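(* Let $(\mathbb{X},\mathcal{X})=(\mathbb{R},\mathcal{B}(\mathbb{R}))$. Let $P$ (depending on a parameter $a>0$) be one of the following random probability measures on $\mathbb{R}$ with base measure $H$: the Dirichlet process $\mathrm{DP}(a,H)$; the Dirichlet process with general stick-breaking weights $\mathrm{DPG}(g_a,H)$ satisfying the moment assumption (M) stated in the context; the two-parameter Poisson-Dirichlet process $\mathrm{PDP}(a,b,H)$; the normalized inverse Gaussian process $\mathrm{N\text{-}IGP}(a,H)$; the normalized generalized gamma process $\mathrm{NGGP}(\sigma,a,H)$; the generalized Dirichlet process $\mathrm{GDP}(a,r,H)$. Assume that $a=n^{\tau}$ for some arbitrarily fixed $\tau>0$. Then, as $n\to\infty$, $$\sup_{x\in\mathbb{R}}\big|P((-\infty,x])-H((-\infty,x])\big|\to0\quad\text{almost surely}.$$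
   Context: $(\Omega,\mathcal{F},\mathbb{P})$ is a complete probability space on which all random variables are defined; $\mathbb{X}=\mathbb{R}$ with Borel $\sigma$-algebra $\mathcal{X}$; $H$ is a nonatomic probability measure on $(\mathbb{X},\mathcal{X})$. $P$ depends on $n$ through $a=n^\tau$; the parameters $b$, $\sigma$, $r$ do not depend on $n$. Stick-breaking process with base measure $H$: a random probability measure $P=\sum_{i=1}^\infty w_i\delta_{\theta_i}$ with $w_1=v_1$, $w_i=v_i\prod_{j=1}^{i-1}(1-v_j)$ for $i\ge2$, where $\theta_1,\theta_2,\dots$ are i.i.d. with law $H$, and the stick-breaking weights $v_1,v_2,\dots$ are $[0,1]$-valued random variables, independent of $(\theta_i)$, such that $\sum_i w_i=1$ a.s. The first five processes below are stick-breaking processes determined by the joint law of $(v_i)$: (1) $\mathrm{DP}(a,H)$, $a>0$: $v_i$ i.i.d. $\mathrm{Beta}(1,a)$. (2) $\mathrm{DPG}(g_a,H)$: $v_i$ i.i.d. with a general distribution $g_a$ on $(0,1)$ depending on $a>0$. Assumption (M): for every $p\in\mathbb{N}$, $\mathbb{E}[v_i^p]=\frac{C_p}{a^{k_p}}+o\left(\frac1{a^{k_p}}\right)$ as $a\to\infty$, where $(k_p)$ is a positive sequence with $jk_i\ge ik_j$ for $i\ge j$, and $(C_p)$ is a sequence of finite constants, independent of $a$. (3) $\mathrm{PDP}(a,b,H)$, $b\in(0,1)$, $a>-b$: $v_i$ independent with $v_i\sim\mathrm{Beta}(1-b,a+ib)$. (4) $\mathrm{N\text{-}IGP}(a,H)$,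 $a>0$: with $K_\mu$ the modified Bessel function of the third type (Macdonald function), for $x\in(0,1)$ $$f_{v_1}(x)=\frac{a^{1/2}x^{-1/2}(1-x)^{-1}}{(2\pi)^{1/2}K_{-1/2}(a)}K_{-1}\Big(\frac{a}{\sqrt{1-x}}\Big),$$ $$f_{v_n|v_1,\dots,v_{n-1}}(x)=\frac{a^{1/2}\prod_{i=1}^{n-1}(1-v_i)^{-1/4}\,x^{-1/2}(1-x)^{-\frac54+\frac n4}}{(2\pi)^{1/2}K_{-n/2}\Big(\frac{a}{\sqrt{\prod_{i=1}^{n-1}(1-v_i)}}\Big)}K_{-\frac12-\frac n2}\Big(\frac{a}{\sqrt{(1-x)\prod_{i=1}^{n-1}(1-v_i)}}\Big),\quad n\ge2.$$ (5) $\mathrm{NGGP}(\sigma,a,H)$, $\sigma\in(0,1)$, $a>0$: with $\Gamma(c;x)=\int_x^\infty u^{c-1}e^{-u}du$ and $(q)_j=q(q+1)\cdots(q+j-1)$, $(q)_0=1$, for $x\in(0,1)$ $$f_{v_1}(x)=\frac{x^{-\sigma}(1-x)^{\sigma-1}e^a}{\Gamma(\sigma)\Gamma(1-\sigma)}\sum_{j=0}^\infty\frac{(1-\sigma)_j}{j!}\frac{a^{j/\sigma}}{(1-x)^j}\Gamma\Big(1-\frac j\sigma;\frac{a}{(1-x)^\sigma}\Big),$$ $$f_{v_n|v_1,\dots,v_{n-1}}(x)=\frac{\sigma\Gamma((n-1)\sigma)x^{-\sigma}(1-x)^{n\sigma-1}}{\Gamma(1-\sigma)\Gamma(n\sigma)}\cdot\frac{\sum_{j=0}^\infty\frac{(1-n\sigma)_j}{j!}\frac{a^{j/\sigma}}{(1-x)^j\prod_{i=1}^{n-1}(1-v_i)^j}\Gamma\Big(n-\frac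 j\sigma;\frac{a}{(1-x)^\sigma\prod_{i=1}^{n-1}(1-v_i)^\sigma}\Big)}{\sum_{j=0}^\infty\frac{(1-(n-1)\sigma)_j}{j!}\frac{a^{j/\sigma}}{\prod_{i=1}^{n-1}(1-v_i)^j}\Gamma\Big(n-1-\frac j\sigma;\frac{a}{\prod_{i=1}^{n-1}(1-v_i)^\sigma}\Big)},\quad n\ge2.$$ (6) $\mathrm{GDP}(a,r,H)$, $a>0$, $r\in\{1,2,\dots\}$: the random probability measure such that for every measurable partition $(A_1,\dots,A_n)$ of $\mathbb{X}$, with $a_i=aH(A_i)$, the vector $(P(A_1),\dots,P(A_n))$ has density on the simplex $\{x_i\ge0,\sum x_i=1\}$ $$\frac{(r!)^a}{\prod_{i=1}^n\Gamma(ra_i)}\prod_{i=1}^nx_i^{ra_i-1}\int_0^\infty t^{ra-1}e^{-rt}\prod_{j=1}^n\Phi_2^{(r-1)}\big(a_j\mathbf{I}_{r-1};ra_j;tx_j\mathbf{J}_{r-1}\big)dt,$$ where $\mathbf{I}_{r-1}=(1,\dots,1)$, $\mathbf{J}_{r-1}=(1,2,\dots,r-1)$ and $\Phi_2^{(N)}(\mathbf{b};c;\mathbf{x})=\sum_{i_1,\dots,i_N\ge0}\frac{(b_1)_{i_1}\cdots(b_N)_{i_N}}{(c)_{i_1+\cdots+i_N}}\frac{x_1^{i_1}\cdots x_N^{i_N}}{i_1!\cdots i_N!}$ is the confluent form of the fourth Lauricella hypergeometric function ($\Phi_2^{(0)}=1$).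
   Formalization: In assumption (M) the constant C_1 is required to be nonzero; with C_1 = 0 allowed the claim fails, e.g. for g_a giving mass e^{-a} to 1/2 and the remaining mass to e^{-2a}. *)

theory Defs
  imports "HOL-Probability.Probability"
begin

section \<open>Random probability measures and stick-breaking\<close>

definition nonatomic :: "'a measure \<Rightarrow> bool" where
  "nonatomic H \<longleftrightarrow>
     (\<forall>A\<in>sets H. emeasure H A > 0 \<longrightarrow>
        (\<exists>B\<in>sets H. B \<subseteq> A \<and> 0 < emeasure H B \<and> emeasure H B < emeasure H A))"

definition random_prob_measure :: "'w measure \<Rightarrow> ('w \<Rightarrow> real measure) \<Rightarrow> bool" where
  "random_prob_measure M P \<longleftrightarrow> P \<in> M \<rightarrow>\<^sub>M prob_algebra borel"

text \<open>
  Sticks, weights and atoms are indexed from 0: \<open>v m\<close> is the stick that is customarily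
  called $v_{m+1}$.
\<close>

definition stick_weight :: "(nat \<Rightarrow> 'w \<Rightarrow> real) \<Rightarrow> nat \<Rightarrow> 'w \<Rightarrow> real" where
  "stick_weight v i \<omega> = v i \<omega> * (\<Prod>j<i. 1 - v j \<omega>)"

definition stick_breaking ::
    "'w measure \<Rightarrow> real measure \<Rightarrow> (nat \<Rightarrow> 'w \<Rightarrow> real) \<Rightarrow> ('w \<Rightarrow> real measure) \<Rightarrow> bool" where
  "stick_breaking M H v P \<longleftrightarrow>
     random_prob_measure M P \<and>
     (\<forall>i. v i \<in> borel_measurable M \<and> (\<forall>\<omega>\<in>space M. 0 \<le> v i \<omega> \<and> v i \<omega> \<le> 1)) \<and>
     (AE \<omega> in M. (\<lambda>i. stick_weight v i \<omega>) sums 1) \<and>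
     (\<exists>\<theta> :: nat \<Rightarrow> 'w \<Rightarrow> real.
        prob_space.indep_vars M (\<lambda>_. borel) \<theta> UNIV \<and>
        (\<forall>i. distr M borel (\<theta> i) = H) \<and>
        prob_space.indep_var M
          (Pi\<^sub>M UNIV (\<lambda>_. borel)) (\<lambda>\<omega> i. v i \<omega>)
          (Pi\<^sub>M UNIV (\<lambda>_. borel)) (\<lambda>\<omega> i. \<theta> i \<omega>) \<and>
        (AE \<omega> in M. \<forall>A\<in>sets borel.
           emeasure (P \<omega>) A = (\<Sum>i. ennreal (stick_weight v i \<omega>) * indicator A (\<theta> i \<omega>))))"

text \<open>
  \<open>f m u\<close> is the conditional density of \<open>v m\<close> given
  \<open>v 0 = u 0, \<dots>, v (m - 1) = u (m - 1)\<close>; only the first \<open>m\<close> values of \<open>u\<close> matter.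
\<close>

definition has_conditional_densities ::
    "'w measure \<Rightarrow> (nat \<Rightarrow> 'w \<Rightarrow> real) \<Rightarrow> (nat \<Rightarrow> (nat \<Rightarrow> real) \<Rightarrow> real \<Rightarrow> real) \<Rightarrow> bool" where
  "has_conditional_densities M v f \<longleftrightarrow>
     (\<forall>m. \<forall>A\<in>sets borel. \<forall>B\<in>sets (Pi\<^sub>M {..<m} (\<lambda>_. borel)).
        emeasure M {\<omega>\<in>space M. (\<lambda>i\<in>{..<m}. v i \<omega>) \<in> B \<and> v m \<omega> \<in> A} =
        (\<integral>\<^sup>+\<omega>. indicator B (\<lambda>i\<in>{..<m}. v i \<omega>) *
               (\<integral>\<^sup>+x. ennreal (f m (\<lambda>i\<in>{..<m}. v i \<omega>) x) * indicator A x \<partial>lborel) \<partial>M))"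


section \<open>Dirichlet, general-weight and two-parameter processes\<close>

definition beta_density :: "real \<Rightarrow> real \<Rightarrow> real \<Rightarrow> real" where
  "beta_density \<alpha> \<beta> x =
     (if 0 < x \<and> x < 1 then x powr (\<alpha> - 1) * (1 - x) powr (\<beta> - 1) / Beta \<alpha> \<beta> else 0)"

definition is_DP :: "'w measure \<Rightarrow> real \<Rightarrow> real measure \<Rightarrow> ('w \<Rightarrow> real measure) \<Rightarrow> bool" where
  "is_DP M a H P \<longleftrightarrow> a > 0 \<and>
     (\<exists>v. stick_breaking M H v P \<and>
          prob_space.indep_vars M (\<lambda>_. borel) v UNIV \<and>
          (\<forall>i. distributed M lborel (v i) (\<lambda>x. ennreal (beta_density 1 a x))))"

definition is_DPG :: "'w measure \<Rightarrow> real measure \<Rightarrow> real measure \<Rightarrow> ('w \<Rightarrow> real measure) \<Rightarrow> bool" where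
  "is_DPG M g H P \<longleftrightarrow>
     (\<exists>v. stick_breaking M H v P \<and>
          prob_space.indep_vars M (\<lambda>_. borel) v UNIV \<and>
          (\<forall>i. distr M borel (v i) = g))"

definition unit_interval_laws :: "(real \<Rightarrow> real measure) \<Rightarrow> bool" where
  "unit_interval_laws g \<longleftrightarrow>
     (\<forall>a>0. prob_space (g a) \<and> sets (g a) = sets borel \<and> emeasure (g a) {0<..<1} = 1)"

text \<open>
  The moments are indexed by \<open>p \<ge> 1\<close> (for \<open>p = 0\<close> the expansion fails, since \<open>k\<close> is positive).
  \<open>C p / a powr k p\<close> is meant as a leading term. Nonvanishing is imposed only on the
  coefficient of the mean: without it the condition would also admit, for instance, the laws giving
  mass \<open>exp (-a)\<close> to 1/2 and the rest to \<open>exp (-2 * a)\<close>, for which the largest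
  weight does not vanish.
\<close>

definition moment_assumption :: "(real \<Rightarrow> real measure) \<Rightarrow> bool" where
  "moment_assumption g \<longleftrightarrow>
     (\<exists>(C :: nat \<Rightarrow> real) (k :: nat \<Rightarrow> real).
        (\<forall>p\<ge>1. k p > 0) \<and>
        (\<forall>j\<ge>1. \<forall>i\<ge>j. real j * k i \<ge> real i * k j) \<and>
        C 1 \<noteq> 0 \<and>
        (\<forall>p\<ge>1. (\<lambda>a. (\<integral>x. x ^ p \<partial>g a) - C p / a powr k p) \<in> o[at_top](\<lambda>a. 1 / a powr k p)))"

definition is_PDP ::
    "'w measure \<Rightarrow> real \<Rightarrow> real \<Rightarrow> real measure \<Rightarrow> ('w \<Rightarrow> real measure) \<Rightarrow> bool" where
  "is_PDP M a b H P \<longleftrightarrow> 0 < b \<and> b < 1 \<and> a > - b \<and>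
     (\<exists>v. stick_breaking M H v P \<and>
          prob_space.indep_vars M (\<lambda>_. borel) v UNIV \<and>
          (\<forall>i. distributed M lborel (v i)
                 (\<lambda>x. ennreal (beta_density (1 - b) (a + real (Suc i) * b) x))))"


section \<open>Normalized inverse Gaussian process\<close>

text \<open>The Macdonald function of real order, for positive argument, by its integral representation.\<close>

definition macdonald :: "real \<Rightarrow> real \<Rightarrow> real" where
  "macdonald \<mu> x = (LBINT t:{0..}. exp (- x * cosh t) * cosh (\<mu> * t))"

text \<open>Here \<open>n = m + 1\<close> is the position of the stick; \<open>m = 0\<close> gives the unconditional
  density of the first stick.\<close>

definition nigp_density :: "real \<Rightarrow> nat \<Rightarrow> (nat \<Rightarrow> real) \<Rightarrow> real \<Rightarrow> real" where
  "nigp_density a m u x =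
     (let n = real (Suc m); R = (\<Prod>i<m. 1 - u i) in
      if 0 < x \<and> x < 1 then
        a powr (1/2) * (\<Prod>i<m. (1 - u i) powr (-1/4)) * x powr (-1/2) * (1 - x) powr (-5/4 + n/4)
        / ((2 * pi) powr (1/2) * macdonald (- n/2) (a / sqrt R))
        * macdonald (- 1/2 - n/2) (a / sqrt ((1 - x) * R))
      else 0)"

definition is_NIGP :: "'w measure \<Rightarrow> real \<Rightarrow> real measure \<Rightarrow> ('w \<Rightarrow> real measure) \<Rightarrow> bool" where
  "is_NIGP M a H P \<longleftrightarrow> a > 0 \<and>
     (\<exists>v. stick_breaking M H v P \<and> has_conditional_densities M v (nigp_density a))"


section \<open>Normalized generalized gamma process\<close>

definition upper_Gamma :: "real \<Rightarrow> real \<Rightarrow> real" where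
  "upper_Gamma c x = (LBINT u:{x<..}. u powr (c - 1) * exp (- u))"

definition nggp_series :: "real \<Rightarrow> real \<Rightarrow> nat \<Rightarrow> real \<Rightarrow> real" where
  "nggp_series \<sigma> a n R =
     (\<Sum>j. pochhammer (1 - real n * \<sigma>) j / fact j * (a powr (real j / \<sigma>) / R ^ j)
           * upper_Gamma (real n - real j / \<sigma>) (a / R powr \<sigma>))"

definition nggp_density :: "real \<Rightarrow> real \<Rightarrow> nat \<Rightarrow> (nat \<Rightarrow> real) \<Rightarrow> real \<Rightarrow> real" where
  "nggp_density \<sigma> a m u x =
     (let n = real (Suc m); R = (\<Prod>i<m. 1 - u i) in
      if \<not> (0 < x \<and> x < 1) then 0
      else if m = 0 then
        x powr (- \<sigma>) * (1 - x) powr (\<sigma> - 1) * exp a / (Gamma \<sigma> * Gamma (1 - \<sigma>))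
        * nggp_series \<sigma> a 1 (1 - x)
      else
        \<sigma> * Gamma ((n - 1) * \<sigma>) * x powr (- \<sigma>) * (1 - x) powr (n * \<sigma> - 1)
        / (Gamma (1 - \<sigma>) * Gamma (n * \<sigma>))
        * (nggp_series \<sigma> a (Suc m) ((1 - x) * R) / nggp_series \<sigma> a m R))"

definition is_NGGP ::
    "'w measure \<Rightarrow> real \<Rightarrow> real \<Rightarrow> real measure \<Rightarrow> ('w \<Rightarrow> real measure) \<Rightarrow> bool" where
  "is_NGGP M \<sigma> a H P \<longleftrightarrow> 0 < \<sigma> \<and> \<sigma> < 1 \<and> a > 0 \<and>
     (\<exists>v. stick_breaking M H v P \<and> has_conditional_densities M v (nggp_density \<sigma> a))"


section \<open>Generalized Dirichlet process\<close>

text \<open>The confluent form of the fourth Lauricella function in \<open>N\<close> variables, indexed by 1 to \<open>N\<close>.\<close>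

definition Phi2 :: "nat \<Rightarrow> (nat \<Rightarrow> real) \<Rightarrow> real \<Rightarrow> (nat \<Rightarrow> real) \<Rightarrow> real" where
  "Phi2 N b c x =
     (\<Sum>\<^sub>\<infinity>i\<in>PiE {1..N} (\<lambda>_. UNIV :: nat set).
        (\<Prod>k=1..N. pochhammer (b k) (i k)) / pochhammer c (\<Sum>k=1..N. i k)
        * (\<Prod>k=1..N. x k ^ i k / fact (i k)))"

text \<open>Partitions and points of the simplex have \<open>m + 1\<close> components, indexed by 0 to \<open>m\<close>; \<open>al i\<close> is
  the mass \<open>a * H (A i)\<close>.\<close>

definition gdp_density ::
    "real \<Rightarrow> nat \<Rightarrow> nat \<Rightarrow> (nat \<Rightarrow> real) \<Rightarrow> (nat \<Rightarrow> real) \<Rightarrow> real" where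
  "gdp_density a r m al x =
     (if \<forall>i\<le>m. 0 \<le> x i then
        fact r powr a / (\<Prod>i\<le>m. Gamma (real r * al i))
        * (\<Prod>i\<le>m. x i powr (real r * al i - 1))
        * (LBINT t:{0<..}. t powr (real r * a - 1) * exp (- real r * t)
             * (\<Prod>j\<le>m. Phi2 (r - 1) (\<lambda>_. al j) (real r * al j) (\<lambda>k. t * x j * real k)))
      else 0)"

text \<open>
  A density on the simplex is a density of the first \<open>m\<close> coordinates with respect to Lebesgue
  measure, the last coordinate being one minus their sum. The formula makes sense
  only if all parameters are positive, so the partition sets are required to be non-null; when
  \<open>H\<close> is nonatomic, null sets of \<open>H\<close> then have \<open>P\<close>-mass 0 almost surely, as they can be covered
  by sets of small positive measure.
\<close>

definition is_GDP ::
    "'w measure \<Rightarrow> real \<Rightarrow> nat \<Rightarrow> real measure \<Rightarrow> ('w \<Rightarrow> real measure) \<Rightarrow> bool" where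
  "is_GDP M a r H P \<longleftrightarrow> a > 0 \<and> r \<ge> 1 \<and> random_prob_measure M P \<and>
     (\<forall>m\<ge>1. \<forall>A :: nat \<Rightarrow> real set.
        (\<forall>i\<le>m. A i \<in> sets borel \<and> measure H (A i) > 0) \<and>
        disjoint_family_on A {..m} \<and> (\<Union>i\<le>m. A i) = UNIV \<longrightarrow>
        distributed M (Pi\<^sub>M {..<m} (\<lambda>_. lborel)) (\<lambda>\<omega>. \<lambda>i\<in>{..<m}. measure (P \<omega>) (A i))
          (\<lambda>x. ennreal (gdp_density a r m (\<lambda>i. a * measure H (A i))
                          (x(m := 1 - (\<Sum>i<m. x i))))))"

end

theory Submission
  imports Defs
begin

text \<open>
  Write \<open>F n x\<close> for the mass that \<open>P n\<close> gives to \<open>{..x}\<close>. By monotonicity and continuity of the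
  distribution function of \<open>H\<close>, it is enough that \<open>F n x\<close> tends almost surely to its limit at countably
  many quantiles, and by Borel--Cantelli this holds once the probabilities that \<open>P n\<close> and \<open>H\<close> differ by
  at least \<open>\<epsilon>\<close> on a fixed set are summable in \<open>n\<close>; no joint law of the \<open>P n\<close> is needed.

  For a stick-breaking process, condition on the weights \<open>w\<close>. Hoeffding's inequality bounds the
  deviation probability by \<open>2 * exp (- 2 * \<epsilon>\<^sup>2 / (\<Sum>i. w i ^ 2))\<close>, hence by a constant times the sum of the
  \<open>q\<close>-th moments of the weights, for any \<open>q\<close>. If the conditional \<open>q\<close>-th moment of each stick given the
  previous ones is at most \<open>\<rho>\<close> times its conditional mean, this sum is at most \<open>\<rho>\<close>, because the weights
  add up to 1. For the Beta, Macdonald and incomplete Gamma densities, \<open>\<rho>\<close> is of order \<open>a powr (1 - q)\<close>: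
  each of these densities is \<open>x powr (- s) * exp (- c * x)\<close>, with \<open>c\<close> proportional to \<open>a\<close>, times a
  nonincreasing function. Taking \<open>q\<close> large gives summability for every \<open>\<tau>\<close>.

  For the generalized Dirichlet process, the law of the mass of a set is that of a ratio
  \<open>X / (X + Y)\<close> with independent \<open>X\<close> and \<open>Y\<close>, both sums of independent Gamma variables,
  and Chernoff's bound gives exponential decay in \<open>a\<close>.
\<close>

section \<open>Moment ratios of tilted densities\<close>

text \<open>For the Dirichlet process a variance bound gives deviation probabilities of order
  \<open>1 / a\<close>, hence \<open>n powr (- \<tau>)\<close>, which is not summable for \<tau>
  \<le> 1; this forces high moments. The obstacle is then that sticks may be dependent, with
  conditional laws whose normalising constants are Macdonald functions or incomplete Gamma series
  evaluated at the earlier sticks. A quotient of two moments of the same conditional law cancels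
  these constants: only the shape of the density in the current stick is left, and a monotone factor
  in it can be discarded, uniformly in the past and in the position of the stick. The moment
  assumption enters through the same quotient, because \<open>k q\<close> \<ge>
  \<open>q * k 1\<close> makes it of order \<open>a powr (- k 1 * (q - 1))\<close>. Comparing with
  the mean rather than bounding moments absolutely also dispenses with any rate of decay of the
  weights along the sequence. The generalized Dirichlet process is given only by densities of finite
  partitions; it is handled through the partition into a set and its complement, a lower deviation
  of one cell being an upper deviation of the other.\<close>

lemma power_div_fact_le_exp:
  fixes x :: real
  assumes "0 \<le> x"
  shows "x ^ k / fact k \<le> exp x"
proof -
  have "x ^ k /\<^sub>R fact k \<le> (\<Sum>i. x ^ i /\<^sub>R fact i)"
    using summable_exp_generic[of x] assms
    by (intro sum_le_suminf[of _ "{k}", simplified]) auto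
  thus ?thesis by (simp add: exp_def divide_inverse mult.commute)
qed

lemma nn_integral_Gamma_scaled:
  fixes z s :: real
  assumes "z > 0" "s > 0"
  shows "(\<integral>\<^sup>+x. ennreal (indicator {0<..} x * x powr (z - 1) * exp (- s * x)) \<partial>lborel)
           = ennreal (Gamma z / s powr z)"
proof -
  let ?h = "\<lambda>t. ennreal (indicator {0<..} t * t powr (z - 1) * exp (- s * t))"
  have "ennreal (Gamma z) = (\<integral>\<^sup>+t. ennreal (indicator {0..} t * t powr (z - 1) / exp t) \<partial>lborel)"
    using Gamma_conv_nn_integral_real[OF assms(1)] by simp
  also have "\<dots> = ennreal \<bar>s\<bar> * (\<integral>\<^sup>+x. ennreal (indicator {0..} (0 + s * x) * (0 + s * x) powr (z - 1) / exp (0 + s * x)) \<partial>lborel)"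
    by (rule nn_integral_real_affine) (use assms in auto)
  also have "(\<integral>\<^sup>+x. ennreal (indicator {0..} (0 + s * x) * (0 + s * x) powr (z - 1) / exp (0 + s * x)) \<partial>lborel)
      = (\<integral>\<^sup>+x. ennreal (s powr (z - 1)) * ?h x \<partial>lborel)"
    using assms by (intro nn_integral_cong)
      (auto simp: indicator_def powr_mult exp_minus field_simps zero_le_mult_iff simp flip: ennreal_mult')
  also have "\<dots> = ennreal (s powr (z - 1)) * integral\<^sup>N lborel ?h"
    by (intro nn_integral_cmult) auto
  finally have "ennreal (Gamma z) = ennreal (s powr z) * integral\<^sup>N lborel ?h"
    using assms by (simp add: powr_diff mult.assoc[symmetric] ennreal_mult'[symmetric])
  hence "ennreal (1 / s powr z) * ennreal (Gamma z) = ennreal (1 / s powr z) * ennreal (s powr z) * integral\<^sup>N lborel ?h"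
    by (simp add: mult.assoc)
  thus ?thesis using assms
    by (simp add: ennreal_mult'[symmetric] )
qed

text \<open>Single-crossing argument: \<open>x ^ q - \<epsilon> * x\<close> changes sign once, at \<open>\<delta>\<close>, so multiplying
  the base density by a nonincreasing factor \<open>G\<close> can only favour the negative part.\<close>

lemma moment_ratio_decreasing_factor:
  fixes f0 G :: "real \<Rightarrow> real" and \<epsilon> :: real and q :: nat
  assumes [measurable]: "f0 \<in> borel_measurable borel" "(\<lambda>x. f0 x * G x) \<in> borel_measurable borel"
    and f0: "\<And>x. 0 \<le> f0 x" "\<And>x. x \<notin> {0<..<1} \<Longrightarrow> f0 x = 0"
    and G: "\<And>x. x \<in> {0<..<1} \<Longrightarrow> 0 \<le> G x" "\<And>x y. 0 < x \<Longrightarrow> x \<le> y \<Longrightarrow> y < 1 \<Longrightarrow> G y \<le> G x"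
    and q: "2 \<le> q" and \<epsilon>: "0 < \<epsilon>"
    and fin: "(\<integral>\<^sup>+x. ennreal (x * f0 x) \<partial>lborel) < \<infinity>"
    and base: "(\<integral>\<^sup>+x. ennreal (x ^ q * f0 x) \<partial>lborel) \<le> ennreal \<epsilon> * (\<integral>\<^sup>+x. ennreal (x * f0 x) \<partial>lborel)"
  shows "(\<integral>\<^sup>+x. ennreal (x ^ q * (f0 x * G x)) \<partial>lborel)
           \<le> ennreal \<epsilon> * (\<integral>\<^sup>+x. ennreal (x * (f0 x * G x)) \<partial>lborel)"
proof (cases "\<epsilon> < 1")
  \<comment> \<open>The crossing point lies in the unit interval only for \<epsilon> < 1; for larger
    \<epsilon> the bound \<open>x ^ q\<close> \<le> \<open>x\<close> \<le>
    \<open>\<epsilon> * x\<close> holds pointwise.\<close>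
  case False
  have "(\<integral>\<^sup>+x. ennreal (x ^ q * (f0 x * G x)) \<partial>lborel) \<le> (\<integral>\<^sup>+x. ennreal \<epsilon> * ennreal (x * (f0 x * G x)) \<partial>lborel)"
  proof (intro nn_integral_mono)
    fix x :: real
    show "ennreal (x ^ q * (f0 x * G x)) \<le> ennreal \<epsilon> * ennreal (x * (f0 x * G x))"
    proof (cases "x \<in> {0<..<1}")
      case True
      have "x ^ q \<le> x ^ 1" using True q by (intro power_decreasing) auto
      also have "\<dots> \<le> \<epsilon> * x" using False True by simp
      finally have "x ^ q * (f0 x * G x) \<le> \<epsilon> * x * (f0 x * G x)"
        using f0 G(1)[OF True] by (intro mult_right_mono) auto
      thus ?thesis using \<epsilon> by (simp add: mult.assoc ennreal_leI flip: ennreal_mult')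
    qed (simp add: f0)
  qed
  also have "\<dots> = ennreal \<epsilon> * (\<integral>\<^sup>+x. ennreal (x * (f0 x * G x)) \<partial>lborel)"
    by (intro nn_integral_cmult) auto
  finally show ?thesis .
next
  case True
  define \<delta> where "\<delta> = \<epsilon> powr (1 / real (q - 1))"
  have \<delta>: "0 < \<delta>" "\<delta> < 1" using \<epsilon> True q by (auto simp: \<delta>_def powr01_less_one)
  have \<delta>q: "\<delta> ^ (q - 1) = \<epsilon>"
    using q \<epsilon> by (simp add: \<delta>_def powr_powr flip: powr_realpow)
  define D where "D = G \<delta>"
  have D: "0 \<le> D" using \<delta> G by (auto simp: D_def)
  let ?I = "\<lambda>h. (\<integral>\<^sup>+x. ennreal (h x) \<partial>lborel)"
  \<comment> \<open>Subtraction is unsafe in \<open>ennreal\<close>, so the integrated form of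
    \<open>(x ^ (q - 1) - \<epsilon>) * (G x - D)\<close> \<le> 0 is written with the negative terms
    moved across. The common term is cancelled at the end, which is where finiteness of the mean is
    used.\<close>
  have "?I (\<lambda>x. x ^ q * (f0 x * G x)) + ennreal (\<epsilon> * D) * ?I (\<lambda>x. x * f0 x)
      = (\<integral>\<^sup>+x. ennreal (x ^ q * (f0 x * G x)) + ennreal (\<epsilon> * D) * ennreal (x * f0 x) \<partial>lborel)"
    by (simp add: nn_integral_add nn_integral_cmult)
  also have "\<dots> \<le> (\<integral>\<^sup>+x. ennreal \<epsilon> * ennreal (x * (f0 x * G x)) + ennreal D * ennreal (x ^ q * f0 x) \<partial>lborel)"
  proof (intro nn_integral_mono)
    fix x :: real
    show "ennreal (x ^ q * (f0 x * G x)) + ennreal (\<epsilon> * D) * ennreal (x * f0 x)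
       \<le> ennreal \<epsilon> * ennreal (x * (f0 x * G x)) + ennreal D * ennreal (x ^ q * f0 x)"
    proof (cases "x \<in> {0<..<1}")
      case x: True
      have xq: "x ^ q = x * x ^ (q - 1)" using q by (simp flip: power_Suc)
      have neg: "(x ^ (q - 1) - \<epsilon>) * (G x - D) \<le> 0"
      proof (cases "x \<le> \<delta>")
        case True
        have "x ^ (q - 1) \<le> \<epsilon>" using True x \<delta>q by (metis greaterThanLessThan_iff less_imp_le power_mono)
        moreover have "D \<le> G x" unfolding D_def using True x \<delta> by (intro G) auto
        ultimately show ?thesis by (simp add: mult_nonpos_nonneg)
      next
        case False
        have "\<epsilon> \<le> x ^ (q - 1)" using False x \<delta>q \<delta> by (metis less_imp_le not_le power_mono)
        moreover have "G x \<le> D" unfolding D_def using False x \<delta> by (intro G) auto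
        ultimately show ?thesis by (simp add: mult_nonneg_nonpos)
      qed
      hence "x * f0 x * ((x ^ (q - 1) - \<epsilon>) * (G x - D)) \<le> 0"
        using x f0(1)[of x] by (intro mult_nonneg_nonpos neg) simp
      hence "x ^ q * (f0 x * G x) + \<epsilon> * D * (x * f0 x) \<le> \<epsilon> * (x * (f0 x * G x)) + D * (x ^ q * f0 x)"
        unfolding xq by (simp add: algebra_simps)
      moreover have "0 \<le> f0 x" "0 \<le> G x" "0 \<le> x" using f0 G(1)[OF x] x by auto
      ultimately show ?thesis using \<epsilon> D
        by (simp add: ennreal_leI flip: ennreal_mult ennreal_plus)
    qed (simp add: f0)
  qed
  also have "\<dots> = ennreal \<epsilon> * ?I (\<lambda>x. x * (f0 x * G x)) + ennreal D * ?I (\<lambda>x. x ^ q * f0 x)"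
    by (simp add: nn_integral_add nn_integral_cmult)
  also have "\<dots> \<le> ennreal \<epsilon> * ?I (\<lambda>x. x * (f0 x * G x)) + ennreal (\<epsilon> * D) * ?I (\<lambda>x. x * f0 x)"
    using mult_left_mono[OF base, of "ennreal D"] D \<epsilon>
    by (intro add_left_mono) (simp add: ennreal_mult mult_ac)
  finally show ?thesis using fin
    by (subst (asm) (1 2) add.commute) (auto simp: ennreal_add_left_cancel_le ennreal_mult_eq_top_iff)
qed

text \<open>Extending the integral to the half-line bounds the higher moment by a Gamma integral.
  The mean is bounded below by its part over the window from \<open>1 / (2 * c)\<close> to
  \<open>1 / c\<close>, where the tilt costs at most a factor \<open>exp (- 1)\<close>. The constant
  12 collects 2 from \<open>(1/2) powr (1 - s)\<close>, 3 from \<open>exp (- 1)\<close> and 2 from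
  the width of the window.\<close>

lemma moment_ratio_base:
  fixes s c :: real and q :: nat
  assumes s: "0 \<le> s" "s < 1" and c: "1 \<le> c"
  defines "f0 \<equiv> (\<lambda>x. indicator {0<..<1} x * x powr (- s) * exp (- c * x))"
  shows "(\<integral>\<^sup>+x. ennreal (x ^ q * f0 x) \<partial>lborel)
            \<le> ennreal (12 * Gamma (real q + 1 - s) * c powr (1 - real q)) * (\<integral>\<^sup>+x. ennreal (x * f0 x) \<partial>lborel)"
    and "(\<integral>\<^sup>+x. ennreal (x * f0 x) \<partial>lborel) < \<infinity>"
proof -
  have ub: "(\<integral>\<^sup>+x. ennreal (x ^ p * f0 x) \<partial>lborel) \<le> ennreal (Gamma (real p + 1 - s) / c powr (real p + 1 - s))" for p
  proof -
    have "(\<integral>\<^sup>+x. ennreal (x ^ p * f0 x) \<partial>lborel)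
        \<le> (\<integral>\<^sup>+x. ennreal (indicator {0<..} x * x powr ((real p + 1 - s) - 1) * exp (- c * x)) \<partial>lborel)"
      by (intro nn_integral_mono ennreal_leI)
        (auto simp: f0_def indicator_def powr_diff powr_minus field_simps powr_realpow)
    also have "\<dots> = ennreal (Gamma (real p + 1 - s) / c powr (real p + 1 - s))"
      using s c by (intro nn_integral_Gamma_scaled) auto
    finally show ?thesis .
  qed
  have "(\<integral>\<^sup>+x. ennreal (x * f0 x) \<partial>lborel) \<le> ennreal (Gamma (real 1 + 1 - s) / c powr (real 1 + 1 - s))"
    using ub[of 1] by simp
  also have "\<dots> < \<infinity>" by simp
  finally show "(\<integral>\<^sup>+x. ennreal (x * f0 x) \<partial>lborel) < \<infinity>" .
  have lb: "ennreal (1 / 12 * c powr (s - 2)) \<le> (\<integral>\<^sup>+x. ennreal (x * f0 x) \<partial>lborel)"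
  proof -
    have "1 / 12 * c powr (s - 2) \<le> (1 / (2 * c)) powr (1 - s) * exp (- 1) * (1 / (2 * c))"
    proof -
      have "(1/2) powr 1 \<le> (1/2) powr (1 - s)"
        using s by (intro powr_mono') auto
      hence "(1/2) * c powr (s - 1) \<le> (1/2) powr (1 - s) * c powr (s - 1)"
        by (intro mult_right_mono) auto
      also have "\<dots> = (1 / (2 * c)) powr (1 - s)"
        using c by (simp add: powr_divide powr_mult powr_diff field_simps)
      finally have A: "(1/2) * c powr (s - 1) \<le> (1 / (2 * c)) powr (1 - s)" .
      have B: "1 / 3 \<le> exp (- 1 :: real)"
        using exp_le by (simp add: exp_minus field_simps)
      have "1 / 12 * c powr (s - 2) = (1/2 * c powr (s - 1)) * (1/3) * (1 / (2 * c))"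
        using c by (simp add: powr_diff power2_eq_square)
      also have "\<dots> \<le> (1 / (2 * c)) powr (1 - s) * exp (- 1) * (1 / (2 * c))"
        using A B c by (intro mult_right_mono mult_mono) auto
      finally show ?thesis .
    qed
    hence "ennreal (1 / 12 * c powr (s - 2)) \<le> ennreal ((1 / (2 * c)) powr (1 - s) * exp (- 1) * (1 / (2 * c)))"
      by (rule ennreal_leI)
    also have "\<dots> = (\<integral>\<^sup>+x. ennreal ((1 / (2 * c)) powr (1 - s) * exp (- 1)) * indicator {1/(2*c)<..<1/c} x \<partial>lborel)"
      using c by (subst nn_integral_cmult_indicator) (auto simp: field_simps ennreal_mult[symmetric])
    also have "\<dots> \<le> (\<integral>\<^sup>+x. ennreal (x * f0 x) \<partial>lborel)"
    proof (intro nn_integral_mono)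
      fix x :: real
      show "ennreal ((1 / (2 * c)) powr (1 - s) * exp (- 1)) * indicator {1/(2*c)<..<1/c} x \<le> ennreal (x * f0 x)"
      proof (cases "x \<in> {1/(2*c)<..<1/c}")
        case True
        have "0 < 1 / (2 * c)" "1 / c \<le> 1" using c by auto
        with True have x: "0 < x" "x < 1"
          unfolding greaterThanLessThan_iff by (linarith, linarith)
        have "c * x \<le> 1" using True c by (simp add: field_simps)
        hence "(1 / (2 * c)) powr (1 - s) * exp (- 1) \<le> x powr (1 - s) * exp (- c * x)"
          using s True c x by (intro mult_mono powr_mono2) auto
        also have "\<dots> = x * f0 x" using x by (simp add: f0_def powr_diff powr_minus field_simps)
        finally show ?thesis using True by (simp add: ennreal_leI)
      qed simp
    qed
    finally show ?thesis .
  qed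
  have "(\<integral>\<^sup>+x. ennreal (x ^ q * f0 x) \<partial>lborel) \<le> ennreal (Gamma (real q + 1 - s) / c powr (real q + 1 - s))"
    by (rule ub)
  also have "Gamma (real q + 1 - s) / c powr (real q + 1 - s)
      = 12 * Gamma (real q + 1 - s) * c powr (1 - real q) * (1 / 12 * c powr (s - 2))"
  proof -
    have "c powr (1 - real q) * c powr (s - 2) = c powr (- (real q + 1 - s))"
      by (simp add: algebra_simps flip: powr_add)
    also have "\<dots> = 1 / c powr (real q + 1 - s)" by (rule powr_minus_divide)
    finally show ?thesis by (simp add: mult.assoc)
  qed
  also have "ennreal \<dots> = ennreal (12 * Gamma (real q + 1 - s) * c powr (1 - real q)) * ennreal (1 / 12 * c powr (s - 2))"
    using s by (intro ennreal_mult) (auto intro!: mult_nonneg_nonneg Gamma_real_nonneg)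
  also have "\<dots> \<le> ennreal (12 * Gamma (real q + 1 - s) * c powr (1 - real q)) * (\<integral>\<^sup>+x. ennreal (x * f0 x) \<partial>lborel)"
    by (intro mult_left_mono lb) auto
  finally show "(\<integral>\<^sup>+x. ennreal (x ^ q * f0 x) \<partial>lborel)
      \<le> ennreal (12 * Gamma (real q + 1 - s) * c powr (1 - real q)) * (\<integral>\<^sup>+x. ennreal (x * f0 x) \<partial>lborel)" .
qed

text \<open>The form in which all explicit families are treated: \<open>K\<close> carries the
  normalisation and everything that depends on earlier sticks, and it cancels. Even its sign can
  stay open, since for negative \<open>K\<close> the coercion to \<open>ennreal\<close> makes both
  integrals 0.\<close>

lemma moment_ratio:
  fixes f g :: "real \<Rightarrow> real" and K s c :: real and q :: nat
  assumes meas: "f \<in> borel_measurable borel"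
    and f: "\<And>x. x \<in> {0<..<1} \<Longrightarrow> f x = K * (x powr (- s) * g x)" "\<And>x. x \<notin> {0<..<1} \<Longrightarrow> f x = 0"
    and g: "\<And>x. x \<in> {0<..<1} \<Longrightarrow> 0 \<le> g x"
      "\<And>x y. 0 < x \<Longrightarrow> x \<le> y \<Longrightarrow> y < 1 \<Longrightarrow> exp (c * y) * g y \<le> exp (c * x) * g x"
    and s: "0 \<le> s" "s < 1" and c: "1 \<le> c" and q: "2 \<le> q"
  shows "(\<integral>\<^sup>+x. ennreal (x ^ q) * ennreal (f x) \<partial>lborel)
           \<le> ennreal (12 * Gamma (real q + 1 - s) * c powr (1 - real q))
              * (\<integral>\<^sup>+x. ennreal x * ennreal (f x) \<partial>lborel)"
proof (cases "K \<ge> 0")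
  case False
  have "ennreal (f x) = 0" for x
  proof (cases "x \<in> {0<..<1}")
    case True
    then have "f x \<le> 0"
      using f(1)[OF True] g(1)[OF True] False by (simp add: mult_nonpos_nonneg)
    thus ?thesis by (rule ennreal_neg)
  qed (simp add: f)
  thus ?thesis by simp
next
  case K: True
  define f0 where "f0 = (\<lambda>x. indicator {0<..<1} x * x powr (- s) * exp (- c * x))"
  define G where "G x = K * (exp (c * x) * g x)" for x
  have eq: "f0 x * G x = f x" for x
    by (cases "x \<in> {0<..<1}") (simp_all add: f0_def G_def f exp_minus field_simps)
  have nn: "0 \<le> f x" for x
    using f[of x] g(1)[of x] K by (cases "x \<in> {0<..<1}") auto
  have "(\<integral>\<^sup>+x. ennreal (x ^ q * (f0 x * G x)) \<partial>lborel)
       \<le> ennreal (12 * Gamma (real q + 1 - s) * c powr (1 - real q)) * (\<integral>\<^sup>+x. ennreal (x * (f0 x * G x)) \<partial>lborel)"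
  proof (rule moment_ratio_decreasing_factor)
    show "f0 \<in> borel_measurable borel" by (simp add: f0_def)
    show "(\<lambda>x. f0 x * G x) \<in> borel_measurable borel" using meas by (simp add: eq)
    show "0 < 12 * Gamma (real q + 1 - s) * c powr (1 - real q)"
      using s c by (intro mult_pos_pos Gamma_real_pos) auto
  qed (use moment_ratio_base[OF s c, folded f0_def] q K g in
        \<open>auto simp: f0_def G_def mult_left_mono\<close>)
  also have "(\<integral>\<^sup>+x. ennreal (x ^ q * (f0 x * G x)) \<partial>lborel) = (\<integral>\<^sup>+x. ennreal (x ^ q) * ennreal (f x) \<partial>lborel)"
    unfolding eq by (intro nn_integral_cong) (metis ennreal_mult'' nn)
  also have "(\<integral>\<^sup>+x. ennreal (x * (f0 x * G x)) \<partial>lborel) = (\<integral>\<^sup>+x. ennreal x * ennreal (f x) \<partial>lborel)"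
    unfolding eq by (intro nn_integral_cong) (metis ennreal_mult'' nn)
  finally show ?thesis .
qed

section \<open>Concentration of stick-breaking processes\<close>

text \<open>If \<mu> is the largest weight, the sum of squares is at most \<mu> times the total
  mass, hence at most \<mu>; and \<open>\<mu> ^ k\<close> is one of the summands on the
  right.\<close>

lemma sum_squares_power_le:
  fixes w :: "nat \<Rightarrow> real"
  assumes w: "\<And>i. i < N \<Longrightarrow> 0 \<le> w i" and sum: "(\<Sum>i<N. w i) \<le> 1" and k: "1 \<le> k"
  shows "(\<Sum>i<N. (w i)\<^sup>2) ^ k \<le> (\<Sum>i<N. w i ^ k)"
proof (cases "N = 0")
  case False
  define \<mu> where "\<mu> = Max (w ` {..<N})"
  have "\<mu> \<in> w ` {..<N}" unfolding \<mu>_def using False by (intro Max_in) auto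
  then obtain l where l: "l < N" "\<mu> = w l" by auto
  have le: "w i \<le> \<mu>" if "i < N" for i unfolding \<mu>_def using that by (intro Max_ge) auto
  have "(\<Sum>i<N. (w i)\<^sup>2) \<le> (\<Sum>i<N. \<mu> * w i)"
    using le w by (intro sum_mono) (auto simp: power2_eq_square intro!: mult_right_mono)
  also have "\<dots> \<le> \<mu> * 1"
    unfolding sum_distrib_left[symmetric] using sum w[of l] l by (intro mult_left_mono) auto
  finally have "(\<Sum>i<N. (w i)\<^sup>2) ^ k \<le> w l ^ k"
    using l by (intro power_mono sum_nonneg) auto
  also have "\<dots> \<le> (\<Sum>i<N. w i ^ k)"
    using w l by (intro member_le_sum) auto
  finally show ?thesis .
qed (use k in \<open>auto simp: power_0_left\<close>)

text \<open>Trades the exponential in Hoeffding's bound for a power of the sum of squared weights,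
  whose expectation is controlled by weight moments.\<close>

lemma exp_minus_le_fact_power:
  fixes x :: real
  assumes "x > 0"
  shows "exp (- x) \<le> fact k / x ^ k"
  using power_div_fact_le_exp[of x k] assms by (simp add: exp_minus field_simps)

lemma weighted_indicator_deviation:
  fixes c :: "nat \<Rightarrow> real" and \<theta> :: "nat \<Rightarrow> 'w \<Rightarrow> real"
  assumes M: "prob_space M"
    and indep: "prob_space.indep_vars M (\<lambda>_. borel) \<theta> UNIV"
    and H: "\<And>i. distr M borel (\<theta> i) = H"
    and A: "A \<in> sets borel" and c: "\<And>i. i < N \<Longrightarrow> 0 \<le> c i" and \<epsilon>: "\<epsilon> > 0"
  shows "measure M {\<omega>\<in>space M. \<epsilon> \<le> \<bar>\<Sum>i<N. c i * (indicator A (\<theta> i \<omega>) - measure H A)\<bar>}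
           \<le> 2 * fact k * ((\<Sum>i<N. (c i)\<^sup>2) / (2 * \<epsilon>\<^sup>2)) ^ k"
proof -
  interpret prob_space M by fact
  define S where "S = (\<Sum>i<N. (c i)\<^sup>2)"
  have "0 \<le> S" unfolding S_def by (intro sum_nonneg) auto
  have \<theta>[measurable]: "\<theta> i \<in> borel_measurable M" for i
    using indep by (auto simp: indep_vars_def)
  note [measurable] = A
  show ?thesis
  proof (cases "S = 0")
    \<comment> \<open>Hoeffding's inequality divides by the sum of squared ranges; if that is 0, all
      coefficients vanish and the event is empty because \<epsilon> > 0.\<close>
    case True
    hence "c i = 0" if "i < N" for i
      unfolding S_def using that by (subst (asm) sum_nonneg_eq_0_iff) auto
    hence "(\<Sum>i<N. c i * (indicator A (\<theta> i \<omega>) - measure H A)) = 0" for \<omega> by simp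
    thus ?thesis using \<epsilon> \<open>0 \<le> S\<close> by (simp add: S_def)
  next
    case False
    with \<open>0 \<le> S\<close> have S: "0 < S" by simp
    define X where "X i \<omega> = c i * indicator A (\<theta> i \<omega>)" for i \<omega>
    have iX: "indep_vars (\<lambda>_. borel) X {..<N}"
      unfolding X_def by (intro indep_vars_compose2[OF indep_vars_subset[OF indep]]) auto
    interpret Hoeffding_ineq M "{..<N}" X "\<lambda>_. 0" c "\<Sum>i<N. expectation (X i)"
      by unfold_locales (use iX c in \<open>auto simp: X_def indicator_def\<close>)
    have E: "expectation (X i) = c i * measure H A" for i
    proof -
      have "measure H A = measure M (\<theta> i -` A \<inter> space M)"
        using A by (subst H[of i, symmetric]) (simp add: measure_distr)
      also have "\<dots> = expectation (indicator (\<theta> i -` A \<inter> space M))" by simp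
      also have "\<dots> = expectation (\<lambda>\<omega>. indicator A (\<theta> i \<omega>))"
        by (intro Bochner_Integration.integral_cong) (auto simp: indicator_def)
      finally show ?thesis by (simp add: X_def[abs_def])
    qed
    have "prob {\<omega>\<in>space M. \<epsilon> \<le> \<bar>\<Sum>i<N. c i * (indicator A (\<theta> i \<omega>) - measure H A)\<bar>}
        = prob {x \<in> space M. \<epsilon> \<le> \<bar>(\<Sum>i<N. X i x) - (\<Sum>i<N. expectation (X i))\<bar>}"
      by (intro arg_cong[where f = prob] Collect_cong)
        (simp add: E X_def right_diff_distrib sum_subtractf)
    also have "\<dots> \<le> 2 * exp (- 2 * \<epsilon>\<^sup>2 / (\<Sum>i<N. (c i - 0)\<^sup>2))"
      using S \<epsilon> by (intro Hoeffding_ineq_abs_ge) (auto simp: S_def)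
    also have "\<dots> = 2 * exp (- (2 * \<epsilon>\<^sup>2 / S))" by (simp add: S_def)
    also have "\<dots> \<le> 2 * (fact k / (2 * \<epsilon>\<^sup>2 / S) ^ k)"
      using S \<epsilon> by (intro mult_left_mono exp_minus_le_fact_power) auto
    finally show ?thesis by (simp add: S_def power_divide)
  qed
qed

section \<open>Deviations of a stick-breaking measure on a fixed set\<close>

lemma sum_stick_weight: "(\<Sum>i<N. stick_weight v i \<omega>) = 1 - (\<Prod>j<N. 1 - v j \<omega>)"
  by (induction N) (auto simp: stick_weight_def algebra_simps)

lemma stick_weight_nonneg:
  assumes "\<And>i. 0 \<le> v i \<omega> \<and> v i \<omega> \<le> 1"
  shows "0 \<le> stick_weight v i \<omega>"
  using assms by (auto simp: stick_weight_def intro!: mult_nonneg_nonneg prod_nonneg)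

lemma sum_stick_weight_le_1:
  assumes "\<And>i. 0 \<le> v i \<omega> \<and> v i \<omega> \<le> 1"
  shows "(\<Sum>i<N. stick_weight v i \<omega>) \<le> 1"
  using assms by (auto simp: sum_stick_weight intro!: prod_nonneg)

lemma measurable_stick_weight:
  assumes "\<And>i. v i \<in> borel_measurable M"
  shows "stick_weight v i \<in> borel_measurable M"
  unfolding stick_weight_def using assms by measurable

text \<open>Independence makes the joint law of sticks and atoms a product measure, so by Fubini the
  sticks can be frozen and Hoeffding's inequality applied to the atoms alone. The bound does not
  depend on \<open>N\<close>, which allows a passage to the limit afterwards.\<close>

lemma truncated_deviation:
  fixes v :: "nat \<Rightarrow> 'w \<Rightarrow> real" and \<theta> :: "nat \<Rightarrow> 'w \<Rightarrow> real"
  assumes M: "prob_space M"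
    and v: "\<And>i. v i \<in> borel_measurable M" "\<And>i \<omega>. \<omega> \<in> space M \<Longrightarrow> 0 \<le> v i \<omega> \<and> v i \<omega> \<le> 1"
    and indep: "prob_space.indep_vars M (\<lambda>_. borel) \<theta> UNIV"
    and H: "\<And>i. distr M borel (\<theta> i) = H"
    and indep2: "prob_space.indep_var M
          (Pi\<^sub>M UNIV (\<lambda>_. borel)) (\<lambda>\<omega> i. v i \<omega>) (Pi\<^sub>M UNIV (\<lambda>_. borel)) (\<lambda>\<omega> i. \<theta> i \<omega>)"
    and A: "A \<in> sets borel" and \<epsilon>: "\<epsilon> > 0" and k: "1 \<le> k"
    and mom: "\<And>m. (\<integral>\<^sup>+\<omega>. ennreal (stick_weight v m \<omega> ^ k) \<partial>M)
                 \<le> \<rho> * (\<integral>\<^sup>+\<omega>. ennreal (stick_weight v m \<omega>) \<partial>M)"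
  shows "emeasure M {\<omega>\<in>space M. \<epsilon> \<le> \<bar>\<Sum>i<N. stick_weight v i \<omega> * (indicator A (\<theta> i \<omega>) - measure H A)\<bar>}
           \<le> ennreal (2 * fact k / (2 * \<epsilon>\<^sup>2) ^ k) * \<rho>"
proof -
  interpret prob_space M by fact
  let ?S = "Pi\<^sub>M UNIV (\<lambda>_. borel) :: (nat \<Rightarrow> real) measure"
  define V where "V = (\<lambda>\<omega> i. v i \<omega>)"
  define T where "T = (\<lambda>\<omega> i. \<theta> i \<omega>)"
  have rv[measurable]: "V \<in> M \<rightarrow>\<^sub>M ?S" "T \<in> M \<rightarrow>\<^sub>M ?S"
    using indep2 unfolding V_def T_def by (auto dest: indep_var_rv1 indep_var_rv2)
  have prod: "distr M (?S \<Otimes>\<^sub>M ?S) (\<lambda>\<omega>. (V \<omega>, T \<omega>)) = distr M ?S V \<Otimes>\<^sub>M distr M ?S T"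
    using indep2 unfolding indep_var_distribution_eq V_def T_def by simp
  interpret DT: prob_space "distr M ?S T" by (rule prob_space_distr) simp
  note [measurable] = A v(1)
  \<comment> \<open>The weights as functions of the whole stick sequence, so that the deviation
    becomes an event \<open>B\<close> in the product of the two sequence spaces.\<close>
  define W where "W u i = u i * (\<Prod>j<i. 1 - u j)" for u :: "nat \<Rightarrow> real" and i
  have W: "W (V \<omega>) i = stick_weight v i \<omega>" for \<omega> i
    by (simp add: W_def V_def stick_weight_def)
  have [measurable]: "(\<lambda>u. W u i) \<in> borel_measurable ?S" for i
    unfolding W_def by measurable
  define B where "B = {z \<in> space (?S \<Otimes>\<^sub>M ?S). \<epsilon> \<le> \<bar>\<Sum>i<N. W (fst z) i * (indicator A (snd z i) - measure H A)\<bar>}"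
  have [measurable]: "B \<in> sets (?S \<Otimes>\<^sub>M ?S)"
    unfolding B_def by measurable
  have "emeasure M {\<omega>\<in>space M. \<epsilon> \<le> \<bar>\<Sum>i<N. stick_weight v i \<omega> * (indicator A (\<theta> i \<omega>) - measure H A)\<bar>}
      = emeasure (distr M (?S \<Otimes>\<^sub>M ?S) (\<lambda>\<omega>. (V \<omega>, T \<omega>))) B"
    by (simp add: emeasure_distr) (auto simp: B_def W T_def space_pair_measure space_PiM intro!: arg_cong[where f = "emeasure M"])
  also have "\<dots> = (\<integral>\<^sup>+u. emeasure (distr M ?S T) (Pair u -` B) \<partial>distr M ?S V)"
    unfolding prod by (intro DT.emeasure_pair_measure_alt) simp
  also have "\<dots> = (\<integral>\<^sup>+\<omega>. emeasure (distr M ?S T) (Pair (V \<omega>) -` B) \<partial>M)"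
    using DT.measurable_emeasure_Pair[of B ?S] by (subst nn_integral_distr) (auto cong: sets_pair_measure_cong)
  also have "\<dots> \<le> (\<integral>\<^sup>+\<omega>. ennreal (2 * fact k / (2 * \<epsilon>\<^sup>2) ^ k) * (\<Sum>i<N. ennreal (stick_weight v i \<omega> ^ k)) \<partial>M)"
  proof (intro nn_integral_mono)
    fix \<omega> assume \<omega>: "\<omega> \<in> space M"
    have nn: "0 \<le> stick_weight v i \<omega>" for i by (intro stick_weight_nonneg v \<omega>)
    have le1: "(\<Sum>i<N. stick_weight v i \<omega>) \<le> 1" by (intro sum_stick_weight_le_1 v \<omega>)
    have "emeasure (distr M ?S T) (Pair (V \<omega>) -` B)
        = emeasure M {\<omega>'\<in>space M. \<epsilon> \<le> \<bar>\<Sum>i<N. stick_weight v i \<omega> * (indicator A (\<theta> i \<omega>') - measure H A)\<bar>}"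
      by (simp add: emeasure_distr sets_Pair1) (auto simp: B_def W T_def space_pair_measure space_PiM intro!: arg_cong[where f = "emeasure M"])
    also have "\<dots> \<le> ennreal (2 * fact k * ((\<Sum>i<N. (stick_weight v i \<omega>)\<^sup>2) / (2 * \<epsilon>\<^sup>2)) ^ k)"
      unfolding emeasure_eq_measure
      by (intro ennreal_leI weighted_indicator_deviation[OF M indep H A _ \<epsilon>] nn)
    also have "\<dots> \<le> ennreal (2 * fact k / (2 * \<epsilon>\<^sup>2) ^ k * (\<Sum>i<N. stick_weight v i \<omega> ^ k))"
      using sum_squares_power_le[of N "\<lambda>i. stick_weight v i \<omega>" k, OF nn le1 k]
      by (intro ennreal_leI) (simp add: power_divide divide_right_mono)
    also have "\<dots> = ennreal (2 * fact k / (2 * \<epsilon>\<^sup>2) ^ k) * (\<Sum>i<N. ennreal (stick_weight v i \<omega> ^ k))"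
      using nn by (subst ennreal_mult) (auto intro!: sum_nonneg)
    finally show "emeasure (distr M ?S T) (Pair (V \<omega>) -` B)
      \<le> ennreal (2 * fact k / (2 * \<epsilon>\<^sup>2) ^ k) * (\<Sum>i<N. ennreal (stick_weight v i \<omega> ^ k))" .
  qed
  also have "\<dots> = ennreal (2 * fact k / (2 * \<epsilon>\<^sup>2) ^ k) * (\<Sum>i<N. \<integral>\<^sup>+\<omega>. ennreal (stick_weight v i \<omega> ^ k) \<partial>M)"
    using measurable_stick_weight[OF v(1)] by (subst nn_integral_cmult) (auto simp: nn_integral_sum)
  also have "\<dots> \<le> ennreal (2 * fact k / (2 * \<epsilon>\<^sup>2) ^ k) * (\<rho> * 1)"
  proof (intro mult_left_mono)
    \<comment> \<open>The factor \<rho> is common to all positions and the means of the weights add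
      up to at most 1 by telescoping, so summing over \<open>i\<close> costs nothing.\<close>
    have "(\<Sum>i<N. \<integral>\<^sup>+\<omega>. ennreal (stick_weight v i \<omega> ^ k) \<partial>M) \<le> (\<Sum>i<N. \<rho> * (\<integral>\<^sup>+\<omega>. ennreal (stick_weight v i \<omega>) \<partial>M))"
      by (intro sum_mono mom)
    also have "\<dots> = \<rho> * (\<integral>\<^sup>+\<omega>. (\<Sum>i<N. ennreal (stick_weight v i \<omega>)) \<partial>M)"
      using measurable_stick_weight[OF v(1)] by (subst nn_integral_sum) (auto simp: sum_distrib_left)
    also have "\<dots> \<le> \<rho> * (\<integral>\<^sup>+\<omega>. 1 \<partial>M)"
      by (intro mult_left_mono nn_integral_mono)
        (auto simp: sum_ennreal stick_weight_nonneg v intro!: sum_stick_weight_le_1)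
    finally show "(\<Sum>i<N. \<integral>\<^sup>+\<omega>. ennreal (stick_weight v i \<omega> ^ k) \<partial>M) \<le> \<rho> * 1"
      by (simp add: emeasure_space_1)
  qed simp
  finally show ?thesis by simp
qed

lemma stick_breaking_deviation:
  assumes M: "prob_space M" and sb: "stick_breaking M H v P"
    and A: "A \<in> sets borel" and \<epsilon>: "\<epsilon> > 0" and k: "1 \<le> k"
    and mom: "\<And>m. (\<integral>\<^sup>+\<omega>. ennreal (stick_weight v m \<omega> ^ k) \<partial>M)
                 \<le> \<rho> * (\<integral>\<^sup>+\<omega>. ennreal (stick_weight v m \<omega>) \<partial>M)"
  shows "emeasure M {\<omega>\<in>space M. \<epsilon> \<le> \<bar>measure (P \<omega>) A - measure H A\<bar>}
           \<le> ennreal (2 * fact k / (\<epsilon>\<^sup>2 / 2) ^ k) * \<rho>"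
proof -
  interpret prob_space M by fact
  from sb obtain \<theta> where v: "\<And>i. v i \<in> borel_measurable M" "\<And>i \<omega>. \<omega> \<in> space M \<Longrightarrow> 0 \<le> v i \<omega> \<and> v i \<omega> \<le> 1"
    and sums: "AE \<omega> in M. (\<lambda>i. stick_weight v i \<omega>) sums 1"
    and indep: "indep_vars (\<lambda>_. borel) \<theta> UNIV"
    and H: "\<And>i. distr M borel (\<theta> i) = H"
    and indep2: "indep_var (Pi\<^sub>M UNIV (\<lambda>_. borel)) (\<lambda>\<omega> i. v i \<omega>) (Pi\<^sub>M UNIV (\<lambda>_. borel)) (\<lambda>\<omega> i. \<theta> i \<omega>)"
    and P: "AE \<omega> in M. \<forall>A\<in>sets borel.
           emeasure (P \<omega>) A = (\<Sum>i. ennreal (stick_weight v i \<omega>) * indicator A (\<theta> i \<omega>))"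
    and rP: "random_prob_measure M P"
    unfolding stick_breaking_def by blast
  note [measurable] = A v(1) measurable_stick_weight[OF v(1)]
  have \<theta>[measurable]: "\<theta> i \<in> borel_measurable M" for i
    using indep by (auto simp: indep_vars_def)
  have [measurable]: "(\<lambda>\<omega>. measure (P \<omega>) A) \<in> borel_measurable M"
    using rP unfolding random_prob_measure_def
    by (intro measurable_compose[OF _ measurable_measure_prob_algebra]) auto
  define Z where "Z N \<omega> = (\<Sum>i<N. stick_weight v i \<omega> * (indicator A (\<theta> i \<omega>) - measure H A))" for N \<omega>
  have [measurable]: "Z N \<in> borel_measurable M" for N unfolding Z_def by measurable
  define E where "E = {\<omega>\<in>space M. \<epsilon> \<le> \<bar>measure (P \<omega>) A - measure H A\<bar>}"
  \<comment> \<open>The threshold is halved so that a limit of absolute value at least \<epsilon>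
    forces \<open>Z N\<close> past it for all large \<open>N\<close>; Fatou's lemma then carries the
    truncated bounds over to the event \<open>E\<close>.\<close>
  define F where "F N = {\<omega>\<in>space M. \<epsilon> / 2 \<le> \<bar>Z N \<omega>\<bar>}" for N
  have [measurable]: "E \<in> sets M" "F N \<in> sets M" for N unfolding E_def F_def by measurable
  have "AE \<omega> in M. indicator E \<omega> \<le> (liminf (\<lambda>N. indicator (F N) \<omega>) :: ennreal)"
    using sums P AE_space
  proof eventually_elim
    case (elim \<omega>)
    have w: "0 \<le> stick_weight v i \<omega>" for i by (intro stick_weight_nonneg v elim)
    show ?case
    proof (cases "\<omega> \<in> E")
      case True
      have summ: "summable (\<lambda>i. stick_weight v i \<omega> * indicator A (\<theta> i \<omega>))"
        using w by (intro summable_comparison_test_ev[OF _ sums_summable[OF elim(1)]] always_eventually allI)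
            (auto simp: indicator_def)
      have "emeasure (P \<omega>) A = (\<Sum>i. ennreal (stick_weight v i \<omega> * indicator A (\<theta> i \<omega>)))"
        using elim(2) A w by (simp add: ennreal_mult' ennreal_indicator)
      also have "\<dots> = ennreal (\<Sum>i. stick_weight v i \<omega> * indicator A (\<theta> i \<omega>))"
        using w summ by (intro suminf_ennreal2) auto
      finally have "measure (P \<omega>) A = (\<Sum>i. stick_weight v i \<omega> * indicator A (\<theta> i \<omega>))"
        using w summ by (simp add: measure_def suminf_nonneg)
      with summ have "(\<lambda>i. stick_weight v i \<omega> * indicator A (\<theta> i \<omega>)) sums measure (P \<omega>) A"
        by (simp add: sums_iff)
      from sums_diff[OF this sums_mult2[OF elim(1), of "measure H A"]]
      have "(\<lambda>i. stick_weight v i \<omega> * (indicator A (\<theta> i \<omega>) - measure H A)) sums (measure (P \<omega>) A - measure H A)"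
        by (simp add: algebra_simps)
      hence "(\<lambda>N. Z N \<omega>) \<longlonglongrightarrow> measure (P \<omega>) A - measure H A"
        unfolding sums_def Z_def .
      hence "(\<lambda>N. \<bar>Z N \<omega>\<bar>) \<longlonglongrightarrow> \<bar>measure (P \<omega>) A - measure H A\<bar>"
        by (rule tendsto_rabs)
      moreover have "\<epsilon> / 2 < \<bar>measure (P \<omega>) A - measure H A\<bar>"
        using True \<epsilon> by (auto simp: E_def)
      ultimately have "eventually (\<lambda>N. \<epsilon> / 2 < \<bar>Z N \<omega>\<bar>) sequentially"
        by (rule order_tendstoD(1))
      hence "eventually (\<lambda>N. (1::ennreal) \<le> indicator (F N) \<omega>) sequentially"
        by eventually_elim (use elim(3) in \<open>auto simp: F_def\<close>)
      hence "1 \<le> (liminf (\<lambda>N. indicator (F N) \<omega>) :: ennreal)"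
        by (rule Liminf_bounded)
      thus ?thesis using True by simp
    qed simp
  qed
  hence "(\<integral>\<^sup>+\<omega>. indicator E \<omega> \<partial>M) \<le> (\<integral>\<^sup>+\<omega>. liminf (\<lambda>N. indicator (F N) \<omega>) \<partial>M)"
    by (rule nn_integral_mono_AE)
  also have "\<dots> \<le> liminf (\<lambda>N. \<integral>\<^sup>+\<omega>. indicator (F N) \<omega> \<partial>M)"
    by (intro nn_integral_liminf) auto
  also have "\<dots> = liminf (\<lambda>N. emeasure M (F N))" by simp
  also have "\<dots> \<le> liminf (\<lambda>N::nat. ennreal (2 * fact k / (2 * (\<epsilon> / 2)\<^sup>2) ^ k) * \<rho>)"
    unfolding F_def Z_def using \<epsilon>
    by (intro Liminf_mono always_eventually allI truncated_deviation[OF M v indep H indep2 A _ k mom]) auto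
  also have "\<dots> = ennreal (2 * fact k / (\<epsilon>\<^sup>2 / 2) ^ k) * \<rho>"
    by (simp add: Liminf_const power2_eq_square)
  finally show ?thesis by (simp add: E_def)
qed

section \<open>From moments of sticks to moments of weights\<close>

lemma prod_one_minus_bounds:
  fixes u :: "nat \<Rightarrow> real"
  assumes "\<And>i. i < m \<Longrightarrow> 0 \<le> u i \<and> u i < 1"
  shows "0 < (\<Prod>i<m. 1 - u i)" and "(\<Prod>i<m. 1 - u i) \<le> 1"
  using assms by (auto intro!: prod_pos prod_le_1 simp: less_imp_le)

text \<open>The remaining length \<open>R\<close> of the stick lies between 0 and 1, so
  \<open>R ^ q\<close> may be replaced by \<open>R\<close>. Independence then leaves the same
  factor, the mean of \<open>R\<close>, next to the \<open>q\<close>-th moment and next to the mean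
  of the stick.\<close>

lemma stick_weight_moment_indep:
  fixes v :: "nat \<Rightarrow> 'w \<Rightarrow> real"
  assumes M: "prob_space M" and indep: "prob_space.indep_vars M (\<lambda>_. borel) v UNIV"
    and v: "\<And>i \<omega>. \<omega> \<in> space M \<Longrightarrow> 0 \<le> v i \<omega> \<and> v i \<omega> \<le> 1" and q: "1 \<le> q"
    and mom: "(\<integral>\<^sup>+\<omega>. ennreal (v m \<omega> ^ q) \<partial>M) \<le> \<rho> * (\<integral>\<^sup>+\<omega>. ennreal (v m \<omega>) \<partial>M)"
  shows "(\<integral>\<^sup>+\<omega>. ennreal (stick_weight v m \<omega> ^ q) \<partial>M) \<le> \<rho> * (\<integral>\<^sup>+\<omega>. ennreal (stick_weight v m \<omega>) \<partial>M)"
proof -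
  interpret prob_space M by fact
  have [measurable]: "v i \<in> borel_measurable M" for i using indep by (auto simp: indep_vars_def)
  have prod: "(\<integral>\<^sup>+\<omega>. ennreal (v m \<omega> ^ p * (\<Prod>j<m. 1 - v j \<omega>)) \<partial>M)
     = (\<integral>\<^sup>+\<omega>. ennreal (v m \<omega> ^ p) \<partial>M) * (\<Prod>j<m. \<integral>\<^sup>+\<omega>. ennreal (1 - v j \<omega>) \<partial>M)" for p
  proof -
    \<comment> \<open>One family of functions covers the last stick and its predecessors, so the
      product formula for independent variables applies once; the exponent \<open>p\<close> is used
      with both \<open>q\<close> and 1.\<close>
    define Y where "Y i x = (if i = m then ennreal (x ^ p) else ennreal (1 - x))" for i x
    have [measurable]: "Y i \<in> borel_measurable borel" for i unfolding Y_def by (cases "i = m") simp_all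
    have "(\<integral>\<^sup>+\<omega>. ennreal (v m \<omega> ^ p * (\<Prod>j<m. 1 - v j \<omega>)) \<partial>M) = (\<integral>\<^sup>+\<omega>. (\<Prod>i\<le>m. Y i (v i \<omega>)) \<partial>M)"
    proof (intro nn_integral_cong)
      fix \<omega> assume \<omega>: "\<omega> \<in> space M"
      have "(\<Prod>i\<le>m. Y i (v i \<omega>)) = (\<Prod>i<m. Y i (v i \<omega>)) * Y m (v m \<omega>)"
        by (simp add: lessThan_Suc_atMost[symmetric])
      also have "(\<Prod>i<m. Y i (v i \<omega>)) = (\<Prod>i<m. ennreal (1 - v i \<omega>))"
        by (intro prod.cong) (auto simp: Y_def)
      also have "\<dots> = ennreal (\<Prod>i<m. 1 - v i \<omega>)"
        using v[OF \<omega>] by (intro prod_ennreal) auto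
      finally show "ennreal (v m \<omega> ^ p * (\<Prod>j<m. 1 - v j \<omega>)) = (\<Prod>i\<le>m. Y i (v i \<omega>))"
        using v[OF \<omega>] by (simp add: Y_def ennreal_mult' mult.commute prod_nonneg)
    qed
    also have "\<dots> = (\<Prod>i\<le>m. \<integral>\<^sup>+\<omega>. Y i (v i \<omega>) \<partial>M)"
      by (intro indep_vars_nn_integral indep_vars_compose2[OF indep_vars_subset[OF indep]]) auto
    also have "\<dots> = (\<Prod>i<m. \<integral>\<^sup>+\<omega>. Y i (v i \<omega>) \<partial>M) * (\<integral>\<^sup>+\<omega>. Y m (v m \<omega>) \<partial>M)"
      by (simp add: lessThan_Suc_atMost[symmetric])
    also have "(\<Prod>i<m. \<integral>\<^sup>+\<omega>. Y i (v i \<omega>) \<partial>M) = (\<Prod>j<m. \<integral>\<^sup>+\<omega>. ennreal (1 - v j \<omega>) \<partial>M)"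
      by (intro prod.cong) (auto simp: Y_def)
    finally show ?thesis by (simp add: Y_def mult.commute)
  qed
  have "(\<integral>\<^sup>+\<omega>. ennreal (stick_weight v m \<omega> ^ q) \<partial>M) \<le> (\<integral>\<^sup>+\<omega>. ennreal (v m \<omega> ^ q * (\<Prod>j<m. 1 - v j \<omega>)) \<partial>M)"
  proof (intro nn_integral_mono ennreal_leI)
    fix \<omega> assume \<omega>: "\<omega> \<in> space M"
    have R: "0 \<le> (\<Prod>j<m. 1 - v j \<omega>)" "(\<Prod>j<m. 1 - v j \<omega>) \<le> 1"
      using v[OF \<omega>] by (auto intro!: prod_nonneg prod_le_1)
    have "(\<Prod>j<m. 1 - v j \<omega>) ^ q \<le> (\<Prod>j<m. 1 - v j \<omega>) ^ 1" using R q by (intro power_decreasing) auto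
    thus "stick_weight v m \<omega> ^ q \<le> v m \<omega> ^ q * (\<Prod>j<m. 1 - v j \<omega>)"
      using v[OF \<omega>] by (auto simp: stick_weight_def power_mult_distrib intro!: mult_left_mono)
  qed
  also have "\<dots> = (\<integral>\<^sup>+\<omega>. ennreal (v m \<omega> ^ q) \<partial>M) * (\<Prod>j<m. \<integral>\<^sup>+\<omega>. ennreal (1 - v j \<omega>) \<partial>M)"
    by (rule prod)
  also have "\<dots> \<le> \<rho> * (\<integral>\<^sup>+\<omega>. ennreal (v m \<omega> ^ 1) \<partial>M) * (\<Prod>j<m. \<integral>\<^sup>+\<omega>. ennreal (1 - v j \<omega>) \<partial>M)"
    using mom by (intro mult_right_mono) auto
  also have "\<dots> = \<rho> * (\<integral>\<^sup>+\<omega>. ennreal (v m \<omega> ^ 1 * (\<Prod>j<m. 1 - v j \<omega>)) \<partial>M)"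
    by (subst prod) (simp add: mult.assoc)
  finally show ?thesis by (simp add: stick_weight_def)
qed

text \<open>The defining property speaks of rectangles of events. It is extended one coordinate at a
  time: for fixed \<open>B\<close> two measures in the variable \<open>A\<close> agree on every
  Borel set, hence on integrals of \<open>h2\<close>; then, for fixed \<open>h2\<close>, two
  measures in the variable \<open>B\<close> agree, hence on integrals of \<open>h1\<close>.\<close>

lemma conditional_densities_nn_integral:
  fixes v :: "nat \<Rightarrow> 'w \<Rightarrow> real" and f :: "nat \<Rightarrow> (nat \<Rightarrow> real) \<Rightarrow> real \<Rightarrow> real"
  assumes M: "prob_space M" and f: "has_conditional_densities M v f"
    and [measurable]: "\<And>i. v i \<in> borel_measurable M"
    and fm[measurable]: "case_prod (f m) \<in> borel_measurable (Pi\<^sub>M {..<m} (\<lambda>_. borel) \<Otimes>\<^sub>M borel)"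
    and h1[measurable]: "h1 \<in> borel_measurable (Pi\<^sub>M {..<m} (\<lambda>_. borel))"
    and h2[measurable]: "h2 \<in> borel_measurable borel"
  shows "(\<integral>\<^sup>+\<omega>. h1 (\<lambda>i\<in>{..<m}. v i \<omega>) * h2 (v m \<omega>) \<partial>M)
       = (\<integral>\<^sup>+\<omega>. h1 (\<lambda>i\<in>{..<m}. v i \<omega>)
            * (\<integral>\<^sup>+x. h2 x * ennreal (f m (\<lambda>i\<in>{..<m}. v i \<omega>) x) \<partial>lborel) \<partial>M)"
proof -
  interpret prob_space M by fact
  let ?S = "Pi\<^sub>M {..<m} (\<lambda>_. borel) :: (nat \<Rightarrow> real) measure"
  define V where "V \<omega> = (\<lambda>i\<in>{..<m}. v i \<omega>)" for \<omega>
  have V[measurable]: "V \<in> M \<rightarrow>\<^sub>M ?S" unfolding V_def by measurable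
  have fV[measurable]: "(\<lambda>(\<omega>, x). f m (V \<omega>) x) \<in> borel_measurable (M \<Otimes>\<^sub>M borel)"
    using measurable_compose[of "\<lambda>(\<omega>, x). (V \<omega>, x)" "M \<Otimes>\<^sub>M borel" _ "case_prod (f m)", OF _ fm]
    by (simp add: split_def)
  have step1: "(\<integral>\<^sup>+\<omega>. indicator B (V \<omega>) * h2 (v m \<omega>) \<partial>M)
        = (\<integral>\<^sup>+\<omega>. indicator B (V \<omega>) * (\<integral>\<^sup>+x. h2 x * ennreal (f m (V \<omega>) x) \<partial>lborel) \<partial>M)"
    if [measurable]: "B \<in> sets ?S" for B
  proof -
    \<comment> \<open>The density of the law of \<open>v m\<close> restricted to the event that the
      past lies in \<open>B\<close>.\<close>
    define F where "F x = (\<integral>\<^sup>+\<omega>. indicator B (V \<omega>) * ennreal (f m (V \<omega>) x) \<partial>M)" for x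
    have [measurable]: "F \<in> borel_measurable borel" unfolding F_def by measurable
    have swap: "(\<integral>\<^sup>+\<omega>. indicator B (V \<omega>) * (\<integral>\<^sup>+x. h x * ennreal (f m (V \<omega>) x) \<partial>lborel) \<partial>M)
        = (\<integral>\<^sup>+x. F x * h x \<partial>lborel)" if [measurable]: "h \<in> borel_measurable borel" for h :: "real \<Rightarrow> ennreal"
    proof -
      interpret pair_sigma_finite M lborel by unfold_locales
      have "(\<integral>\<^sup>+x. F x * h x \<partial>lborel)
          = (\<integral>\<^sup>+x. \<integral>\<^sup>+\<omega>. indicator B (V \<omega>) * (h x * ennreal (f m (V \<omega>) x)) \<partial>M \<partial>lborel)"
        unfolding F_def
        by (intro nn_integral_cong) (subst nn_integral_multc[symmetric], auto simp: mult_ac)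
      also have "\<dots> = (\<integral>\<^sup>+\<omega>. \<integral>\<^sup>+x. indicator B (V \<omega>) * (h x * ennreal (f m (V \<omega>) x)) \<partial>lborel \<partial>M)"
        by (intro Fubini') measurable
      also have "\<dots> = (\<integral>\<^sup>+\<omega>. indicator B (V \<omega>) * (\<integral>\<^sup>+x. h x * ennreal (f m (V \<omega>) x) \<partial>lborel) \<partial>M)"
        by (intro nn_integral_cong nn_integral_cmult) measurable
      finally show ?thesis ..
    qed
    have eq: "distr (density M (\<lambda>\<omega>. indicator B (V \<omega>))) borel (v m) = density lborel F"
    proof (rule measure_eqI)
      fix A assume "A \<in> sets (distr (density M (\<lambda>\<omega>. indicator B (V \<omega>))) borel (v m))"
      hence [measurable]: "A \<in> sets borel" by simp
      have "emeasure (distr (density M (\<lambda>\<omega>. indicator B (V \<omega>))) borel (v m)) A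
          = (\<integral>\<^sup>+\<omega>\<in>v m -` A \<inter> space M. indicator B (V \<omega>) \<partial>M)"
        by (simp add: emeasure_distr emeasure_density)
      also have "\<dots> = (\<integral>\<^sup>+\<omega>. indicator {\<omega>\<in>space M. V \<omega> \<in> B \<and> v m \<omega> \<in> A} \<omega> \<partial>M)"
        by (intro nn_integral_cong) (auto simp: indicator_def)
      also have "\<dots> = emeasure M {\<omega>\<in>space M. V \<omega> \<in> B \<and> v m \<omega> \<in> A}" by simp
      also have "\<dots> = (\<integral>\<^sup>+\<omega>. indicator B (V \<omega>) * (\<integral>\<^sup>+x. indicator A x * ennreal (f m (V \<omega>) x) \<partial>lborel) \<partial>M)"
        using f that unfolding has_conditional_densities_def V_def by (simp add: mult.commute)
      also have "\<dots> = (\<integral>\<^sup>+x. F x * indicator A x \<partial>lborel)" by (rule swap) simp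
      also have "\<dots> = emeasure (density lborel F) A" by (simp add: emeasure_density)
      finally show "emeasure (distr (density M (\<lambda>\<omega>. indicator B (V \<omega>))) borel (v m)) A = emeasure (density lborel F) A" .
    qed simp
    have "(\<integral>\<^sup>+\<omega>. indicator B (V \<omega>) * h2 (v m \<omega>) \<partial>M)
        = (\<integral>\<^sup>+x. h2 x \<partial>distr (density M (\<lambda>\<omega>. indicator B (V \<omega>))) borel (v m))"
      by (simp add: nn_integral_distr nn_integral_density)
    also have "\<dots> = (\<integral>\<^sup>+x. F x * h2 x \<partial>lborel)"
      unfolding eq by (simp add: nn_integral_density)
    also note swap[OF h2, symmetric]
    finally show ?thesis .
  qed
  define J where "J u = (\<integral>\<^sup>+x. h2 x * ennreal (f m u x) \<partial>lborel)" for u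
  have [measurable]: "J \<in> borel_measurable ?S" unfolding J_def by measurable
  have eq: "distr (density M (\<lambda>\<omega>. h2 (v m \<omega>))) ?S V = distr (density M (\<lambda>\<omega>. J (V \<omega>))) ?S V"
  proof (rule measure_eqI)
    fix B assume "B \<in> sets (distr (density M (\<lambda>\<omega>. h2 (v m \<omega>))) ?S V)"
    hence [measurable]: "B \<in> sets ?S" by simp
    have *: "emeasure (distr (density M g) ?S V) B = (\<integral>\<^sup>+\<omega>. indicator B (V \<omega>) * g \<omega> \<partial>M)"
      if [measurable]: "g \<in> borel_measurable M" for g
      by (simp add: emeasure_distr emeasure_density)
        (intro nn_integral_cong, auto simp: indicator_def)
    show "emeasure (distr (density M (\<lambda>\<omega>. h2 (v m \<omega>))) ?S V) B = emeasure (distr (density M (\<lambda>\<omega>. J (V \<omega>))) ?S V) B"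
      using step1[of B] by (simp add: * J_def)
  qed simp
  have "(\<integral>\<^sup>+\<omega>. h1 (V \<omega>) * h2 (v m \<omega>) \<partial>M) = (\<integral>\<^sup>+u. h1 u \<partial>distr (density M (\<lambda>\<omega>. h2 (v m \<omega>))) ?S V)"
    by (simp add: nn_integral_distr nn_integral_density mult.commute)
  also have "\<dots> = (\<integral>\<^sup>+\<omega>. h1 (V \<omega>) * J (V \<omega>) \<partial>M)"
    unfolding eq by (simp add: nn_integral_distr nn_integral_density mult.commute)
  finally show ?thesis by (simp add: V_def J_def)
qed

lemma stick_weight_moment_conditional:
  fixes v :: "nat \<Rightarrow> 'w \<Rightarrow> real" and f :: "nat \<Rightarrow> (nat \<Rightarrow> real) \<Rightarrow> real \<Rightarrow> real"
  assumes M: "prob_space M" and f: "has_conditional_densities M v f"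
    and v[measurable]: "\<And>i. v i \<in> borel_measurable M"
    and v01: "\<And>i \<omega>. \<omega> \<in> space M \<Longrightarrow> 0 \<le> v i \<omega> \<and> v i \<omega> \<le> 1" and q: "1 \<le> q"
    and fm[measurable]: "case_prod (f m) \<in> borel_measurable (Pi\<^sub>M {..<m} (\<lambda>_. borel) \<Otimes>\<^sub>M borel)"
    and ratio: "\<And>u. (\<And>i. i < m \<Longrightarrow> 0 \<le> u i \<and> u i < 1) \<Longrightarrow>
        (\<integral>\<^sup>+x. ennreal (x ^ q) * ennreal (f m u x) \<partial>lborel) \<le> \<rho> * (\<integral>\<^sup>+x. ennreal x * ennreal (f m u x) \<partial>lborel)"
  shows "(\<integral>\<^sup>+\<omega>. ennreal (stick_weight v m \<omega> ^ q) \<partial>M) \<le> \<rho> * (\<integral>\<^sup>+\<omega>. ennreal (stick_weight v m \<omega>) \<partial>M)"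
proof -
  interpret prob_space M by fact
  define h where "h u = ennreal (\<Prod>j<m. 1 - u j)" for u :: "nat \<Rightarrow> real"
  define V where "V \<omega> = (\<lambda>i\<in>{..<m}. v i \<omega>)" for \<omega>
  have [measurable]: "h \<in> borel_measurable (Pi\<^sub>M {..<m} (\<lambda>_. borel))" unfolding h_def by measurable
  have [measurable]: "V \<in> M \<rightarrow>\<^sub>M Pi\<^sub>M {..<m} (\<lambda>_. borel)" unfolding V_def by measurable
  have fV[measurable]: "(\<lambda>(\<omega>, x). f m (V \<omega>) x) \<in> borel_measurable (M \<Otimes>\<^sub>M borel)"
    using measurable_compose[of "\<lambda>(\<omega>, x). (V \<omega>, x)" "M \<Otimes>\<^sub>M borel" _ "case_prod (f m)", OF _ fm]
    by (simp add: split_def)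
  have hV: "h (V \<omega>) = ennreal (\<Prod>j<m. 1 - v j \<omega>)" for \<omega>
    unfolding h_def V_def by (intro arg_cong[where f = ennreal] prod.cong) auto
  note cd = conditional_densities_nn_integral[OF M f v fm, of h, folded V_def]
  have "(\<integral>\<^sup>+\<omega>. ennreal (stick_weight v m \<omega> ^ q) \<partial>M) \<le> (\<integral>\<^sup>+\<omega>. h (V \<omega>) * ennreal (v m \<omega> ^ q) \<partial>M)"
  proof (intro nn_integral_mono)
    fix \<omega> assume \<omega>: "\<omega> \<in> space M"
    have R: "0 \<le> (\<Prod>j<m. 1 - v j \<omega>)" "(\<Prod>j<m. 1 - v j \<omega>) \<le> 1"
      using v01[OF \<omega>] by (auto intro!: prod_nonneg prod_le_1)
    have "(\<Prod>j<m. 1 - v j \<omega>) ^ q \<le> (\<Prod>j<m. 1 - v j \<omega>) ^ 1" using R q by (intro power_decreasing) auto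
    hence "stick_weight v m \<omega> ^ q \<le> (\<Prod>j<m. 1 - v j \<omega>) * v m \<omega> ^ q"
      using v01[OF \<omega>] by (auto simp: stick_weight_def power_mult_distrib mult.commute[of _ "v m \<omega> ^ q"] intro!: mult_left_mono)
    thus "ennreal (stick_weight v m \<omega> ^ q) \<le> h (V \<omega>) * ennreal (v m \<omega> ^ q)"
      using R v01[OF \<omega>] by (simp add: hV ennreal_leI flip: ennreal_mult)
  qed
  also have "\<dots> = (\<integral>\<^sup>+\<omega>. h (V \<omega>) * (\<integral>\<^sup>+x. ennreal (x ^ q) * ennreal (f m (V \<omega>) x) \<partial>lborel) \<partial>M)"
    by (rule cd) auto
  also have "\<dots> \<le> (\<integral>\<^sup>+\<omega>. \<rho> * (h (V \<omega>) * (\<integral>\<^sup>+x. ennreal x * ennreal (f m (V \<omega>) x) \<partial>lborel)) \<partial>M)"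
  proof (intro nn_integral_mono)
    fix \<omega> assume \<omega>: "\<omega> \<in> space M"
    show "h (V \<omega>) * (\<integral>\<^sup>+x. ennreal (x ^ q) * ennreal (f m (V \<omega>) x) \<partial>lborel)
        \<le> \<rho> * (h (V \<omega>) * (\<integral>\<^sup>+x. ennreal x * ennreal (f m (V \<omega>) x) \<partial>lborel))"
    \<comment> \<open>The moment ratio is assumed only for past sticks below 1, as the conditional
      densities degenerate otherwise; if an earlier stick equals 1, the remaining length
      \<open>h (V \<omega>)\<close> is 0 and both sides vanish.\<close>
    proof (cases "\<exists>i<m. v i \<omega> = 1")
      case True
      hence "(\<Prod>j<m. 1 - v j \<omega>) = 0" by (intro prod_zero) auto
      hence "h (V \<omega>) = 0" by (simp only: hV ennreal_0)
      thus ?thesis by simp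
    next
      case False
      hence "(\<integral>\<^sup>+x. ennreal (x ^ q) * ennreal (f m (V \<omega>) x) \<partial>lborel) \<le> \<rho> * (\<integral>\<^sup>+x. ennreal x * ennreal (f m (V \<omega>) x) \<partial>lborel)"
        using v01[OF \<omega>] by (intro ratio) (auto simp: V_def less_le)
      from mult_left_mono[OF this, of "h (V \<omega>)"] show ?thesis by (simp add: mult_ac)
    qed
  qed
  also have "\<dots> = \<rho> * (\<integral>\<^sup>+\<omega>. h (V \<omega>) * (\<integral>\<^sup>+x. ennreal x * ennreal (f m (V \<omega>) x) \<partial>lborel) \<partial>M)"
    by (intro nn_integral_cmult) measurable
  also have "(\<integral>\<^sup>+\<omega>. h (V \<omega>) * (\<integral>\<^sup>+x. ennreal x * ennreal (f m (V \<omega>) x) \<partial>lborel) \<partial>M)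
      = (\<integral>\<^sup>+\<omega>. h (V \<omega>) * ennreal (v m \<omega>) \<partial>M)"
    by (rule cd[symmetric]) auto
  also have "\<dots> = (\<integral>\<^sup>+\<omega>. ennreal (stick_weight v m \<omega>) \<partial>M)"
    using v01 by (intro nn_integral_cong)
      (simp add: hV stick_weight_def ennreal_mult' mult.commute prod_nonneg)
  finally show ?thesis .
qed

section \<open>The normalized inverse Gaussian process\<close>

text \<open>\<open>cosh t\<close> \<ge> \<open>t\<^sup>2 / 4\<close> gives Gaussian decay, which
  beats the growth \<open>exp (\<bar>\<mu>\<bar> * t)\<close> of the other factor.\<close>

lemma macdonald_integrable:
  fixes \<mu> z :: real
  assumes z: "0 < z"
  shows "set_integrable lborel {0..} (\<lambda>t. exp (- z * cosh t) * cosh (\<mu> * t))"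
proof -
  have bound: "exp (- z * cosh t) * cosh (\<mu> * t) \<le> exp ((\<bar>\<mu>\<bar> + 1)\<^sup>2 / z) * exp (- t)" if t: "0 \<le> t" for t
  proof -
    have "cosh (\<mu> * t) \<le> exp (\<bar>\<mu>\<bar> * t)"
    proof -
      have "exp (\<mu> * t) \<le> exp (\<bar>\<mu>\<bar> * t)" "exp (- (\<mu> * t)) \<le> exp (\<bar>\<mu>\<bar> * t)"
        using mult_right_mono[OF abs_ge_self t, of \<mu>] mult_right_mono[OF abs_ge_minus_self t, of \<mu>]
        by auto
      hence "exp (\<mu> * t) + exp (- (\<mu> * t)) \<le> 2 * exp (\<bar>\<mu>\<bar> * t)" by linarith
      thus ?thesis by (simp add: cosh_def)
    qed
    moreover have "t\<^sup>2 / 4 \<le> cosh t"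
    proof -
      have "1 + t + t\<^sup>2 / 2 \<le> exp t" by (rule exp_lower_Taylor_quadratic) (rule t)
      moreover have "0 < exp (- t)" by simp
      ultimately have "t\<^sup>2 / 2 \<le> exp t + exp (- t)" using t by linarith
      thus ?thesis by (simp add: cosh_def)
    qed
    hence "- z * cosh t \<le> - z * (t\<^sup>2 / 4)" using z by simp
    moreover have le: "- z * (t\<^sup>2 / 4) + \<bar>\<mu>\<bar> * t \<le> (\<bar>\<mu>\<bar> + 1)\<^sup>2 / z - t"
    proof -
      \<comment> \<open>The extra 1 in \<open>k\<close> leaves a spare \<open>exp (- t)\<close> as
        integrable majorant once the square is completed.\<close>
      define k where "k = \<bar>\<mu>\<bar> + 1"
      have "0 \<le> z * (t / 2 - k / z)\<^sup>2" using z by simp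
      also have "z * (t / 2 - k / z)\<^sup>2 = z * (t\<^sup>2 / 4) - k * t + k\<^sup>2 / z"
        using z by (simp add: power2_eq_square algebra_simps)
      finally show ?thesis by (simp add: k_def algebra_simps)
    qed
    ultimately have "exp (- z * cosh t) * cosh (\<mu> * t) \<le> exp (- z * (t\<^sup>2 / 4)) * exp (\<bar>\<mu>\<bar> * t)"
      by (intro mult_mono) auto
    also have "\<dots> \<le> exp ((\<bar>\<mu>\<bar> + 1)\<^sup>2 / z - t)"
      using le by (simp flip: exp_add)
    finally show ?thesis by (simp add: exp_diff exp_minus divide_inverse)
  qed
  have "set_integrable lborel {0..} (\<lambda>t. exp ((\<bar>\<mu>\<bar> + 1)\<^sup>2 / z) * exp (- t))"
  proof -
    have "(\<integral>\<^sup>+t. ennreal (indicator {0..} t * exp (- t)) \<partial>lborel)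
         = (\<integral>\<^sup>+t. ennreal (t ^ 0 * exp (- t)) * indicator {0..} t \<partial>lborel)"
      by (intro nn_integral_cong) (auto simp: indicator_def)
    also have "\<dots> = 1" by (subst nn_intergal_power_times_exp_Ici) simp
    finally have "integrable lborel (\<lambda>t::real. indicator {0..} t * exp (- t))"
      by (intro integrableI_nonneg) (auto intro!: AE_I2)
    from integrable_mult_right[OF this, of "exp ((\<bar>\<mu>\<bar> + 1)\<^sup>2 / z)"]
    show ?thesis by (simp add: set_integrable_def mult_ac)
  qed
  thus ?thesis
  proof (rule set_integrable_bound)
    show "set_borel_measurable lborel {0..} (\<lambda>t. exp (- z * cosh t) * cosh (\<mu> * t))"
      unfolding set_borel_measurable_def cosh_def by measurable
  qed (use bound in \<open>auto intro!: always_eventually\<close>)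
qed

lemma macdonald_nonneg: "0 \<le> macdonald \<mu> z"
  unfolding macdonald_def set_lebesgue_integral_def by (intro Bochner_Integration.integral_nonneg) (auto simp: indicator_def)

lemma borel_measurable_macdonald[measurable]: "macdonald \<mu> \<in> borel_measurable borel"
  unfolding macdonald_def[abs_def] set_lebesgue_integral_def cosh_def by measurable

text \<open>The exponential in \<open>1 / sqrt (1 - x)\<close> absorbs both the singularity of \<open>1 / (1 - x)\<close> and the
  tilt. In terms of \<open>w = 1 / sqrt (1 - x)\<close> the claim reduces to \<open>ln r - ln p \<le> r - p\<close> for \<open>1 \<le> p \<le> r\<close>.\<close>

lemma exp_tilt_decreasing:
  fixes a B x y :: real
  assumes a: "0 < a" and B: "4 \<le> a" "a \<le> B" and xy: "0 < x" "x \<le> y" "y < 1"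
  shows "exp (a / 4 * y) / (1 - y) * exp (- B / sqrt (1 - y)) \<le> exp (a / 4 * x) / (1 - x) * exp (- B / sqrt (1 - x))"
proof -
  define w where "w u = 1 / sqrt (1 - u)" for u :: real
  have eq: "exp (a / 4 * u) / (1 - u) * exp (- B / sqrt (1 - u)) = exp (a / 4 * u + 2 * ln (w u) - B * w u)"
    and w: "1 \<le> w u" "u = 1 - 1 / (w u)\<^sup>2" if u: "0 < u" "u < 1" for u
  proof -
    have *: "0 < w u" "(w u)\<^sup>2 = 1 / (1 - u)" using u by (auto simp: w_def power_divide)
    have "exp (2 * ln (w u)) = (w u)\<^sup>2"
      using *(1) exp_of_nat_mult[of 2 "ln (w u)"] by simp
    hence e: "exp (2 * ln (w u)) = 1 / (1 - u)" by (simp only: *(2))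
    have b: "- B / sqrt (1 - u) = - (B * w u)" by (simp add: w_def)
    have "exp (a / 4 * u + 2 * ln (w u) - B * w u) = exp (a / 4 * u) * exp (2 * ln (w u)) * exp (- (B * w u))"
      by (simp only: exp_add[symmetric] diff_conv_add_uminus)
    thus "exp (a / 4 * u) / (1 - u) * exp (- B / sqrt (1 - u)) = exp (a / 4 * u + 2 * ln (w u) - B * w u)"
      unfolding e b by simp
    show "1 \<le> w u" using u by (simp add: w_def)
    show "u = 1 - 1 / (w u)\<^sup>2" using u by (simp add: *(2))
  qed
  define p where "p = w x"
  define r where "r = w y"
  have xy': "x < 1" "0 < y" using xy by auto
  have p: "1 \<le> p" "x = 1 - 1 / p\<^sup>2" and r: "1 \<le> r" "y = 1 - 1 / r\<^sup>2"
    unfolding p_def r_def using w xy xy' by blast+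
  have "p \<le> r" using xy unfolding p_def r_def w_def by (intro divide_left_mono) auto
  have "ln r - ln p \<le> r - p"
  proof -
    have "ln r - ln p = ln (r / p)" using p r by (simp add: ln_div)
    also have "\<dots> \<le> r / p - 1" using p r by (intro ln_le_minus_one) auto
    also have "\<dots> = (r - p) / p" using p by (simp add: diff_divide_distrib)
    also have "\<dots> \<le> (r - p) / 1" using p \<open>p \<le> r\<close> by (intro divide_left_mono) auto
    finally show ?thesis by simp
  qed
  \<comment> \<open>In terms of the reciprocals, \<open>y - x\<close> is
    \<open>(i - j) * (i + j)\<close> with \<open>i + j\<close> \<le> 2 and
    \<open>i - j = (r - p) * (i * j)\<close>, so it is at most twice the increase of
    \<open>w\<close>.\<close>
  moreover have "y - x \<le> 2 * (r - p)"
  proof -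
    define i where "i = 1 / p"
    define j where "j = 1 / r"
    have ij: "0 \<le> i" "i \<le> 1" "0 \<le> j" "j \<le> 1" using p r by (auto simp: i_def j_def)
    have "i - j = (r - p) * (i * j)" using p r by (simp add: i_def j_def field_simps)
    also have "\<dots> \<le> (r - p) * 1" using \<open>p \<le> r\<close> ij by (intro mult_left_mono mult_le_one) auto
    finally have d: "i - j \<le> r - p" by simp
    have "y - x = (i - j) * (i + j)" unfolding p(2) r(2) i_def j_def
      by (simp add: power_divide[symmetric] power2_eq_square algebra_simps)
    also have "\<dots> \<le> (r - p) * 2" using d ij \<open>p \<le> r\<close> by (intro mult_mono) auto
    finally show ?thesis by simp
  qed
  hence "a / 4 * (y - x) \<le> a / 4 * (2 * (r - p))" using a by (intro mult_left_mono) auto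
  hence "a / 4 * (y - x) \<le> a / 2 * (r - p)" by (simp add: algebra_simps)
  \<comment> \<open>The budget: of the rate \<open>B\<close> \<ge> \<open>a\<close>, the tilt uses
    \<open>a / 2\<close> and the logarithm of the singular factor uses 2. Both fit because
    \<open>a\<close> \<ge> 4, which is the origin of that threshold and of the tilt
    \<open>a / 4\<close>.\<close>
  moreover have "(a / 2 + 2) * (r - p) \<le> B * (r - p)" using B \<open>p \<le> r\<close> by (intro mult_right_mono) auto
  ultimately have "a / 4 * y + 2 * ln r - B * r \<le> a / 4 * x + 2 * ln p - B * p"
    unfolding right_diff_distrib distrib_right by linarith
  thus ?thesis
    unfolding eq[OF xy'(2) xy(3)] eq[OF xy(1) xy'(1)] by (simp add: p_def r_def)
qed

text \<open>The integral representation of the Macdonald function reduces the claim to each fixed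
  \<open>t\<close>, where the rate \<open>b * cosh t\<close> is at least \<open>a\<close>. Splitting
  off \<open>1 / (1 - x)\<close> leaves the exponent \<open>p + 1\<close> \<ge> 0, hence a
  nonincreasing power. For the first stick \<open>p\<close> is exactly -1, so the singular factor
  cannot be avoided.\<close>

lemma nigp_factor_decreasing:
  fixes a b \<mu> p x y :: real
  assumes a: "4 \<le> a" "a \<le> b" and p: "- 1 \<le> p" and xy: "0 < x" "x \<le> y" "y < 1"
  shows "exp (a / 4 * y) * ((1 - y) powr p * macdonald \<mu> (b / sqrt (1 - y)))
       \<le> exp (a / 4 * x) * ((1 - x) powr p * macdonald \<mu> (b / sqrt (1 - x)))"
proof -
  have int: "integrable lborel (\<lambda>t. indicator {0..} t *
      (exp (a / 4 * u) * (1 - u) powr p * exp (- (b / sqrt (1 - u)) * cosh t) * cosh (\<mu> * t)))"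
    and eq: "exp (a / 4 * u) * ((1 - u) powr p * macdonald \<mu> (b / sqrt (1 - u)))
     = (LINT t|lborel. indicator {0..} t * (exp (a / 4 * u) * (1 - u) powr p * exp (- (b / sqrt (1 - u)) * cosh t) * cosh (\<mu> * t)))"
    if "u < 1" for u
  proof -
    have "0 < b / sqrt (1 - u)" using a that by simp
    from macdonald_integrable[OF this, of \<mu>]
    have "integrable lborel (\<lambda>t. (exp (a / 4 * u) * (1 - u) powr p) * (indicator {0..} t * (exp (- (b / sqrt (1 - u)) * cosh t) * cosh (\<mu> * t))))"
      unfolding set_integrable_def by (intro integrable_mult_right) simp
    thus "integrable lborel (\<lambda>t. indicator {0..} t *
      (exp (a / 4 * u) * (1 - u) powr p * exp (- (b / sqrt (1 - u)) * cosh t) * cosh (\<mu> * t)))"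
      by (simp only: mult_ac)
    show "exp (a / 4 * u) * ((1 - u) powr p * macdonald \<mu> (b / sqrt (1 - u)))
     = (LINT t|lborel. indicator {0..} t * (exp (a / 4 * u) * (1 - u) powr p * exp (- (b / sqrt (1 - u)) * cosh t) * cosh (\<mu> * t)))"
    proof -
      have "exp (a / 4 * u) * ((1 - u) powr p * macdonald \<mu> (b / sqrt (1 - u)))
        = (exp (a / 4 * u) * (1 - u) powr p) * (LINT t|lborel. indicator {0..} t * (exp (- (b / sqrt (1 - u)) * cosh t) * cosh (\<mu> * t)))"
        unfolding macdonald_def set_lebesgue_integral_def by simp
      also have "\<dots> = (LINT t|lborel. (exp (a / 4 * u) * (1 - u) powr p) * (indicator {0..} t * (exp (- (b / sqrt (1 - u)) * cosh t) * cosh (\<mu> * t))))"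
        by (rule integral_mult_right_zero[symmetric])
      finally show ?thesis by (simp only: mult_ac)
    qed
  qed
  show ?thesis
    unfolding eq[OF xy(3)] eq[OF le_less_trans[OF xy(2,3)]]
  proof (intro integral_mono int)
    fix t :: real
    have c: "1 \<le> cosh t" by (rule cosh_real_ge_1)
    have "a * 1 \<le> b * cosh t" using a c by (intro mult_mono) auto
    hence B: "a \<le> b * cosh t" by simp
    have split: "exp (a / 4 * u) * (1 - u) powr p * exp (- (b / sqrt (1 - u)) * cosh t)
        = (1 - u) powr (p + 1) * (exp (a / 4 * u) / (1 - u) * exp (- (b * cosh t) / sqrt (1 - u)))" if "u < 1" for u
      using that by (simp add: powr_add)
    have "exp (a / 4 * y) * (1 - y) powr p * exp (- (b / sqrt (1 - y)) * cosh t)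
       \<le> exp (a / 4 * x) * (1 - x) powr p * exp (- (b / sqrt (1 - x)) * cosh t)"
      unfolding split[OF xy(3)] split[OF le_less_trans[OF xy(2,3)]]
      using a B p xy by (intro mult_mono powr_mono2 exp_tilt_decreasing) auto
    thus "indicator {0..} t * (exp (a / 4 * y) * (1 - y) powr p * exp (- (b / sqrt (1 - y)) * cosh t) * cosh (\<mu> * t))
       \<le> indicator {0..} t * (exp (a / 4 * x) * (1 - x) powr p * exp (- (b / sqrt (1 - x)) * cosh t) * cosh (\<mu> * t))"
      by (intro mult_left_mono mult_right_mono) auto
  qed (use xy in auto)
qed

lemma measurable_nigp_density:
  "case_prod (nigp_density a m) \<in> borel_measurable (Pi\<^sub>M {..<m} (\<lambda>_. borel) \<Otimes>\<^sub>M borel)"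
  unfolding nigp_density_def[abs_def] Let_def split_def by measurable

lemma nigp_moment_ratio:
  assumes a: "4 \<le> a" and q: "2 \<le> q" and u: "\<And>i. i < m \<Longrightarrow> 0 \<le> u i \<and> u i < 1"
  shows "(\<integral>\<^sup>+x. ennreal (x ^ q) * ennreal (nigp_density a m u x) \<partial>lborel)
       \<le> ennreal (12 * Gamma (real q + 1 - 1 / 2) * (a / 4) powr (1 - real q))
          * (\<integral>\<^sup>+x. ennreal x * ennreal (nigp_density a m u x) \<partial>lborel)"
proof -
  define R where "R = (\<Prod>i<m. 1 - u i)"
  have R: "0 < R" "R \<le> 1" unfolding R_def using prod_one_minus_bounds[of m u] u by auto
  define n where "n = real (Suc m)"
  define K where "K = a powr (1/2) * (\<Prod>i<m. (1 - u i) powr (-1/4)) / ((2 * pi) powr (1/2) * macdonald (- n/2) (a / sqrt R))"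
  define g where "g x = (1 - x) powr (-5/4 + n/4) * macdonald (- 1/2 - n/2) (a / sqrt R / sqrt (1 - x))" for x
  \<comment> \<open>The earlier sticks enter the factor \<open>g\<close> only through
    \<open>a / sqrt R\<close>, and \<open>R\<close> \<le> 1 makes this at least \<open>a\<close>:
    the past can only strengthen the decay. The Macdonald function in the denominator goes into
    \<open>K\<close>.\<close>
  have b: "a \<le> a / sqrt R" using a R by (simp add: pos_le_divide_eq)
  have n: "1 \<le> n" by (simp add: n_def)
  show ?thesis
  proof (rule moment_ratio[where K = K and g = g])
    show "nigp_density a m u \<in> borel_measurable borel"
      unfolding nigp_density_def[abs_def] Let_def by measurable
    show "nigp_density a m u x = K * (x powr - (1 / 2) * g x)" if "x \<in> {0<..<1}" for x
    proof -
      have e: "a / sqrt ((1 - x) * R) = a / sqrt R / sqrt (1 - x)"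
        using R that by (simp add: real_sqrt_mult)
      from that show ?thesis
        unfolding nigp_density_def Let_def K_def g_def R_def[symmetric] n_def[symmetric] e by simp
    qed
    show "exp (a / 4 * y) * g y \<le> exp (a / 4 * x) * g x" if "0 < x" "x \<le> y" "y < 1" for x y
      unfolding g_def using a b n that by (intro nigp_factor_decreasing) auto
  qed (use a q in \<open>auto simp: nigp_density_def Let_def g_def macdonald_nonneg\<close>)
qed

section \<open>The normalized generalized gamma process\<close>

lemma pochhammer_binomial_sums:
  fixes c z :: real
  assumes "\<bar>z\<bar> < 1"
  shows "(\<lambda>j. pochhammer c j / fact j * z ^ j) sums (1 - z) powr (- c)"
proof -
  have "(\<lambda>j. ((- c) gchoose j) * (- z) ^ j) sums (1 + - z) powr (- c)"
    using assms by (intro gen_binomial_real) simp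
  moreover have "((- c) gchoose j) * (- z) ^ j = pochhammer c j / fact j * z ^ j" for j
  proof -
    have "(- 1) ^ j * (- z) ^ j = z ^ j" by (simp flip: power_mult_distrib)
    thus ?thesis by (simp add: gbinomial_pochhammer mult_ac)
  qed
  ultimately show ?thesis by simp
qed

text \<open>The coefficients eventually have constant sign, so their absolute values can be summed
  up to finitely many terms.\<close>

lemma pochhammer_binomial_abs_bound:
  fixes c :: real
  obtains C where "\<And>z N. 0 \<le> z \<Longrightarrow> z < 1 \<Longrightarrow> (\<Sum>j<N. \<bar>pochhammer c j / fact j\<bar> * z ^ j) \<le> (1 - z) powr (- c) + C"
proof -
  define d where "d j = pochhammer c j / fact j" for j
  \<comment> \<open>From \<open>J\<close> on, every further factor of the rising factorial is
    positive, so all later coefficients have the sign of \<open>d J\<close>.\<close>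
  obtain J :: nat where "- c < real J" using reals_Archimedean2 by blast
  hence J: "0 < c + real J" by simp
  define \<epsilon> where "\<epsilon> = sgn (d J)"
  have \<epsilon>: "\<bar>d j\<bar> = \<epsilon> * d j" if "J \<le> j" for j
  proof -
    have "pochhammer c j = pochhammer c J * pochhammer (c + real J) (j - J)"
      using that by (metis pochhammer_product)
    moreover define r where "r = fact J * pochhammer (c + real J) (j - J) / fact j"
    ultimately have "d j = d J * r" by (simp add: d_def)
    moreover have "0 \<le> r"
      unfolding r_def using J by (intro divide_nonneg_nonneg mult_nonneg_nonneg pochhammer_nonneg) auto
    ultimately show ?thesis by (simp add: \<epsilon>_def abs_mult sgn_if)
  qed
  have \<epsilon>1: "\<bar>\<epsilon>\<bar> \<le> 1" by (simp add: \<epsilon>_def sgn_if)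
  \<comment> \<open>The head is counted twice: once for its own absolute values and once for its
    removal from the full sum when the tail is isolated.\<close>
  define C where "C = 2 * (\<Sum>j<J. \<bar>d j\<bar>)"
  show thesis
  proof (rule that[of C])
    fix z :: real and N :: nat assume z: "0 \<le> z" "z < 1"
    have sums: "(\<lambda>j. d j * z ^ j) sums (1 - z) powr (- c)"
      unfolding d_def using z by (intro pochhammer_binomial_sums) auto
    have head: "\<bar>\<Sum>j<J. d j * z ^ j\<bar> \<le> (\<Sum>j<J. \<bar>d j\<bar>)" "(\<Sum>j<J. \<bar>d j\<bar> * z ^ j) \<le> (\<Sum>j<J. \<bar>d j\<bar>)"
    proof -
      have *: "\<bar>d j\<bar> * z ^ j \<le> \<bar>d j\<bar>" for j using z by (simp add: mult_left_le power_le_one)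
      show "(\<Sum>j<J. \<bar>d j\<bar> * z ^ j) \<le> (\<Sum>j<J. \<bar>d j\<bar>)" by (intro sum_mono *)
      have "\<bar>\<Sum>j<J. d j * z ^ j\<bar> \<le> (\<Sum>j<J. \<bar>d j * z ^ j\<bar>)" by (rule sum_abs)
      also have "\<dots> \<le> (\<Sum>j<J. \<bar>d j\<bar>)" using * z by (intro sum_mono) (auto simp: abs_mult)
      finally show "\<bar>\<Sum>j<J. d j * z ^ j\<bar> \<le> (\<Sum>j<J. \<bar>d j\<bar>)" .
    qed
    have tail: "(\<lambda>j. \<bar>d (j + J)\<bar> * z ^ (j + J)) sums (\<epsilon> * ((1 - z) powr (- c) - (\<Sum>j<J. d j * z ^ j)))"
      using sums_mult[OF sums_split_initial_segment[OF sums, of J], of \<epsilon>] \<epsilon> by (simp add: mult_ac)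
    have "(\<Sum>j<N. \<bar>d j\<bar> * z ^ j) \<le> (\<Sum>j<N + J. \<bar>d j\<bar> * z ^ j)"
      using z by (intro sum_mono2) auto
    also have "\<dots> = (\<Sum>j<J. \<bar>d j\<bar> * z ^ j) + (\<Sum>j<N. \<bar>d (j + J)\<bar> * z ^ (j + J))"
      by (induction N) (auto simp: add.commute)
    also have "(\<Sum>j<N. \<bar>d (j + J)\<bar> * z ^ (j + J)) \<le> \<epsilon> * ((1 - z) powr (- c) - (\<Sum>j<J. d j * z ^ j))"
      using tail z sum_le_suminf[OF sums_summable[OF tail], of "{..<N}"] by (simp add: sums_iff)
    also have "\<dots> \<le> \<bar>\<epsilon>\<bar> * \<bar>(1 - z) powr (- c) - (\<Sum>j<J. d j * z ^ j)\<bar>"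
      by (metis abs_ge_self abs_mult)
    also have "\<dots> \<le> 1 * \<bar>(1 - z) powr (- c) - (\<Sum>j<J. d j * z ^ j)\<bar>"
      using \<epsilon>1 by (intro mult_right_mono) auto
    also have "\<dots> \<le> (1 - z) powr (- c) + (\<Sum>j<J. \<bar>d j\<bar>)"
      using head(1) powr_ge_zero[of "1 - z" "- c"] unfolding mult_1_left by linarith
    finally show "(\<Sum>j<N. \<bar>pochhammer c j / fact j\<bar> * z ^ j) \<le> (1 - z) powr (- c) + C"
      using head(2) by (simp add: d_def C_def)
  qed
qed

text \<open>The coefficients can change sign and \<open>z\<close> can come arbitrarily close to 1,
  so monotone convergence does not apply directly. The bound on absolute partial sums gives a
  majorant made of the two integrable functions in the hypotheses.\<close>

lemma pochhammer_integral_sums: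
  fixes z w :: "'a \<Rightarrow> real" and c :: real
  assumes [measurable]: "z \<in> borel_measurable M"
    and z: "\<And>s. s \<in> space M \<Longrightarrow> 0 \<le> z s \<and> z s < 1"
    and w: "\<And>s. s \<in> space M \<Longrightarrow> 0 \<le> w s"
    and iw: "integrable M w" and i1: "integrable M (\<lambda>s. (1 - z s) powr (- c) * w s)"
  shows "(\<lambda>j. pochhammer c j / fact j * (\<integral>s. z s ^ j * w s \<partial>M)) sums (\<integral>s. (1 - z s) powr (- c) * w s \<partial>M)"
proof -
  define d where "d j = pochhammer c j / fact j" for j
  obtain C where C: "\<And>z N. 0 \<le> z \<Longrightarrow> z < 1 \<Longrightarrow> (\<Sum>j<N. \<bar>d j\<bar> * z ^ j) \<le> (1 - z) powr (- c) + C"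
    using pochhammer_binomial_abs_bound[of c] unfolding d_def by blast
  have [measurable]: "w \<in> borel_measurable M" using iw by auto
  have int: "integrable M (\<lambda>s. z s ^ j * w s)" for j
  proof (rule Bochner_Integration.integrable_bound[OF iw])
    show "AE s in M. norm (z s ^ j * w s) \<le> norm (w s)"
      using z w by (intro AE_I2) (auto simp: abs_mult less_imp_le intro!: mult_left_le_one_le power_le_one)
  qed measurable
  have intd: "integrable M (\<lambda>s. d j * (z s ^ j * w s))" for j using int by simp
  have "(\<lambda>j. \<integral>s. d j * (z s ^ j * w s) \<partial>M) sums (\<integral>s. (\<Sum>j. d j * (z s ^ j * w s)) \<partial>M)"
  proof (rule sums_integral[OF intd])
    show "AE s in M. summable (\<lambda>j. norm (d j * (z s ^ j * w s)))"
    proof (intro AE_I2 summableI_nonneg_bounded[where x = "((1 - z s) powr (- c) + C) * w s" for s])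
      fix s N assume s: "s \<in> space M"
      have "(\<Sum>j<N. norm (d j * (z s ^ j * w s))) = (\<Sum>j<N. \<bar>d j\<bar> * z s ^ j) * w s"
        using z[OF s] w[OF s] by (simp add: abs_mult sum_distrib_right mult.assoc)
      also have "\<dots> \<le> ((1 - z s) powr (- c) + C) * w s"
        using z[OF s] w[OF s] C by (intro mult_right_mono) auto
      finally show "(\<Sum>j<N. norm (d j * (z s ^ j * w s))) \<le> ((1 - z s) powr (- c) + C) * w s" .
    qed auto
    show "summable (\<lambda>j. \<integral>s. norm (d j * (z s ^ j * w s)) \<partial>M)"
    proof (rule summableI_nonneg_bounded)
      fix N
      have "(\<Sum>j<N. \<integral>s. norm (d j * (z s ^ j * w s)) \<partial>M) = (\<integral>s. (\<Sum>j<N. norm (d j * (z s ^ j * w s))) \<partial>M)"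
        using intd by (subst Bochner_Integration.integral_sum) auto
      also have "\<dots> \<le> (\<integral>s. (1 - z s) powr (- c) * w s + C * w s \<partial>M)"
      proof (rule integral_mono)
        show "integrable M (\<lambda>s. \<Sum>j<N. norm (d j * (z s ^ j * w s)))" using intd by auto
        show "integrable M (\<lambda>s. (1 - z s) powr (- c) * w s + C * w s)" using i1 iw by auto
        fix s assume s: "s \<in> space M"
        have "(\<Sum>j<N. norm (d j * (z s ^ j * w s))) = (\<Sum>j<N. \<bar>d j\<bar> * z s ^ j) * w s"
          using z[OF s] w[OF s] by (simp add: abs_mult sum_distrib_right mult.assoc)
        also have "\<dots> \<le> ((1 - z s) powr (- c) + C) * w s"
          using z[OF s] w[OF s] C by (intro mult_right_mono) auto
        finally show "(\<Sum>j<N. norm (d j * (z s ^ j * w s))) \<le> (1 - z s) powr (- c) * w s + C * w s"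
          by (simp add: distrib_right)
      qed
      finally show "(\<Sum>j<N. \<integral>s. norm (d j * (z s ^ j * w s)) \<partial>M) \<le> (\<integral>s. (1 - z s) powr (- c) * w s + C * w s \<partial>M)" .
    qed simp
  qed
  moreover have "(\<Sum>j. d j * (z s ^ j * w s)) = (1 - z s) powr (- c) * w s" if "s \<in> space M" for s
    using sums_mult2[OF pochhammer_binomial_sums[of "z s" c], of "w s"] z[OF that]
    by (simp add: sums_iff d_def mult_ac)
  hence "(\<integral>s. (\<Sum>j. d j * (z s ^ j * w s)) \<partial>M) = (\<integral>s. (1 - z s) powr (- c) * w s \<partial>M)"
    by (intro Bochner_Integration.integral_cong) auto
  ultimately show ?thesis by (simp add: d_def)
qed

text \<open>Rescaling moves the lower limit to 1, so that all terms of the series are integrals over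
  the same set, against powers of one function.\<close>

lemma upper_Gamma_scale:
  fixes c y :: real
  assumes y: "0 < y"
  shows "upper_Gamma c y = y powr c * (LINT s|lborel. indicator {1<..} s * (s powr (c - 1) * exp (- y * s)))"
proof -
  have "upper_Gamma c y = (LINT u|lborel. indicator {y<..} u * (u powr (c - 1) * exp (- u)))"
    by (simp add: upper_Gamma_def set_lebesgue_integral_def)
  also have "\<dots> = \<bar>y\<bar> *\<^sub>R (LINT s|lborel. indicator {y<..} (0 + y * s) * ((0 + y * s) powr (c - 1) * exp (- (0 + y * s))))"
    using y by (intro lborel_integral_real_affine) auto
  also have "(\<lambda>s. indicator {y<..} (0 + y * s) * ((0 + y * s) powr (c - 1) * exp (- (0 + y * s))))
     = (\<lambda>s. y powr (c - 1) * (indicator {1<..} s * (s powr (c - 1) * exp (- y * s))))"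
    using y by (auto simp: indicator_def powr_mult)
  also have "\<bar>y\<bar> *\<^sub>R (LINT s|lborel. y powr (c - 1) * (indicator {1<..} s * (s powr (c - 1) * exp (- y * s))))
     = y * y powr (c - 1) * (LINT s|lborel. indicator {1<..} s * (s powr (c - 1) * exp (- y * s)))"
    using y by simp
  also have "y * y powr (c - 1) = y powr c" using y by (simp add: powr_diff)
  finally show ?thesis .
qed

lemma powr_exp_bounded:
  fixes p y :: real
  assumes y: "0 < y"
  obtains C where "\<And>s. 1 \<le> s \<Longrightarrow> s powr p \<le> C * exp (y * s)" "0 \<le> C"
proof -
  obtain k :: nat where k: "p \<le> real k" using real_arch_simple by blast
  show thesis
  proof (rule that[of "fact k / y ^ k"])
    fix s :: real assume s: "1 \<le> s"
    have *: "(y * s) ^ k / fact k \<le> exp (y * s)" using s y by (intro power_div_fact_le_exp) auto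
    have "s powr p \<le> s powr real k" using s k by (intro powr_mono) auto
    also have "\<dots> = fact k / y ^ k * ((y * s) ^ k / fact k)"
      using s y by (simp add: powr_realpow power_mult_distrib)
    also have "\<dots> \<le> fact k / y ^ k * exp (y * s)"
      using * y by (intro mult_left_mono) auto
    finally show "s powr p \<le> fact k / y ^ k * exp (y * s)" .
  qed (use y in simp)
qed

text \<open>Half of the exponential absorbs the power of \<open>s\<close>; the rest is a Gamma
  integral shifted by 1, convergent at its left end because \<beta> > 0.\<close>

lemma shifted_Gamma_integrable:
  fixes \<beta> p y :: real
  assumes y: "0 < y" and \<beta>: "0 < \<beta>"
  shows "integrable lborel (\<lambda>s. indicator {1<..} s * ((s - 1) powr (\<beta> - 1) * s powr p * exp (- y * s)))"
proof -
  obtain C where C: "\<And>s. 1 \<le> s \<Longrightarrow> s powr p \<le> C * exp (y / 2 * s)" "0 \<le> C"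
    using powr_exp_bounded[of "y / 2" p] y by auto
  define h where "h s = indicator {1<..} s * ((s - 1) powr (\<beta> - 1) * exp (- (y / 2) * s))" for s :: real
  have [measurable]: "h \<in> borel_measurable borel" unfolding h_def by measurable
  have "(\<integral>\<^sup>+s. ennreal (h s) \<partial>lborel) = ennreal \<bar>1\<bar> * (\<integral>\<^sup>+s. ennreal (h (1 + 1 * s)) \<partial>lborel)"
    by (rule nn_integral_real_affine) auto
  also have "\<dots> = (\<integral>\<^sup>+s. ennreal (exp (- (y / 2))) * ennreal (indicator {0<..} s * s powr (\<beta> - 1) * exp (- (y / 2) * s)) \<partial>lborel)"
    by (simp, intro nn_integral_cong)
      (auto simp: h_def indicator_def distrib_left exp_add[symmetric] simp flip: ennreal_mult)
  also have "\<dots> = ennreal (exp (- (y / 2))) * (\<integral>\<^sup>+s. ennreal (indicator {0<..} s * s powr (\<beta> - 1) * exp (- (y / 2) * s)) \<partial>lborel)"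
    by (intro nn_integral_cmult) measurable
  also have "\<dots> < \<infinity>"
    using \<beta> y by (subst nn_integral_Gamma_scaled) (auto simp: ennreal_mult_less_top)
  finally have ih: "integrable lborel (\<lambda>s. C * h s)"
    by (intro integrable_mult_right integrableI_nonneg) (auto simp: h_def)
  show ?thesis
  proof (rule Bochner_Integration.integrable_bound[OF ih])
    show "AE s in lborel. norm (indicator {1<..} s * ((s - 1) powr (\<beta> - 1) * s powr p * exp (- y * s))) \<le> norm (C * h s)"
    proof (intro AE_I2)
      fix s :: real
      show "norm (indicator {1<..} s * ((s - 1) powr (\<beta> - 1) * s powr p * exp (- y * s))) \<le> norm (C * h s)"
      proof (cases "1 < s")
        case True
        have "(s - 1) powr (\<beta> - 1) * s powr p * exp (- y * s) \<le> (s - 1) powr (\<beta> - 1) * (C * exp (y / 2 * s)) * exp (- y * s)"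
          using C(1)[of s] True by (intro mult_right_mono mult_left_mono) auto
        also have "\<dots> = C * ((s - 1) powr (\<beta> - 1) * (exp (y / 2 * s) * exp (- y * s)))" by simp
        also have "exp (y / 2 * s) * exp (- y * s) = exp (- (y / 2) * s)"
          by (simp flip: exp_add)
        finally show ?thesis using True C(2) by (simp add: h_def abs_mult)
      qed (simp add: h_def)
    qed
  qed measurable
qed

lemma nggp_integrand_integrable:
  fixes \<sigma> y :: real and n :: nat
  assumes \<sigma>: "0 < \<sigma>" "\<sigma> < 1" and n: "1 \<le> n" and y: "0 < y"
  shows "integrable lborel (\<lambda>s. indicator {1<..} s * (s powr (real n - 1) * exp (- y * s)))" (is ?A)
    and "integrable lborel (\<lambda>s. indicator {1<..} s * ((1 - s powr (- 1 / \<sigma>)) powr (real n * \<sigma> - 1)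
            * s powr (real n - 1) * exp (- y * s)))" (is ?B)
proof -
  \<comment> \<open>If \<open>real n * \<sigma>\<close> < 1 the integrand is singular at 1 and is
    compared with a power of \<open>(s - 1) / s\<close>. That comparison reverses a lower bound on
    the base, which requires a nonpositive exponent; hence the cap at 1. Both exponents of interest,
    0 and \<open>real n * \<sigma> - 1\<close>, are at least \<open>\<beta> - 1\<close>.\<close>
  define \<beta> where "\<beta> = min (real n * \<sigma>) 1"
  have \<beta>: "0 < \<beta>" "\<beta> \<le> 1" "\<beta> \<le> real n * \<sigma>" using \<sigma> n by (auto simp: \<beta>_def)
  define D where "D s = indicator {1<..} s * ((s - 1) powr (\<beta> - 1) * s powr (real n - \<beta>) * exp (- y * s))" for s :: real
  have iD: "integrable lborel D" unfolding D_def using y \<beta>(1) by (rule shifted_Gamma_integrable)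
  have key: "\<bar>indicator {1<..} s * (1 - s powr (- 1 / \<sigma>)) powr e * s powr (real n - 1) * exp (- y * s)\<bar> \<le> D s"
    if e: "\<beta> - 1 \<le> e" for s e :: real
  proof (cases "1 < s")
    case True
    have "s powr (- 1 / \<sigma>) \<le> s powr - 1" using True \<sigma> by (intro powr_mono) (auto simp: field_simps)
    hence z: "(s - 1) / s \<le> 1 - s powr (- 1 / \<sigma>)" using True by (simp add: powr_minus field_simps)
    moreover have "0 < (s - 1) / s" using True by simp
    ultimately have z0: "0 < 1 - s powr (- 1 / \<sigma>)" by linarith
    have "(1 - s powr (- 1 / \<sigma>)) powr e \<le> (1 - s powr (- 1 / \<sigma>)) powr (\<beta> - 1)"
      using z0 e by (intro powr_mono') auto
    also have "\<dots> \<le> ((s - 1) / s) powr (\<beta> - 1)"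
      using z \<beta> True by (intro powr_mono2') auto
    also have "\<dots> = (s - 1) powr (\<beta> - 1) * s powr (1 - \<beta>)"
      using True by (simp add: powr_divide powr_diff)
    finally have "(1 - s powr (- 1 / \<sigma>)) powr e * (s powr (real n - 1) * exp (- y * s))
        \<le> (s - 1) powr (\<beta> - 1) * s powr (1 - \<beta>) * (s powr (real n - 1) * exp (- y * s))"
      by (intro mult_right_mono) auto
    also have "\<dots> = (s - 1) powr (\<beta> - 1) * (s powr (1 - \<beta>) * s powr (real n - 1)) * exp (- y * s)" by simp
    also have "s powr (1 - \<beta>) * s powr (real n - 1) = s powr (real n - \<beta>)" by (simp flip: powr_add)
    finally show ?thesis using True by (simp add: D_def mult.assoc)
  qed (simp add: D_def)
  show ?A
  proof (rule Bochner_Integration.integrable_bound[OF iD])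
    show "AE s in lborel. norm (indicator {1<..} s * (s powr (real n - 1) * exp (- y * s))) \<le> norm (D s)"
    proof (intro AE_I2)
      fix s :: real
      \<comment> \<open>Since \<open>0 powr 0\<close> is 0, the factor with exponent 0 disappears
        only once its base is known to be nonzero.\<close>
      have "s powr (- 1 / \<sigma>) < 1" if "1 < s" using that \<sigma> powr_less_mono[of "- 1 / \<sigma>" 0 s] by simp
      thus "norm (indicator {1<..} s * (s powr (real n - 1) * exp (- y * s))) \<le> norm (D s)"
        using key[of 0 s] \<beta> \<sigma> by (cases "1 < s") (auto simp: abs_mult)
    qed
  qed measurable
  show ?B
  proof (rule Bochner_Integration.integrable_bound[OF iD])
    show "AE s in lborel. norm (indicator {1<..} s * ((1 - s powr (- 1 / \<sigma>)) powr (real n * \<sigma> - 1)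
            * s powr (real n - 1) * exp (- y * s))) \<le> norm (D s)"
      using key[of "real n * \<sigma> - 1"] \<beta> by (intro AE_I2) (simp add: mult.assoc order_trans[OF _ abs_ge_self])
  qed measurable
qed

text \<open>After rescaling, \<open>y powr (- (j / \<sigma>))\<close> cancels
  \<open>a powr (j / \<sigma>) / S ^ j\<close>, and what remains is the binomial expansion of
  \<open>(1 - s powr (- 1 / \<sigma>)) powr (n * \<sigma> - 1)\<close> integrated term by term. In
  this form the integrand is nonnegative and \<open>S\<close> occurs only through \<open>y\<close>,
  whereas the signs of the terms of the series hide any monotonicity.\<close>

lemma nggp_series_integral:
  fixes \<sigma> a S :: real and n :: nat
  assumes \<sigma>: "0 < \<sigma>" "\<sigma> < 1" and n: "1 \<le> n" and a: "0 < a" and S: "0 < S"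
  defines "y \<equiv> a / S powr \<sigma>"
  shows "nggp_series \<sigma> a n S = y powr real n *
      (LINT s|lborel. indicator {1<..} s * ((1 - s powr (- 1 / \<sigma>)) powr (real n * \<sigma> - 1) * s powr (real n - 1) * exp (- y * s)))"
proof -
  have y: "0 < y" using a S by (simp add: y_def)
  define z where "z s = indicator {1<..} s * s powr (- 1 / \<sigma>)" for s :: real
  define w where "w s = indicator {1<..} s * (s powr (real n - 1) * exp (- y * s))" for s :: real
  define c where "c = 1 - real n * \<sigma>"
  have trm: "pochhammer c j / fact j * (a powr (real j / \<sigma>) / S ^ j) * upper_Gamma (real n - real j / \<sigma>) y
      = y powr real n * (pochhammer c j / fact j * (LINT s|lborel. z s ^ j * w s))" for j
  proof -
    have "y powr (real j / \<sigma>) = a powr (real j / \<sigma>) / S ^ j"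
      using a S \<sigma> by (simp add: y_def powr_divide powr_powr powr_realpow)
    moreover have "y powr (real n - real j / \<sigma>) * y powr (real j / \<sigma>) = y powr real n"
      by (simp flip: powr_add)
    ultimately have yy: "y powr (real n - real j / \<sigma>) * (a powr (real j / \<sigma>) / S ^ j) = y powr real n" by simp
    have "indicator {1<..} s * (s powr (real n - real j / \<sigma> - 1) * exp (- y * s)) = z s ^ j * w s" for s :: real
    proof (cases "1 < s")
      case True
      have "(s powr (- 1 / \<sigma>)) ^ j = s powr (- real j / \<sigma>)"
        using True by (simp add: powr_powr flip: powr_realpow)
      hence "(s powr (- 1 / \<sigma>)) ^ j * s powr (real n - 1) = s powr (real n - real j / \<sigma> - 1)"
        by (simp add: algebra_simps flip: powr_add)
      thus ?thesis using True by (simp add: z_def w_def)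
    qed (simp add: w_def)
    hence "upper_Gamma (real n - real j / \<sigma>) y = y powr (real n - real j / \<sigma>) * (LINT s|lborel. z s ^ j * w s)"
      by (subst upper_Gamma_scale[OF y]) simp
    thus ?thesis unfolding yy[symmetric] by (simp only: mult_ac)
  qed
  have zw: "(1 - z s) powr (- c) * w s = indicator {1<..} s * ((1 - s powr (- 1 / \<sigma>)) powr (real n * \<sigma> - 1) * s powr (real n - 1) * exp (- y * s))" for s
    by (simp add: z_def w_def c_def indicator_def)
  have sum: "(\<lambda>j. pochhammer c j / fact j * (\<integral>s. z s ^ j * w s \<partial>lborel)) sums (\<integral>s. (1 - z s) powr (- c) * w s \<partial>lborel)"
  proof (rule pochhammer_integral_sums)
    show "0 \<le> z s \<and> z s < 1" for s
      using \<sigma> powr_less_mono[of "- 1 / \<sigma>" 0 s] by (auto simp: z_def indicator_def)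
    show "integrable lborel w" "integrable lborel (\<lambda>s. (1 - z s) powr (- c) * w s)"
      using nggp_integrand_integrable[OF \<sigma> n y] unfolding zw by (auto simp: w_def[abs_def])
  qed (auto simp: z_def[abs_def] w_def)
  have "nggp_series \<sigma> a n S = (\<Sum>j. y powr real n * (pochhammer c j / fact j * (\<integral>s. z s ^ j * w s \<partial>lborel)))"
    unfolding nggp_series_def y_def[symmetric] c_def[symmetric] trm ..
  also have "\<dots> = y powr real n * (\<integral>s. (1 - z s) powr (- c) * w s \<partial>lborel)"
    using sums_mult[OF sum, of "y powr real n"] by (simp add: sums_iff)
  finally show ?thesis unfolding zw .
qed

text \<open>With \<open>L u = - ln (1 - u)\<close> the exponent is
  \<open>c * u + L u - B * exp (\<sigma> * L u)\<close>. As a function of \<open>L\<close> \<ge> 0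
  its first two terms grow with slope at most \<open>c + 1\<close>, and the last falls with slope at
  least \<open>B * \<sigma>\<close> \<ge> \<open>2 * c\<close>. So \<open>c\<close> \<ge> 1
  suffices, which is the condition \<open>2 / \<sigma>\<close> \<le> \<open>a\<close>.\<close>

lemma exp_tilt_powr_decreasing:
  fixes a \<sigma> B x y :: real
  assumes \<sigma>: "0 < \<sigma>" and B: "2 / \<sigma> \<le> a" "a \<le> B" and xy: "0 < x" "x \<le> y" "y < 1"
  shows "exp (\<sigma> * a / 2 * y) / (1 - y) * exp (- B * (1 - y) powr (- \<sigma>))
       \<le> exp (\<sigma> * a / 2 * x) / (1 - x) * exp (- B * (1 - x) powr (- \<sigma>))"
proof -
  define c where "c = \<sigma> * a / 2"
  have c: "1 \<le> c" using B \<sigma> by (simp add: c_def field_simps)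
  have a: "0 < a" using B(1) \<sigma> by (smt (verit) divide_pos_pos)
  define L where "L u = - ln (1 - u)" for u :: real
  have eq: "exp (c * u) / (1 - u) * exp (- B * (1 - u) powr (- \<sigma>)) = exp (c * u + L u - B * exp (\<sigma> * L u))"
    if u: "u < 1" for u
  proof -
    have e: "exp (L u) = 1 / (1 - u)" using u by (simp add: L_def exp_minus inverse_eq_divide)
    have p: "(1 - u) powr (- \<sigma>) = exp (\<sigma> * L u)" using u by (simp add: powr_def L_def)
    have "exp (c * u + L u - B * exp (\<sigma> * L u)) = exp (c * u) * exp (L u) * exp (- (B * exp (\<sigma> * L u)))"
      by (simp only: exp_add[symmetric] diff_conv_add_uminus)
    thus ?thesis unfolding e p by simp
  qed
  have L: "0 \<le> L x" "L x \<le> L y" using xy by (auto simp: L_def)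
  have id: "u = 1 - exp (- L u)" if "u < 1" for u using that by (simp add: L_def)
  define D where "D = L y - L x"
  have D: "0 \<le> D" using L by (simp add: D_def)
  have "y - x \<le> D"
  proof -
    have e: "1 - exp (- D) \<le> D" using exp_ge_add_one_self[of "- D"] by linarith
    have "y - x = exp (- L x) - exp (- L y)" using id[of x] id[of y] xy by linarith
    also have "\<dots> = exp (- L x) * (1 - exp (- D))" by (simp add: D_def algebra_simps flip: exp_add)
    also have "\<dots> \<le> 1 * D" using L D e by (intro mult_mono) auto
    finally show ?thesis by simp
  qed
  hence 1: "c * (y - x) \<le> c * D" using c by (intro mult_left_mono) auto
  have "\<sigma> * D \<le> exp (\<sigma> * L y) - exp (\<sigma> * L x)"
  proof -
    have e: "\<sigma> * D \<le> exp (\<sigma> * D) - 1" using exp_ge_add_one_self[of "\<sigma> * D"] by linarith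
    have "1 * (\<sigma> * D) \<le> exp (\<sigma> * L x) * (exp (\<sigma> * D) - 1)"
      using L D \<sigma> e by (intro mult_mono) auto
    also have "\<dots> = exp (\<sigma> * L y) - exp (\<sigma> * L x)" by (simp add: D_def algebra_simps flip: exp_add)
    finally show ?thesis by simp
  qed
  hence 2: "B * (\<sigma> * D) \<le> B * (exp (\<sigma> * L y) - exp (\<sigma> * L x))" using B a by (intro mult_left_mono) auto
  have "(1 + c) * D \<le> (B * \<sigma>) * D"
  proof (intro mult_right_mono D)
    have "1 + c \<le> 2 * c" using c by simp
    also have "\<dots> = a * \<sigma>" by (simp add: c_def)
    also have "\<dots> \<le> B * \<sigma>" using B \<sigma> by simp
    finally show "1 + c \<le> B * \<sigma>" .
  qed
  with 1 2 have "c * y + L y - B * exp (\<sigma> * L y) \<le> c * x + L x - B * exp (\<sigma> * L x)"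
    unfolding right_diff_distrib distrib_right mult.assoc D_def by linarith
  moreover have "x < 1" using xy by simp
  ultimately show ?thesis unfolding c_def[symmetric] eq[OF \<open>x < 1\<close>] eq[OF xy(3)] by simp
qed

text \<open>The prefactor \<open>Y powr n\<close> of the integral form contributes
  \<open>(1 - x) powr (- \<sigma> * n)\<close>, which reduces the explicit power to
  \<open>1 / (1 - x)\<close> whatever \<open>n\<close> is. For each fixed \<open>s\<close> the
  remaining dependence on \<open>x\<close> is that of the tilted exponential with rate
  \<open>b * s\<close> \<ge> \<open>a\<close>.\<close>

lemma nggp_factor_decreasing:
  fixes \<sigma> a R x y :: real and n :: nat
  assumes \<sigma>: "0 < \<sigma>" "\<sigma> < 1" and n: "1 \<le> n" and a: "2 / \<sigma> \<le> a" and R: "0 < R" "R \<le> 1"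
    and xy: "0 < x" "x \<le> y" "y < 1"
  shows "exp (\<sigma> * a / 2 * y) * ((1 - y) powr (real n * \<sigma> - 1) * nggp_series \<sigma> a n ((1 - y) * R))
       \<le> exp (\<sigma> * a / 2 * x) * ((1 - x) powr (real n * \<sigma> - 1) * nggp_series \<sigma> a n ((1 - x) * R))"
proof -
  have a0: "0 < a" using a \<sigma> by (smt (verit) divide_pos_pos)
  define b where "b = a / R powr \<sigma>"
  have "R powr \<sigma> \<le> 1" using R \<sigma> by (intro powr_le1) auto
  hence b: "a \<le> b" using a0 R by (simp add: b_def pos_le_divide_eq)
  define k where "k s = (1 - s powr (- 1 / \<sigma>)) powr (real n * \<sigma> - 1) * s powr (real n - 1)" for s :: real
  define h where "h u s = indicator {1<..} s * (b powr real n * (exp (\<sigma> * a / 2 * u) / (1 - u)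
      * exp (- (b * s) * (1 - u) powr (- \<sigma>))) * k s)" for u s :: real
  have eq: "exp (\<sigma> * a / 2 * u) * ((1 - u) powr (real n * \<sigma> - 1) * nggp_series \<sigma> a n ((1 - u) * R)) = (LINT s|lborel. h u s)"
    and int: "integrable lborel (h u)" if u: "u < 1" for u
  proof -
    define Y where "Y = a / ((1 - u) * R) powr \<sigma>"
    have Y: "Y = b * (1 - u) powr (- \<sigma>)"
      using u R by (simp add: Y_def b_def powr_mult powr_minus divide_inverse)
    have "0 < Y" using u R a0 by (simp add: Y_def)
    define c where "c = exp (\<sigma> * a / 2 * u) / (1 - u) * b powr real n"
    have hc: "h u = (\<lambda>s. c * (indicator {1<..} s * ((1 - s powr (- 1 / \<sigma>)) powr (real n * \<sigma> - 1) * s powr (real n - 1) * exp (- Y * s))))"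
      by (intro ext) (simp add: h_def c_def Y k_def mult_ac)
    show "integrable lborel (h u)"
      unfolding hc using nggp_integrand_integrable(2)[OF \<sigma> n \<open>0 < Y\<close>] by simp
    have "(1 - u) powr (real n * \<sigma> - 1) * Y powr real n = b powr real n / (1 - u)"
    proof -
      have "Y powr real n = b powr real n * (1 - u) powr (- \<sigma> * real n)"
        using a0 b u by (simp add: Y powr_mult powr_powr)
      moreover have "(1 - u) powr (real n * \<sigma> - 1) * (1 - u) powr (- \<sigma> * real n) = (1 - u) powr - 1"
        by (simp add: mult.commute flip: powr_add)
      moreover have "(1 - u) powr - 1 = 1 / (1 - u)" using u by (simp add: powr_minus_divide)
      ultimately show ?thesis by (simp add: mult_ac)
    qed
    hence "exp (\<sigma> * a / 2 * u) * ((1 - u) powr (real n * \<sigma> - 1) * Y powr real n) = c"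
      by (simp add: c_def)
    moreover have "nggp_series \<sigma> a n ((1 - u) * R) = Y powr real n
        * (LINT s|lborel. indicator {1<..} s * ((1 - s powr (- 1 / \<sigma>)) powr (real n * \<sigma> - 1) * s powr (real n - 1) * exp (- Y * s)))"
      (is "_ = _ * ?I") unfolding Y_def using u R by (intro nggp_series_integral \<sigma> n a0) simp
    moreover have "(LINT s|lborel. h u s) = c * ?I" unfolding hc by (rule integral_mult_right_zero)
    ultimately show "exp (\<sigma> * a / 2 * u) * ((1 - u) powr (real n * \<sigma> - 1) * nggp_series \<sigma> a n ((1 - u) * R)) = (LINT s|lborel. h u s)"
      by (simp only: mult.assoc[symmetric])
  qed
  have x1: "x < 1" using xy by simp
  show ?thesis
    unfolding eq[OF x1] eq[OF xy(3)]
  proof (rule integral_mono[OF int[OF xy(3)] int[OF x1]])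
    fix s :: real
    show "h y s \<le> h x s"
    proof (cases "1 < s")
      case True
      have "a * 1 \<le> b * s" using b True a0 by (intro mult_mono) auto
      hence "exp (\<sigma> * a / 2 * y) / (1 - y) * exp (- (b * s) * (1 - y) powr (- \<sigma>))
           \<le> exp (\<sigma> * a / 2 * x) / (1 - x) * exp (- (b * s) * (1 - x) powr (- \<sigma>))"
        using \<sigma> a xy by (intro exp_tilt_powr_decreasing) auto
      thus ?thesis unfolding h_def
        by (intro mult_left_mono mult_right_mono) (auto simp: k_def)
    qed (simp add: h_def)
  qed
qed

lemma nggp_series_nonneg:
  assumes "0 < \<sigma>" "\<sigma> < 1" "1 \<le> n" "0 < a" "0 < S"
  shows "0 \<le> nggp_series \<sigma> a n S"
  unfolding nggp_series_integral[OF assms]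
  by (intro mult_nonneg_nonneg Bochner_Integration.integral_nonneg) auto

lemma measurable_nggp_series[measurable]: "nggp_series \<sigma> a n \<in> borel_measurable borel"
  unfolding nggp_series_def[abs_def] upper_Gamma_def set_lebesgue_integral_def
  unfolding greaterThan_def indicator_def by measurable

lemma measurable_nggp_density:
  "case_prod (nggp_density \<sigma> a m) \<in> borel_measurable (Pi\<^sub>M {..<m} (\<lambda>_. borel) \<Otimes>\<^sub>M borel)"
  unfolding nggp_density_def[abs_def] Let_def split_def by measurable

lemma nggp_moment_ratio:
  assumes \<sigma>: "0 < \<sigma>" "\<sigma> < 1" and a: "2 / \<sigma> \<le> a" and q: "2 \<le> q"
    and u: "\<And>i. i < m \<Longrightarrow> 0 \<le> u i \<and> u i < 1"
  shows "(\<integral>\<^sup>+x. ennreal (x ^ q) * ennreal (nggp_density \<sigma> a m u x) \<partial>lborel)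
       \<le> ennreal (12 * Gamma (real q + 1 - \<sigma>) * (\<sigma> * a / 2) powr (1 - real q))
          * (\<integral>\<^sup>+x. ennreal x * ennreal (nggp_density \<sigma> a m u x) \<partial>lborel)"
proof -
  define R where "R = (\<Prod>i<m. 1 - u i)"
  have R: "0 < R" "R \<le> 1" unfolding R_def using prod_one_minus_bounds[of m u] u by auto
  define n where "n = Suc m"
  \<comment> \<open>The denominator series depends only on the earlier sticks and is hidden in
    \<open>K\<close>, so no lower bound for it has to be found.\<close>
  define K where "K = (if m = 0 then exp a / (Gamma \<sigma> * Gamma (1 - \<sigma>))
     else \<sigma> * Gamma ((real n - 1) * \<sigma>) / (Gamma (1 - \<sigma>) * Gamma (real n * \<sigma>)) / nggp_series \<sigma> a m R)"
  define g where "g x = (1 - x) powr (real n * \<sigma> - 1) * nggp_series \<sigma> a n ((1 - x) * R)" for x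
  have a0: "0 < a" using a \<sigma> by (smt (verit) divide_pos_pos)
  show ?thesis
  proof (rule moment_ratio[where K = K and g = g])
    show "nggp_density \<sigma> a m u \<in> borel_measurable borel"
      unfolding nggp_density_def[abs_def] Let_def by measurable
    show "nggp_density \<sigma> a m u x = K * (x powr - \<sigma> * g x)" if "x \<in> {0<..<1}" for x
    proof (cases "m = 0")
      case True
      have "R = 1" using True by (simp add: R_def)
      thus ?thesis using that True by (simp add: nggp_density_def Let_def K_def g_def n_def)
    next
      case False
      thus ?thesis using that
        unfolding nggp_density_def Let_def K_def g_def R_def[symmetric] n_def[symmetric] by simp
    qed
    show "exp (\<sigma> * a / 2 * y) * g y \<le> exp (\<sigma> * a / 2 * x) * g x" if "0 < x" "x \<le> y" "y < 1" for x y
      unfolding g_def by (rule nggp_factor_decreasing) (use \<sigma> a R that in \<open>auto simp: n_def\<close>)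
    show "0 \<le> g x" if "x \<in> {0<..<1}" for x
      unfolding g_def using that \<sigma> a0 R by (intro mult_nonneg_nonneg nggp_series_nonneg) (auto simp: n_def)
    show "1 \<le> \<sigma> * a / 2" using a \<sigma> by (simp add: field_simps)
  qed (use \<sigma> q in \<open>auto simp: nggp_density_def Let_def\<close>)
qed

section \<open>Moment bounds for the weights\<close>

text \<open>The common interface between the five stick-breaking families and the concentration
  bound: \<rho> may depend on the parameter, but is the same for every position
  \<open>m\<close>.\<close>

definition weight_moment_bound ::
    "'w measure \<Rightarrow> real measure \<Rightarrow> ('w \<Rightarrow> real measure) \<Rightarrow> nat \<Rightarrow> ennreal \<Rightarrow> bool" where
  "weight_moment_bound M H P q \<rho> \<longleftrightarrow>
     (\<exists>v. stick_breaking M H v P \<and>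
        (\<forall>m. (\<integral>\<^sup>+\<omega>. ennreal (stick_weight v m \<omega> ^ q) \<partial>M) \<le> \<rho> * (\<integral>\<^sup>+\<omega>. ennreal (stick_weight v m \<omega>) \<partial>M)))"

lemma stick_breakingD:
  assumes "stick_breaking M H v P"
  shows "v i \<in> borel_measurable M" and "\<omega> \<in> space M \<Longrightarrow> 0 \<le> v i \<omega> \<and> v i \<omega> \<le> 1"
  using assms by (auto simp: stick_breaking_def)

text \<open>From \<open>1 + t\<close> \<le> \<open>exp t\<close>, the factor
  \<open>(1 - x) powr (\<beta> - 1)\<close> falls at least at the rate \<open>\<beta> - 1\<close>,
  and \<open>\<beta> - 1\<close> \<ge> \<open>a / 2\<close> once \<open>a\<close> \<ge> 2. The first
  Beta parameter is written \<open>1 - s\<close> to match the singularity: \<open>s = 0\<close> for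
  the Dirichlet process, \<open>s = b\<close> for the two-parameter process.\<close>

lemma beta_moment_ratio:
  fixes s \<beta> a :: real
  assumes s: "0 \<le> s" "s < 1" and a: "2 \<le> a" "a \<le> \<beta>" and q: "2 \<le> q"
  shows "(\<integral>\<^sup>+x. ennreal (x ^ q) * ennreal (beta_density (1 - s) \<beta> x) \<partial>lborel)
       \<le> ennreal (12 * Gamma (real q + 1 - s) * (a / 2) powr (1 - real q))
          * (\<integral>\<^sup>+x. ennreal x * ennreal (beta_density (1 - s) \<beta> x) \<partial>lborel)"
proof (rule moment_ratio[where K = "1 / Beta (1 - s) \<beta>" and g = "\<lambda>x. (1 - x) powr (\<beta> - 1)"])
  show "beta_density (1 - s) \<beta> \<in> borel_measurable borel"
    unfolding beta_density_def[abs_def] by measurable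
  show "exp (a / 2 * y) * (1 - y) powr (\<beta> - 1) \<le> exp (a / 2 * x) * (1 - x) powr (\<beta> - 1)"
    if xy: "0 < x" "x \<le> y" "y < 1" for x y
  proof -
    have "1 - y = (1 - x) * (1 + - ((y - x) / (1 - x)))" using xy by (simp add: field_simps)
    also have "\<dots> \<le> (1 - x) * exp (- ((y - x) / (1 - x)))"
      using xy by (intro mult_left_mono exp_ge_add_one_self) auto
    also have "\<dots> \<le> (1 - x) * exp (- (y - x))"
    proof -
      have "(y - x) / 1 \<le> (y - x) / (1 - x)" using xy by (intro divide_left_mono) auto
      thus ?thesis using xy by (intro mult_left_mono) auto
    qed
    finally have "(1 - y) powr (\<beta> - 1) \<le> ((1 - x) * exp (- (y - x))) powr (\<beta> - 1)"
      using xy a by (intro powr_mono2) auto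
    also have "\<dots> = (1 - x) powr (\<beta> - 1) * exp (- ((\<beta> - 1) * (y - x)))"
      using xy by (simp add: powr_mult exp_powr_real mult.commute) (simp add: algebra_simps)
    also have "\<dots> \<le> (1 - x) powr (\<beta> - 1) * exp (- (a / 2 * (y - x)))"
    proof -
      have "a / 2 * (y - x) \<le> (\<beta> - 1) * (y - x)" using a xy by (intro mult_right_mono) auto
      thus ?thesis by (intro mult_left_mono) auto
    qed
    finally have "exp (a / 2 * y) * (1 - y) powr (\<beta> - 1)
        \<le> exp (a / 2 * y) * ((1 - x) powr (\<beta> - 1) * exp (- (a / 2 * (y - x))))"
      by (intro mult_left_mono) auto
    also have "\<dots> = (exp (a / 2 * y) * exp (- (a / 2 * (y - x)))) * (1 - x) powr (\<beta> - 1)" by simp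
    also have "exp (a / 2 * y) * exp (- (a / 2 * (y - x))) = exp (a / 2 * x)"
      by (simp only: exp_add[symmetric] right_diff_distrib) simp
    finally show ?thesis .
  qed
qed (use assms in \<open>auto simp: beta_density_def\<close>)

lemma beta_weight_moment_bound:
  assumes M: "prob_space M" and sb: "stick_breaking M H v P"
    and indep: "prob_space.indep_vars M (\<lambda>_. borel) v UNIV"
    and v: "\<And>i. distributed M lborel (v i) (\<lambda>x. ennreal (beta_density (1 - s) (\<beta> i) x))"
    and s: "0 \<le> s" "s < 1" and a: "2 \<le> a" "\<And>i. a \<le> \<beta> i" and q: "2 \<le> q"
  shows "weight_moment_bound M H P q (ennreal (12 * Gamma (real q + 1 - s) * (a / 2) powr (1 - real q)))"
  unfolding weight_moment_bound_def
proof (intro exI conjI allI)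
  fix m
  have nn: "(\<integral>\<^sup>+\<omega>. ennreal (v m \<omega> ^ p) \<partial>M) = (\<integral>\<^sup>+x. ennreal (x ^ p) * ennreal (beta_density (1 - s) (\<beta> m) x) \<partial>lborel)" for p
    using distributed_nn_integral[OF v[of m], of "\<lambda>x. ennreal (x ^ p)"] by (simp add: mult.commute)
  show "(\<integral>\<^sup>+\<omega>. ennreal (stick_weight v m \<omega> ^ q) \<partial>M)
      \<le> ennreal (12 * Gamma (real q + 1 - s) * (a / 2) powr (1 - real q)) * (\<integral>\<^sup>+\<omega>. ennreal (stick_weight v m \<omega>) \<partial>M)"
    using beta_moment_ratio[OF s a(1) a(2)[of m] q] nn[of q] nn[of 1] q
    by (intro stick_weight_moment_indep[OF M indep stick_breakingD(2)[OF sb]]) auto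
qed fact

lemma DP_weight_moment_bound:
  assumes "prob_space M" "is_DP M a H P" "2 \<le> a" "2 \<le> q"
  shows "weight_moment_bound M H P q (ennreal (12 * Gamma (real q + 1 - 0) * (a / 2) powr (1 - real q)))"
proof -
  from assms(2) obtain v where v: "stick_breaking M H v P" "prob_space.indep_vars M (\<lambda>_. borel) v UNIV"
      "\<And>i. distributed M lborel (v i) (\<lambda>x. ennreal (beta_density (1 - 0) a x))"
    by (auto simp: is_DP_def)
  show ?thesis by (rule beta_weight_moment_bound[OF assms(1) v]) (use assms in auto)
qed

lemma PDP_weight_moment_bound:
  assumes "prob_space M" "is_PDP M a b H P" "2 \<le> a" "2 \<le> q"
  shows "weight_moment_bound M H P q (ennreal (12 * Gamma (real q + 1 - b) * (a / 2) powr (1 - real q)))"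
proof -
  from assms(2) obtain v where v: "stick_breaking M H v P" "prob_space.indep_vars M (\<lambda>_. borel) v UNIV"
      "\<And>i. distributed M lborel (v i) (\<lambda>x. ennreal (beta_density (1 - b) (a + real (Suc i) * b) x))"
    and b: "0 < b" "b < 1"
    unfolding is_PDP_def by blast
  show ?thesis by (rule beta_weight_moment_bound[OF assms(1) v]) (use assms b in auto)
qed

lemma NIGP_weight_moment_bound:
  assumes M: "prob_space M" and P: "is_NIGP M a H P" and a: "4 \<le> a" and q: "2 \<le> q"
  shows "weight_moment_bound M H P q (ennreal (12 * Gamma (real q + 1 - 1 / 2) * (a / 4) powr (1 - real q)))"
proof -
  from P obtain v where v: "stick_breaking M H v P" "has_conditional_densities M v (nigp_density a)"
    by (auto simp: is_NIGP_def)
  show ?thesis unfolding weight_moment_bound_def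
    using q by (intro exI[of _ v] conjI allI v(1) stick_weight_moment_conditional[OF M v(2) stick_breakingD[OF v(1)]]
      measurable_nigp_density nigp_moment_ratio[OF a q]) auto
qed

lemma NGGP_weight_moment_bound:
  assumes M: "prob_space M" and P: "is_NGGP M \<sigma> a H P" and a: "2 / \<sigma> \<le> a" and q: "2 \<le> q"
  shows "weight_moment_bound M H P q (ennreal (12 * Gamma (real q + 1 - \<sigma>) * (\<sigma> * a / 2) powr (1 - real q)))"
proof -
  from P obtain v where v: "stick_breaking M H v P" "has_conditional_densities M v (nggp_density \<sigma> a)"
    and \<sigma>: "0 < \<sigma>" "\<sigma> < 1"
    by (auto simp: is_NGGP_def)
  show ?thesis unfolding weight_moment_bound_def
    using q by (intro exI[of _ v] conjI allI v(1) stick_weight_moment_conditional[OF M v(2) stick_breakingD[OF v(1)]]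
      measurable_nggp_density nggp_moment_ratio[OF \<sigma> a q]) auto
qed

lemma DPG_weight_moment_bound:
  assumes M: "prob_space M" and P: "is_DPG M (g a) H P" and ui: "unit_interval_laws g" and a: "0 < a" and q: "1 \<le> q"
    and r: "(\<integral>x. x ^ q \<partial>g a) \<le> r * (\<integral>x. x \<partial>g a)" and "0 \<le> r"
  shows "weight_moment_bound M H P q (ennreal r)"
proof -
  interpret prob_space M by fact
  from P obtain v where v: "stick_breaking M H v P" "indep_vars (\<lambda>_. borel) v UNIV" "\<And>i. distr M borel (v i) = g a"
    by (auto simp: is_DPG_def)
  note sb = stick_breakingD[OF v(1)]
  note [measurable] = sb(1)
  have nn: "(\<integral>\<^sup>+\<omega>. ennreal (v m \<omega> ^ p) \<partial>M) = ennreal (\<integral>x. x ^ p \<partial>g a)" for m p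
  proof -
    have int: "integrable M (\<lambda>\<omega>. v m \<omega> ^ p)"
      using sb(2)[of _ m] by (intro integrable_const_bound[where B = 1]) (auto intro!: AE_I2 power_le_one)
    have "(\<integral>\<^sup>+\<omega>. ennreal (v m \<omega> ^ p) \<partial>M) = ennreal (\<integral>\<omega>. v m \<omega> ^ p \<partial>M)"
      using sb(2)[of _ m] by (intro nn_integral_eq_integral int) (auto intro!: AE_I2)
    also have "(\<integral>\<omega>. v m \<omega> ^ p \<partial>M) = (\<integral>x. x ^ p \<partial>g a)"
      unfolding v(3)[of m, symmetric] by (subst integral_distr) auto
    finally show ?thesis .
  qed
  show ?thesis unfolding weight_moment_bound_def
  proof (intro exI[of _ v] conjI allI v(1))
    fix m
    have "ennreal (\<integral>x. x ^ q \<partial>g a) \<le> ennreal r * ennreal (\<integral>x. x \<partial>g a)"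
      using r \<open>0 \<le> r\<close> by (simp add: ennreal_leI flip: ennreal_mult')
    thus "(\<integral>\<^sup>+\<omega>. ennreal (stick_weight v m \<omega> ^ q) \<partial>M) \<le> ennreal r * (\<integral>\<^sup>+\<omega>. ennreal (stick_weight v m \<omega>) \<partial>M)"
      using nn[of m q] nn[of m 1] q
      by (intro stick_weight_moment_indep[OF M v(2) sb(2)]) auto
  qed
qed

text \<open>The growth condition with \<open>j = 1\<close> gives \<open>k q\<close> \<ge>
  \<open>q * k 1\<close>, and the nonvanishing leading coefficient bounds the mean below by a
  multiple of \<open>a powr (- k 1)\<close>.\<close>

lemma moment_assumption_ratio:
  assumes g: "unit_interval_laws g" and M: "moment_assumption g"
  obtains k where "0 < k"
    "\<And>q. 1 \<le> q \<Longrightarrow> \<exists>C\<ge>0. eventually (\<lambda>a. (\<integral>x. x ^ q \<partial>g a) \<le> C * a powr (- k * (real q - 1)) * (\<integral>x. x \<partial>g a)) at_top"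
proof -
  from M obtain Cf k where k: "\<And>p. 1 \<le> p \<Longrightarrow> 0 < k p" "\<And>i j. 1 \<le> j \<Longrightarrow> j \<le> i \<Longrightarrow> real i * k j \<le> real j * k i"
    and C1: "Cf 1 \<noteq> 0"
    and o: "\<And>p. 1 \<le> p \<Longrightarrow> (\<lambda>a. (\<integral>x. x ^ p \<partial>g a) - Cf p / a powr k p) \<in> o(\<lambda>a. 1 / a powr k p)"
    unfolding moment_assumption_def by blast
  show thesis
  proof (rule that)
    show "0 < k 1" using k(1) by simp
    fix q :: nat assume q: "1 \<le> q"
    \<comment> \<open>Half the leading coefficient is the error allowed for the mean. As the mean is
      nonnegative, being within \<open>c * A\<close> of a number of modulus \<open>2 * c * A\<close>
      forces it to be at least \<open>c * A\<close>.\<close>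
    define c where "c = \<bar>Cf 1\<bar> / 2"
    have c: "0 < c" using C1 by (simp add: c_def)
    define C where "C = (\<bar>Cf q\<bar> + 1) / c"
    have C: "0 \<le> C" using c by (simp add: C_def)
    have "eventually (\<lambda>a. norm ((\<integral>x. x ^ q \<partial>g a) - Cf q / a powr k q) \<le> 1 * norm (1 / a powr k q)) at_top"
      by (rule landau_o.smallD[OF o[OF q]]) simp
    moreover have "eventually (\<lambda>a. norm ((\<integral>x. x ^ 1 \<partial>g a) - Cf 1 / a powr k 1) \<le> c * norm (1 / a powr k 1)) at_top"
      by (rule landau_o.smallD[OF o]) (use c in auto)
    ultimately have "eventually (\<lambda>a. (\<integral>x. x ^ q \<partial>g a) \<le> C * a powr (- k 1 * (real q - 1)) * (\<integral>x. x \<partial>g a)) at_top"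
      using eventually_ge_at_top[of 1]
    proof eventually_elim
      case (elim a)
      interpret prob_space "g a" using g elim by (auto simp: unit_interval_laws_def)
      have sets: "sets (g a) = sets borel" and e1: "emeasure (g a) {0<..<1} = 1"
        using g elim by (auto simp: unit_interval_laws_def)
      have "AE x in g a. x \<in> {0<..<1}"
        by (rule AE_in_set_eq_1[THEN iffD2]) (use sets e1 in \<open>auto simp: measure_def\<close>)
      hence "0 \<le> (\<integral>x. x \<partial>g a)" by (intro integral_nonneg_AE) (auto elim!: eventually_mono)
      define A where "A = a powr - k 1"
      have A: "0 < A" "1 / a powr k 1 = A" "Cf 1 / a powr k 1 = Cf 1 * A"
        using elim by (auto simp: A_def powr_minus divide_inverse)
      have "\<bar>(\<integral>x. x \<partial>g a) - Cf 1 * A\<bar> \<le> c * A"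
        using elim(2) unfolding power_one_right A(2,3) using A(1) by simp
      moreover have "\<bar>Cf 1 * A\<bar> = 2 * c * A" using A by (simp add: c_def abs_mult)
      ultimately have lower: "c * A \<le> (\<integral>x. x \<partial>g a)" using \<open>0 \<le> (\<integral>x. x \<partial>g a)\<close> by linarith
      define B where "B = a powr - k q"
      have B: "0 < B" "1 / a powr k q = B" "Cf q / a powr k q = Cf q * B"
        using elim by (auto simp: B_def powr_minus divide_inverse)
      have "\<bar>(\<integral>x. x ^ q \<partial>g a) - Cf q * B\<bar> \<le> 1 * B"
        using elim(1) unfolding B(2,3) using B(1) by simp
      moreover have "Cf q * B \<le> \<bar>Cf q\<bar> * B" using B by (intro mult_right_mono) auto
      ultimately have "(\<integral>x. x ^ q \<partial>g a) \<le> (\<bar>Cf q\<bar> + 1) * B" by (simp add: distrib_right)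
      also have "B \<le> a powr (- k 1 * (real q - 1)) * A"
      proof -
        have "a powr - k q \<le> a powr (- (real q * k 1))"
          using k(2)[of 1 q] q elim by (intro powr_mono) auto
        also have "\<dots> = a powr (- k 1 * (real q - 1)) * A"
          unfolding A_def by (simp add: algebra_simps flip: powr_add)
        finally show ?thesis by (simp add: B_def)
      qed
      hence "(\<bar>Cf q\<bar> + 1) * B \<le> (\<bar>Cf q\<bar> + 1) * (a powr (- k 1 * (real q - 1)) * A)"
        by (intro mult_left_mono) auto
      also have "\<dots> = C * a powr (- k 1 * (real q - 1)) * (c * A)"
        using c by (simp add: C_def)
      also have "\<dots> \<le> C * a powr (- k 1 * (real q - 1)) * (\<integral>x. x \<partial>g a)"
        using lower C by (intro mult_left_mono) auto
      finally show ?case .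
    qed
    with C show "\<exists>C\<ge>0. eventually (\<lambda>a. (\<integral>x. x ^ q \<partial>g a) \<le> C * a powr (- k 1 * (real q - 1)) * (\<integral>x. x \<partial>g a)) at_top"
      by (intro exI[of _ C] conjI)
  qed
qed

section \<open>The generalized Dirichlet process\<close>

text \<open>At the argument \<open>u\<close> times the vector (1, ..., N), the powers of the fixed
  vector are absorbed into nonnegative coefficients, leaving a series in \<open>u\<close>
  alone.\<close>

definition Phi2_coeff :: "nat \<Rightarrow> real \<Rightarrow> real \<Rightarrow> (nat \<Rightarrow> nat) \<Rightarrow> real" where
  "Phi2_coeff N \<alpha> c i = (\<Prod>k=1..N. pochhammer \<alpha> (i k) / fact (i k) * real k ^ i k) / pochhammer c (\<Sum>k=1..N. i k)"

text \<open>Partial sums over cubes of multi-indices: they exhaust all multi-indices, and sums of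
  products over them factorise.\<close>

definition Phi2_box :: "nat \<Rightarrow> real \<Rightarrow> real \<Rightarrow> nat \<Rightarrow> real \<Rightarrow> real" where
  "Phi2_box N \<alpha> c K u = (\<Sum>i\<in>PiE {1..N} (\<lambda>_. {..<K}). Phi2_coeff N \<alpha> c i * u ^ (\<Sum>k=1..N. i k))"

lemma Phi2_coeff_nonneg:
  assumes "0 < \<alpha>" "0 < c"
  shows "0 \<le> Phi2_coeff N \<alpha> c i"
  unfolding Phi2_coeff_def using assms
  by (intro divide_nonneg_nonneg prod_nonneg mult_nonneg_nonneg pochhammer_nonneg ballI) auto

lemma Phi2_term:
  "(\<Prod>k=1..N. pochhammer \<alpha> (i k)) / pochhammer c (\<Sum>k=1..N. i k) * (\<Prod>k=1..N. (u * real k) ^ i k / fact (i k))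
     = Phi2_coeff N \<alpha> c i * u ^ (\<Sum>k=1..N. i k)"
  by (simp add: Phi2_coeff_def power_sum power_mult_distrib prod.distrib prod_dividef mult_ac)

lemma Phi2_nonneg:
  assumes "0 < \<alpha>" "0 < c" "0 \<le> u"
  shows "0 \<le> Phi2 N (\<lambda>_. \<alpha>) c (\<lambda>k. u * real k)"
  unfolding Phi2_def Phi2_term using assms
  by (intro infsum_nonneg mult_nonneg_nonneg Phi2_coeff_nonneg) auto

text \<open>Every finite set of multi-indices lies in some cube. If the series is not summable,
  \<open>infsum\<close> is 0 by default and the inequality still holds.\<close>

lemma Phi2_le_SUP_box:
  assumes "0 < \<alpha>" "0 < c" "0 \<le> u"
  shows "ennreal (Phi2 N (\<lambda>_. \<alpha>) c (\<lambda>k. u * real k)) \<le> (SUP K. ennreal (Phi2_box N \<alpha> c K u))"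
proof -
  let ?t = "\<lambda>i. Phi2_coeff N \<alpha> c i * u ^ (\<Sum>k=1..N. i k)"
  let ?A = "PiE {1..N} (\<lambda>_. UNIV :: nat set)"
  let ?S = "SUP K. ennreal (Phi2_box N \<alpha> c K u)"
  have t: "0 \<le> ?t i" for i using assms by (intro mult_nonneg_nonneg Phi2_coeff_nonneg) auto
  have fin: "ennreal (sum ?t F) \<le> ?S" if F: "finite F" "F \<subseteq> ?A" for F
  proof -
    define K where "K = Suc (\<Sum>i\<in>F. \<Sum>k=1..N. i k)"
    have "F \<subseteq> PiE {1..N} (\<lambda>_. {..<K})"
    proof
      fix i assume i: "i \<in> F"
      have "i k < K" if "k \<in> {1..N}" for k
      proof -
        have "i k \<le> (\<Sum>k=1..N. i k)" using that by (intro member_le_sum) auto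
        also have "\<dots> \<le> (\<Sum>i\<in>F. \<Sum>k=1..N. i k)" using i F by (intro member_le_sum) auto
        finally show ?thesis by (simp add: K_def)
      qed
      thus "i \<in> PiE {1..N} (\<lambda>_. {..<K})" using i F by (auto simp: PiE_iff subset_eq)
    qed
    hence "sum ?t F \<le> Phi2_box N \<alpha> c K u"
      unfolding Phi2_box_def using t by (intro sum_mono2 finite_PiE) auto
    thus ?thesis by (intro SUP_upper2[of K] ennreal_leI) auto
  qed
  show ?thesis
  proof (cases "?t summable_on ?A \<and> ?S < \<infinity>")
    case True
    then obtain b where b: "?S = ennreal b" "0 \<le> b" by (cases ?S) auto
    have "infsum ?t ?A \<le> b"
      using True fin b by (intro infsum_le_finite_sums) (auto simp: ennreal_le_iff)
    thus ?thesis unfolding Phi2_def Phi2_term using b by (simp add: ennreal_leI)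
  next
    case False
    hence "\<not> ?t summable_on ?A \<or> \<not> ?S < \<infinity>" by blast
    thus ?thesis unfolding Phi2_def Phi2_term
    proof
      assume "\<not> ?t summable_on ?A"
      hence "infsum ?t ?A = 0" by (rule infsum_not_exists)
      thus "ennreal (infsum ?t ?A) \<le> ?S" by (simp only: ennreal_0 zero_le)
    next
      assume "\<not> ?S < \<infinity>"
      hence "?S = \<top>" unfolding infinity_ennreal_def by (simp only: less_top[symmetric] not_not)
      thus "ennreal (infsum ?t ?A) \<le> ?S" by (simp only: top_greatest)
    qed
  qed
qed

text \<open>Integrating \<open>u powr (c + n - 1)\<close> produces
  \<open>Gamma (c + n) = pochhammer c n * Gamma c\<close>, which cancels the one factor that couples
  the indices. The sum over the cube then splits into \<open>N\<close> binomial series;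
  \<open>s\<close> > \<open>N\<close> places each argument \<open>k / s\<close> below 1.\<close>

lemma Phi2_box_Laplace_le:
  fixes \<alpha> s c :: real
  assumes \<alpha>: "0 < \<alpha>" and c: "0 < c" and s: "real N < s"
  shows "(\<integral>\<^sup>+u. ennreal (indicator {0<..} u * u powr (c - 1) * exp (- s * u)) * ennreal (Phi2_box N \<alpha> c K u) \<partial>lborel)
     \<le> ennreal (Gamma c / s powr c * (\<Prod>k=1..N. (1 - real k / s) powr (- \<alpha>)))"
proof -
  have s0: "0 < s" using s by linarith
  let ?B = "PiE {1..N} (\<lambda>_. {..<K})"
  let ?n = "\<lambda>i :: nat \<Rightarrow> nat. \<Sum>k=1..N. i k"
  have fB: "finite ?B" by (intro finite_PiE) auto
  have "(\<integral>\<^sup>+u. ennreal (indicator {0<..} u * u powr (c - 1) * exp (- s * u)) * ennreal (Phi2_box N \<alpha> c K u) \<partial>lborel)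
     = (\<integral>\<^sup>+u. (\<Sum>i\<in>?B. ennreal (Phi2_coeff N \<alpha> c i) * ennreal (indicator {0<..} u * u powr ((c + real (?n i)) - 1) * exp (- s * u))) \<partial>lborel)"
  proof (intro nn_integral_cong)
    fix u :: real
    show "ennreal (indicator {0<..} u * u powr (c - 1) * exp (- s * u)) * ennreal (Phi2_box N \<alpha> c K u)
      = (\<Sum>i\<in>?B. ennreal (Phi2_coeff N \<alpha> c i) * ennreal (indicator {0<..} u * u powr ((c + real (?n i)) - 1) * exp (- s * u)))"
    proof (cases "0 < u")
      case True
      have p: "u powr ((c + real (?n i)) - 1) = u powr (c - 1) * u ^ ?n i" for i
        using True powr_add[of u "c - 1" "real (?n i)"] by (simp add: powr_realpow algebra_simps del: of_nat_sum)
      have "(\<Sum>i\<in>?B. ennreal (Phi2_coeff N \<alpha> c i) * ennreal (indicator {0<..} u * u powr ((c + real (?n i)) - 1) * exp (- s * u)))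
          = (\<Sum>i\<in>?B. ennreal (u powr (c - 1) * exp (- s * u) * (Phi2_coeff N \<alpha> c i * u ^ ?n i)))"
        unfolding p using True Phi2_coeff_nonneg[OF \<alpha> c]
        by (intro sum.cong refl) (simp add: mult_ac flip: ennreal_mult')
      also have "\<dots> = ennreal (\<Sum>i\<in>?B. u powr (c - 1) * exp (- s * u) * (Phi2_coeff N \<alpha> c i * u ^ ?n i))"
        using True Phi2_coeff_nonneg[OF \<alpha> c] by (intro sum_ennreal) (auto intro!: mult_nonneg_nonneg)
      also have "(\<Sum>i\<in>?B. u powr (c - 1) * exp (- s * u) * (Phi2_coeff N \<alpha> c i * u ^ ?n i))
          = u powr (c - 1) * exp (- s * u) * Phi2_box N \<alpha> c K u"
        by (simp only: Phi2_box_def sum_distrib_left)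
      also have "ennreal \<dots> = ennreal (indicator {0<..} u * u powr (c - 1) * exp (- s * u)) * ennreal (Phi2_box N \<alpha> c K u)"
        using True by (simp add: ennreal_mult')
      finally show ?thesis ..
    qed simp
  qed
  also have "\<dots> = (\<Sum>i\<in>?B. ennreal (Phi2_coeff N \<alpha> c i) *
      (\<integral>\<^sup>+u. ennreal (indicator {0<..} u * u powr ((c + real (?n i)) - 1) * exp (- s * u)) \<partial>lborel))"
    by (subst nn_integral_sum) (auto simp: nn_integral_cmult)
  also have "\<dots> = (\<Sum>i\<in>?B. ennreal (Gamma c / s powr c * (\<Prod>k=1..N. pochhammer \<alpha> (i k) / fact (i k) * (real k / s) ^ i k)))"
  proof (intro sum.cong refl)
    fix i
    have "Gamma (c + real (?n i)) = pochhammer c (?n i) * Gamma c"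
      using c by (subst pochhammer_Gamma) (auto simp: Gamma_eq_zero_iff elim!: nonpos_Ints_cases)
    moreover have "s powr (c + real (?n i)) = s powr c * s ^ ?n i"
      using s0 by (simp add: powr_add powr_realpow del: of_nat_sum)
    moreover have "pochhammer c (?n i) \<noteq> 0" using c pochhammer_pos[of c "?n i"] by simp
    moreover have "(\<Prod>k=1..N. pochhammer \<alpha> (i k) / fact (i k) * (real k / s) ^ i k)
        = (\<Prod>k=1..N. pochhammer \<alpha> (i k) / fact (i k) * real k ^ i k) / s ^ ?n i"
      by (simp add: power_sum power_divide prod_dividef prod.distrib)
    ultimately have "Phi2_coeff N \<alpha> c i * (Gamma (c + real (?n i)) / s powr (c + real (?n i)))
        = Gamma c / s powr c * (\<Prod>k=1..N. pochhammer \<alpha> (i k) / fact (i k) * (real k / s) ^ i k)"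
      by (simp add: Phi2_coeff_def)
    moreover have "(\<integral>\<^sup>+u. ennreal (indicator {0<..} u * u powr ((c + real (?n i)) - 1) * exp (- s * u)) \<partial>lborel)
        = ennreal (Gamma (c + real (?n i)) / s powr (c + real (?n i)))"
      by (intro nn_integral_Gamma_scaled add_pos_nonneg of_nat_0_le_iff c s0)
    ultimately show "ennreal (Phi2_coeff N \<alpha> c i) * (\<integral>\<^sup>+u. ennreal (indicator {0<..} u * u powr ((c + real (?n i)) - 1) * exp (- s * u)) \<partial>lborel)
       = ennreal (Gamma c / s powr c * (\<Prod>k=1..N. pochhammer \<alpha> (i k) / fact (i k) * (real k / s) ^ i k))"
      using Phi2_coeff_nonneg[OF \<alpha> c, of N i] by (simp flip: ennreal_mult')
  qed
  also have "\<dots> = ennreal (\<Sum>i\<in>?B. Gamma c / s powr c * (\<Prod>k=1..N. pochhammer \<alpha> (i k) / fact (i k) * (real k / s) ^ i k))"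
    using c s0 \<alpha> by (intro sum_ennreal mult_nonneg_nonneg divide_nonneg_nonneg prod_nonneg ballI pochhammer_nonneg Gamma_real_nonneg) auto
  also have "(\<Sum>i\<in>?B. Gamma c / s powr c * (\<Prod>k=1..N. pochhammer \<alpha> (i k) / fact (i k) * (real k / s) ^ i k))
      = Gamma c / s powr c * (\<Prod>k=1..N. \<Sum>j<K. pochhammer \<alpha> j / fact j * (real k / s) ^ j)"
    by (simp only: sum_distrib_left[symmetric] prod_sum_PiE finite_atLeastAtMost finite_lessThan)
  also have "ennreal \<dots> \<le> ennreal (Gamma c / s powr c * (\<Prod>k=1..N. (1 - real k / s) powr (- \<alpha>)))"
  proof (intro ennreal_leI mult_left_mono prod_mono conjI)
    fix k assume k: "k \<in> {1..N}"
    hence z: "0 \<le> real k / s" "real k / s < 1" using s s0 by auto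
    show "0 \<le> (\<Sum>j<K. pochhammer \<alpha> j / fact j * (real k / s) ^ j)"
      using \<alpha> z by (intro sum_nonneg mult_nonneg_nonneg divide_nonneg_nonneg pochhammer_nonneg) auto
    have sums: "(\<lambda>j. pochhammer \<alpha> j / fact j * (real k / s) ^ j) sums (1 - real k / s) powr (- \<alpha>)"
      using z by (intro pochhammer_binomial_sums) auto
    show "(\<Sum>j<K. pochhammer \<alpha> j / fact j * (real k / s) ^ j) \<le> (1 - real k / s) powr (- \<alpha>)"
      unfolding sums_unique[OF sums] using \<alpha> z
      by (intro sum_le_suminf sums_summable[OF sums] mult_nonneg_nonneg divide_nonneg_nonneg pochhammer_nonneg ballI) auto
  qed (use c s0 in \<open>auto intro!: divide_nonneg_nonneg Gamma_real_nonneg\<close>)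
  finally show ?thesis .
qed

lemma Phi2_Laplace_le:
  fixes \<alpha> s c :: real
  assumes \<alpha>: "0 < \<alpha>" and c: "0 < c" and s: "real N < s"
  shows "(\<integral>\<^sup>+u. ennreal (indicator {0<..} u * u powr (c - 1) * exp (- s * u)) * (SUP K. ennreal (Phi2_box N \<alpha> c K u)) \<partial>lborel)
     \<le> ennreal (Gamma c / s powr c * (\<Prod>k=1..N. (1 - real k / s) powr (- \<alpha>)))"
proof -
  let ?w = "\<lambda>u. ennreal (indicator {0<..} u * u powr (c - 1) * exp (- s * u))"
  have [measurable]: "Phi2_box N \<alpha> c K \<in> borel_measurable borel" for K
    unfolding Phi2_box_def[abs_def] by measurable
  have "(\<integral>\<^sup>+u. ?w u * (SUP K. ennreal (Phi2_box N \<alpha> c K u)) \<partial>lborel) = (\<integral>\<^sup>+u. (SUP K. ?w u * ennreal (Phi2_box N \<alpha> c K u)) \<partial>lborel)"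
    by (simp add: SUP_mult_left_ennreal)
  also have "\<dots> = (SUP K. \<integral>\<^sup>+u. ?w u * ennreal (Phi2_box N \<alpha> c K u) \<partial>lborel)"
  proof (rule nn_integral_monotone_convergence_SUP)
    show "incseq (\<lambda>K u. ?w u * ennreal (Phi2_box N \<alpha> c K u))"
    proof (intro monoI le_funI)
      fix K L :: nat and u :: real assume "K \<le> L"
      show "?w u * ennreal (Phi2_box N \<alpha> c K u) \<le> ?w u * ennreal (Phi2_box N \<alpha> c L u)"
      proof (cases "0 < u")
        case True
        have "Phi2_box N \<alpha> c K u \<le> Phi2_box N \<alpha> c L u"
          unfolding Phi2_box_def using \<open>K \<le> L\<close> True Phi2_coeff_nonneg[OF \<alpha> c]
          by (intro sum_mono2 finite_PiE PiE_mono) auto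
        thus ?thesis by (intro mult_left_mono ennreal_leI) auto
      qed simp
    qed
  qed measurable
  also have "\<dots> \<le> ennreal (Gamma c / s powr c * (\<Prod>k=1..N. (1 - real k / s) powr (- \<alpha>)))"
    by (intro SUP_least Phi2_box_Laplace_le assms)
  finally show ?thesis .
qed

text \<open>The change of variables (t, x) to (t x, t (1 - x)), whose Jacobian is \<open>t\<close>,
  carried out as two one-dimensional substitutions with Fubini between them. Dropping the
  restriction to positive \<open>t\<close> makes it an inequality.\<close>

lemma nn_integral_simplex_coordinates_le:
  fixes F G :: "real \<Rightarrow> ennreal"
  assumes [measurable]: "F \<in> borel_measurable borel" "G \<in> borel_measurable borel"
  shows "(\<integral>\<^sup>+x. \<integral>\<^sup>+t. indicator {0<..} t * (ennreal t * (F (t * x) * G (t * (1 - x)))) \<partial>lborel \<partial>lborel)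
     \<le> (\<integral>\<^sup>+u. F u \<partial>lborel) * (\<integral>\<^sup>+u. G u \<partial>lborel)"
proof -
  have "(\<integral>\<^sup>+x. \<integral>\<^sup>+t. indicator {0<..} t * (ennreal t * (F (t * x) * G (t * (1 - x)))) \<partial>lborel \<partial>(lborel :: real measure))
     = (\<integral>\<^sup>+t. \<integral>\<^sup>+x. indicator {0<..} t * (ennreal t * (F (t * x) * G (t * (1 - x)))) \<partial>lborel \<partial>lborel)"
    by (intro lborel_pair.Fubini') measurable
  also have "\<dots> \<le> (\<integral>\<^sup>+t. \<integral>\<^sup>+u. F u * G (t - u) \<partial>lborel \<partial>lborel)"
  proof (rule nn_integral_mono)
    fix t :: real
    show "(\<integral>\<^sup>+x. indicator {0<..} t * (ennreal t * (F (t * x) * G (t * (1 - x)))) \<partial>lborel) \<le> (\<integral>\<^sup>+u. F u * G (t - u) \<partial>lborel)"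
    proof (cases "0 < t")
      case True
      have "(\<integral>\<^sup>+u. F u * G (t - u) \<partial>lborel) = ennreal \<bar>t\<bar> * (\<integral>\<^sup>+x. F (0 + t * x) * G (t - (0 + t * x)) \<partial>lborel)"
        using True by (intro nn_integral_real_affine) auto
      also have "\<dots> = (\<integral>\<^sup>+x. ennreal t * (F (t * x) * G (t * (1 - x))) \<partial>lborel)"
        using True by (subst nn_integral_cmult[symmetric]) (auto simp: right_diff_distrib)
      finally show ?thesis using True by simp
    qed simp
  qed
  also have "\<dots> = (\<integral>\<^sup>+u. \<integral>\<^sup>+t. F u * G (t - u) \<partial>lborel \<partial>lborel)"
    by (intro lborel_pair.Fubini') measurable
  also have "\<dots> = (\<integral>\<^sup>+u. F u * (\<integral>\<^sup>+v. G v \<partial>lborel) \<partial>lborel)"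
  proof (rule nn_integral_cong)
    fix u :: real
    have "(\<integral>\<^sup>+v. G v \<partial>lborel) = ennreal \<bar>1\<bar> * (\<integral>\<^sup>+t. G (- u + 1 * t) \<partial>lborel)"
      by (intro nn_integral_real_affine) auto
    thus "(\<integral>\<^sup>+t. F u * G (t - u) \<partial>lborel) = F u * (\<integral>\<^sup>+v. G v \<partial>lborel)"
      by (subst nn_integral_cmult) (auto simp: algebra_simps)
  qed
  also have "\<dots> = (\<integral>\<^sup>+u. F u \<partial>lborel) * (\<integral>\<^sup>+u. G u \<partial>lborel)"
    by (intro nn_integral_multc) measurable
  finally show ?thesis .
qed

lemma ennreal_integral_le_nn_integral:
  assumes "\<And>x. 0 \<le> f x"
  shows "ennreal (integral\<^sup>L M f) \<le> (\<integral>\<^sup>+x. ennreal (f x) \<partial>M)"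
proof (cases "integrable M f")
  case True
  thus ?thesis using assms by (subst nn_integral_eq_integral) auto
qed (simp add: not_integrable_integral_eq)

text \<open>Up to the factor \<open>fact r powr \<alpha> / Gamma (r * \<alpha>)\<close>, this is the density of a sum of \<open>r\<close>
  independent Gamma variables with shape \<open>\<alpha>\<close> and rates 1 to \<open>r\<close>. Replacing \<open>Phi2\<close> by the
  supremum of its partial sums avoids all questions of summability and measurability, as only an
  upper bound for the density is needed.\<close>

definition gdp_kernel :: "nat \<Rightarrow> real \<Rightarrow> real \<Rightarrow> ennreal" where
  "gdp_kernel r \<alpha> u = ennreal (indicator {0<..} u * u powr (real r * \<alpha> - 1) * exp (- real r * u))
     * (SUP K. ennreal (Phi2_box (r - 1) \<alpha> (real r * \<alpha>) K u))"

lemma measurable_gdp_kernel[measurable]: "gdp_kernel r \<alpha> \<in> borel_measurable borel"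
  unfolding gdp_kernel_def[abs_def] Phi2_box_def by measurable

text \<open>Writes the two-cell density as that of a ratio \<open>X / (X + Y)\<close> with total
  \<open>t\<close>: since \<open>al 0 + al 1 = a\<close>, the power of \<open>t\<close> splits into
  one factor for each kernel and a single leftover \<open>t\<close>, the Jacobian.\<close>

lemma gdp_density_le:
  assumes r: "1 \<le> r" and al: "0 < al 0" "0 < al 1" "al 0 + al 1 = a"
    and y: "y 0 = x" "y 1 = 1 - x" and x: "0 < x" "x < 1"
  shows "ennreal (gdp_density a r 1 al y) \<le> ennreal (fact r powr a / (Gamma (real r * al 0) * Gamma (real r * al 1)))
     * (\<integral>\<^sup>+t. indicator {0<..} t * (ennreal t * (gdp_kernel r (al 0) (t * x) * gdp_kernel r (al 1) (t * (1 - x)))) \<partial>lborel)"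
proof -
  define \<Phi> where "\<Phi> j u = Phi2 (r - 1) (\<lambda>_. al j) (real r * al j) (\<lambda>k. u * real k)" for j u
  define S where "S j u = (SUP K. ennreal (Phi2_box (r - 1) (al j) (real r * al j) K u))" for j u
  have [measurable]: "S j \<in> borel_measurable borel" for j
    unfolding S_def[abs_def] Phi2_box_def by measurable
  have \<Phi>: "0 \<le> \<Phi> j u" "ennreal (\<Phi> j u) \<le> S j u" if "j = 0 \<or> j = 1" "0 \<le> u" for j u
    unfolding \<Phi>_def S_def using that al r by (auto intro!: Phi2_nonneg Phi2_le_SUP_box)
  define B where "B = x powr (real r * al 0 - 1) * (1 - x) powr (real r * al 1 - 1)"
  define h where "h t = indicator {0<..} t * (t powr (real r * a - 1) * exp (- real r * t) * (\<Phi> 0 (t * x) * \<Phi> 1 (t * (1 - x))))" for t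
  have h: "0 \<le> h t" for t
    using \<Phi>(1) x by (auto simp: h_def indicator_def intro!: mult_nonneg_nonneg)
  have split: "gdp_density a r 1 al y = fact r powr a / (Gamma (real r * al 0) * Gamma (real r * al 1)) * (B * (LINT t|lborel. h t))"
  proof -
    have nn: "\<forall>i\<le>1. 0 \<le> y i" using x y by (auto simp: le_Suc_eq)
    show ?thesis unfolding gdp_density_def if_P[OF nn]
      using y by (simp add: atMost_Suc set_lebesgue_integral_def B_def h_def \<Phi>_def mult_ac)
  qed
  have "ennreal (B * (LINT t|lborel. h t)) = ennreal B * ennreal (LINT t|lborel. h t)"
    by (intro ennreal_mult') (simp add: B_def)
  also have "\<dots> \<le> ennreal B * (\<integral>\<^sup>+t. ennreal (indicator {0<..} t * (t powr (real r * a - 1) * exp (- real r * t))) * (S 0 (t * x) * S 1 (t * (1 - x))) \<partial>lborel)"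
  proof (rule mult_left_mono)
    have "ennreal (LINT t|lborel. h t) \<le> (\<integral>\<^sup>+t. ennreal (h t) \<partial>lborel)"
      using h by (rule ennreal_integral_le_nn_integral)
    also have "\<dots> \<le> (\<integral>\<^sup>+t. ennreal (indicator {0<..} t * (t powr (real r * a - 1) * exp (- real r * t))) * (S 0 (t * x) * S 1 (t * (1 - x))) \<partial>lborel)"
    proof (rule nn_integral_mono)
      fix t :: real
      show "ennreal (h t) \<le> ennreal (indicator {0<..} t * (t powr (real r * a - 1) * exp (- real r * t))) * (S 0 (t * x) * S 1 (t * (1 - x)))"
      proof (cases "0 < t")
        case True
        hence "0 \<le> t * x" "0 \<le> t * (1 - x)" using x by auto
        have "ennreal (h t) = ennreal (t powr (real r * a - 1) * exp (- real r * t)) * (ennreal (\<Phi> 0 (t * x)) * ennreal (\<Phi> 1 (t * (1 - x))))"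
          using True \<Phi>(1) \<open>0 \<le> t * x\<close> \<open>0 \<le> t * (1 - x)\<close> by (simp add: h_def ennreal_mult)
        also have "\<dots> \<le> ennreal (t powr (real r * a - 1) * exp (- real r * t)) * (S 0 (t * x) * S 1 (t * (1 - x)))"
          using \<open>0 \<le> t * x\<close> \<open>0 \<le> t * (1 - x)\<close> by (intro mult_left_mono mult_mono \<Phi>) auto
        finally show ?thesis using True by simp
      qed (simp add: h_def)
    qed
    finally show "ennreal (LINT t|lborel. h t) \<le> (\<integral>\<^sup>+t. ennreal (indicator {0<..} t * (t powr (real r * a - 1) * exp (- real r * t))) * (S 0 (t * x) * S 1 (t * (1 - x))) \<partial>lborel)" .
  qed simp
  also have "\<dots> = (\<integral>\<^sup>+t. ennreal B * (ennreal (indicator {0<..} t * (t powr (real r * a - 1) * exp (- real r * t))) * (S 0 (t * x) * S 1 (t * (1 - x)))) \<partial>lborel)"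
    by (rule nn_integral_cmult[symmetric]) measurable
  also have "\<dots> = (\<integral>\<^sup>+t. indicator {0<..} t * (ennreal t * (gdp_kernel r (al 0) (t * x) * gdp_kernel r (al 1) (t * (1 - x)))) \<partial>lborel)"
  proof (rule nn_integral_cong)
    fix t :: real
    show "ennreal B * (ennreal (indicator {0<..} t * (t powr (real r * a - 1) * exp (- real r * t))) * (S 0 (t * x) * S 1 (t * (1 - x))))
      = indicator {0<..} t * (ennreal t * (gdp_kernel r (al 0) (t * x) * gdp_kernel r (al 1) (t * (1 - x))))"
    proof (cases "0 < t")
      case True
      have e: "B * (t powr (real r * a - 1) * exp (- real r * t))
        = t * (((t * x) powr (real r * al 0 - 1) * exp (- real r * (t * x))) * ((t * (1 - x)) powr (real r * al 1 - 1) * exp (- real r * (t * (1 - x)))))"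
      proof -
        have "t powr (real r * a - 1) = t powr (1 + (real r * al 0 - 1) + (real r * al 1 - 1))"
          unfolding al(3)[symmetric] by (simp add: algebra_simps)
        also have "\<dots> = t * t powr (real r * al 0 - 1) * t powr (real r * al 1 - 1)"
          using True by (simp only: powr_add powr_one)
        finally have 1: "t powr (real r * a - 1) = t * t powr (real r * al 0 - 1) * t powr (real r * al 1 - 1)" .
        have 2: "exp (- real r * t) = exp (- real r * (t * x)) * exp (- real r * (t * (1 - x)))"
          by (simp add: algebra_simps flip: exp_add)
        show ?thesis unfolding 1 2 B_def using True x by (simp add: powr_mult)
      qed
      have pos: "0 < t * x" "0 < t * (1 - x)" using True x by auto
      have "ennreal B * (ennreal (t powr (real r * a - 1) * exp (- real r * t)) * (S 0 (t * x) * S 1 (t * (1 - x))))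
          = ennreal (B * (t powr (real r * a - 1) * exp (- real r * t))) * (S 0 (t * x) * S 1 (t * (1 - x)))"
        by (subst ennreal_mult) (simp_all add: B_def mult.assoc)
      also have "\<dots> = ennreal t * ((ennreal ((t * x) powr (real r * al 0 - 1) * exp (- real r * (t * x))) * S 0 (t * x))
            * (ennreal ((t * (1 - x)) powr (real r * al 1 - 1) * exp (- real r * (t * (1 - x)))) * S 1 (t * (1 - x))))"
        unfolding e using True by (simp add: ennreal_mult mult_ac)
      finally show ?thesis using True pos by (simp add: gdp_kernel_def S_def)
    qed simp
  qed
  finally have "ennreal (B * (LINT t|lborel. h t)) \<le> (\<integral>\<^sup>+t. indicator {0<..} t * (ennreal t * (gdp_kernel r (al 0) (t * x) * gdp_kernel r (al 1) (t * (1 - x)))) \<partial>lborel)" .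
  moreover have "0 \<le> fact r powr a / (Gamma (real r * al 0) * Gamma (real r * al 1))"
    using al r by (intro divide_nonneg_nonneg mult_nonneg_nonneg Gamma_real_nonneg) auto
  ultimately show ?thesis unfolding split
    by (subst ennreal_mult') (auto intro: mult_left_mono)
qed

text \<open>With \<open>s = r - d\<close>, the factor \<open>s * (1 - k / s)\<close> is
  \<open>(r - k) - d\<close>, so the binomial factors together with the power of \<open>s\<close>
  become the product over the rates 1 to \<open>r\<close>. The smallest rate is 1, hence
  \<open>d\<close> < 1.\<close>

lemma gdp_kernel_Laplace_le:
  assumes r: "1 \<le> r" and \<alpha>: "0 < \<alpha>" and d: "d < 1"
  shows "(\<integral>\<^sup>+u. gdp_kernel r \<alpha> u * ennreal (exp (d * u)) \<partial>lborel)
     \<le> ennreal (Gamma (real r * \<alpha>) * (\<Prod>k=1..r. 1 / (real k - d)) powr \<alpha>)"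
proof -
  define N where "N = r - 1"
  have rN: "r = Suc N" using r by (simp add: N_def)
  define s where "s = real r - d"
  have s: "real N < s" "0 < s" using d by (auto simp: s_def rN)
  have "(\<integral>\<^sup>+u. gdp_kernel r \<alpha> u * ennreal (exp (d * u)) \<partial>lborel)
     = (\<integral>\<^sup>+u. ennreal (indicator {0<..} u * u powr (real r * \<alpha> - 1) * exp (- s * u)) * (SUP K. ennreal (Phi2_box N \<alpha> (real r * \<alpha>) K u)) \<partial>lborel)"
  proof (rule nn_integral_cong)
    fix u :: real
    have "ennreal (indicator {0<..} u * u powr (real r * \<alpha> - 1) * exp (- real r * u)) * ennreal (exp (d * u))
        = ennreal (indicator {0<..} u * u powr (real r * \<alpha> - 1) * (exp (- real r * u) * exp (d * u)))"
      by (simp add: mult.assoc flip: ennreal_mult'')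
    also have "exp (- real r * u) * exp (d * u) = exp (- s * u)"
      by (simp add: s_def algebra_simps flip: exp_add)
    finally have eq: "ennreal (indicator {0<..} u * u powr (real r * \<alpha> - 1) * exp (- real r * u)) * ennreal (exp (d * u))
        = ennreal (indicator {0<..} u * u powr (real r * \<alpha> - 1) * exp (- s * u))" .
    show "gdp_kernel r \<alpha> u * ennreal (exp (d * u))
       = ennreal (indicator {0<..} u * u powr (real r * \<alpha> - 1) * exp (- s * u)) * (SUP K. ennreal (Phi2_box N \<alpha> (real r * \<alpha>) K u))"
      unfolding gdp_kernel_def N_def[symmetric] eq[symmetric] by (simp only: mult_ac)
  qed
  also have "\<dots> \<le> ennreal (Gamma (real r * \<alpha>) / s powr (real r * \<alpha>) * (\<Prod>k=1..N. (1 - real k / s) powr (- \<alpha>)))"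
    using \<alpha> r s by (intro Phi2_Laplace_le) auto
  also have "Gamma (real r * \<alpha>) / s powr (real r * \<alpha>) * (\<Prod>k=1..N. (1 - real k / s) powr (- \<alpha>))
      = Gamma (real r * \<alpha>) * (\<Prod>k=1..r. 1 / (real k - d)) powr \<alpha>"
  proof -
    \<comment> \<open>The reflection \<open>k\<close> to \<open>r - k\<close>; the index 0 on the
      right supplies the factor \<open>1 / s\<close>.\<close>
    have "(\<Prod>k=1..r. 1 / (real k - d)) = (\<Prod>k\<in>insert 0 {1..N}. 1 / (s - real k))"
      by (rule prod.reindex_bij_witness[of _ "\<lambda>k. r - k" "\<lambda>k. r - k"]) (auto simp: s_def rN)
    also have "\<dots> = 1 / s * (\<Prod>k=1..N. 1 / (s - real k))" by simp
    finally have e: "(\<Prod>k=1..r. 1 / (real k - d)) = 1 / s * (\<Prod>k=1..N. 1 / (s - real k))" .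
    have "(\<Prod>k=1..r. 1 / (real k - d)) powr \<alpha> = (1 / s) powr \<alpha> * (\<Prod>k=1..N. 1 / (s - real k)) powr \<alpha>"
      unfolding e by (rule powr_mult)
    also have "(\<Prod>k=1..N. 1 / (s - real k)) powr \<alpha> = (\<Prod>k=1..N. (1 / (s - real k)) powr \<alpha>)"
      by (rule prod_powr_distrib)
    also have "(\<Prod>k=1..N. (1 / (s - real k)) powr \<alpha>) = (\<Prod>k=1..N. (1 / s) powr \<alpha> * (1 - real k / s) powr (- \<alpha>))"
    proof (intro prod.cong refl)
      fix k assume "k \<in> {1..N}"
      hence k: "0 < 1 - real k / s" "s - real k = s * (1 - real k / s)" using s by (auto simp: field_simps)
      show "(1 / (s - real k)) powr \<alpha> = (1 / s) powr \<alpha> * (1 - real k / s) powr (- \<alpha>)"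
      proof -
        define w where "w = 1 - real k / s"
        have "(1 / (s * w)) powr \<alpha> = (1 / s * (1 / w)) powr \<alpha>" by simp
        also have "\<dots> = (1 / s) powr \<alpha> * (1 / w) powr \<alpha>" by (rule powr_mult)
        also have "(1 / w) powr \<alpha> = w powr (- \<alpha>)" by (simp add: powr_divide powr_minus_divide)
        finally show ?thesis unfolding k(2) w_def .
      qed
    qed
    also have "\<dots> = ((1 / s) powr \<alpha>) ^ N * (\<Prod>k=1..N. (1 - real k / s) powr (- \<alpha>))"
      by (simp add: prod.distrib)
    also have "(1 / s) powr \<alpha> * (((1 / s) powr \<alpha>) ^ N * (\<Prod>k=1..N. (1 - real k / s) powr (- \<alpha>)))
        = ((1 / s) powr \<alpha>) ^ r * (\<Prod>k=1..N. (1 - real k / s) powr (- \<alpha>))"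
      by (simp add: rN)
    also have "((1 / s) powr \<alpha>) ^ r = 1 / s powr (real r * \<alpha>)"
    proof -
      have "((1 / s) powr \<alpha>) ^ r = (1 / s) powr (real r * \<alpha>)"
        using s by (intro powr_power) auto
      also have "\<dots> = 1 / s powr (real r * \<alpha>)" by (simp add: powr_divide)
      finally show ?thesis .
    qed
    finally show ?thesis by simp
  qed
  finally show ?thesis .
qed

section \<open>Chernoff's bound for the generalized Dirichlet process\<close>

text \<open>The exponent, per unit of \<open>a\<close>, in Chernoff's bound for \<open>X / (X + Y) \<ge> p + \<epsilon>\<close> with the tilting
  parameter \<open>\<epsilon>\<close>.\<close>

definition gdp_rate :: "nat \<Rightarrow> real \<Rightarrow> real \<Rightarrow> real" where
  "gdp_rate r p \<epsilon> = (\<Sum>k=1..r. - p * ln (1 - \<epsilon> * (1 - (p + \<epsilon>)) / real k) - (1 - p) * ln (1 + \<epsilon> * (p + \<epsilon>) / real k))"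

text \<open>\<open>ln z\<close> \<ge> \<open>1 - 1 / z\<close> turns each summand into a rational
  expression, whose numerator reduces to
  \<open>\<epsilon>\<^sup>2 * (1 - c * (1 - c) / k) / k\<close> > 0. The tilt \<epsilon> need not be
  optimal; it is small enough for this to hold for all rates at once.\<close>

lemma gdp_rate_neg:
  assumes r: "1 \<le> r" and p: "0 < p" and \<epsilon>: "0 < \<epsilon>" "p + \<epsilon> < 1"
  shows "gdp_rate r p \<epsilon> < 0"
  unfolding gdp_rate_def
proof -
  define c where "c = p + \<epsilon>"
  have c: "0 < c" "c < 1" "p < c" "p < 1" using p \<epsilon> by (auto simp: c_def)
  have neg: "- p * ln (1 - \<epsilon> * (1 - c) / real k) - (1 - p) * ln (1 + \<epsilon> * c / real k) < 0" if k: "k \<in> {1..r}" for k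
  proof -
    define X where "X = \<epsilon> * (1 - c) / real k"
    define Y where "Y = \<epsilon> * c / real k"
    have k1: "1 \<le> real k" using k by simp
    have "X \<le> \<epsilon> * (1 - c) / 1" unfolding X_def using k1 \<epsilon> c by (intro divide_left_mono) auto
    also have "\<dots> \<le> 1 * (1 - c)" using \<epsilon> c p by (simp add: c_def)
    finally have X: "X < 1" using c by simp
    have Y: "0 < Y" unfolding Y_def using k1 \<epsilon> c by simp
    have ln_ge: "1 - 1 / z \<le> ln z" if "0 < z" for z :: real
      using ln_le_minus_one[of "1 / z"] that by (simp add: ln_div)
    have "p * (1 - 1 / (1 - X)) + (1 - p) * (1 - 1 / (1 + Y)) \<le> p * ln (1 - X) + (1 - p) * ln (1 + Y)"
      using X Y p c by (intro add_mono mult_left_mono ln_ge) auto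
    moreover have "0 < p * (1 - 1 / (1 - X)) + (1 - p) * (1 - 1 / (1 + Y))"
    proof -
      have "p * (1 - 1 / (1 - X)) + (1 - p) * (1 - 1 / (1 + Y)) = ((1 - p) * Y * (1 - X) - p * X * (1 + Y)) / ((1 - X) * (1 + Y))"
        using X Y by (simp add: field_simps)
      moreover have "(1 - p) * Y * (1 - X) - p * X * (1 + Y) = \<epsilon> * (\<epsilon> - \<epsilon> * c * (1 - c) / real k) / real k"
        using k1 by (simp add: X_def Y_def c_def field_simps)
      moreover have "\<epsilon> * c * (1 - c) / real k < \<epsilon>"
      proof -
        have "c * (1 - c) < 1 * 1" using c by (intro mult_strict_mono) auto
        hence "\<epsilon> * (c * (1 - c)) < \<epsilon> * real k" using \<epsilon> k1 by (intro mult_strict_left_mono) auto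
        thus ?thesis using k1 by (simp add: field_simps)
      qed
      ultimately show ?thesis using \<epsilon> k1 X Y by (simp add: divide_pos_pos)
    qed
    ultimately show ?thesis unfolding X_def[symmetric] Y_def[symmetric] by linarith
  qed
  show "(\<Sum>k=1..r. - p * ln (1 - \<epsilon> * (1 - (p + \<epsilon>)) / real k) - (1 - p) * ln (1 + \<epsilon> * (p + \<epsilon>) / real k)) < 0"
    using sum_strict_mono[of "{1..r}", OF _ _ neg] r by (simp add: c_def)
qed

lemma gdp_upper_deviation:
  assumes M: "prob_space M" and H: "prob_space H" "sets H = sets borel" and P: "is_GDP M a r H P"
    and A[measurable]: "A \<in> sets borel" and p: "0 < measure H A" and \<epsilon>: "0 < \<epsilon>" "measure H A + \<epsilon> < 1"
  shows "emeasure M {\<omega>\<in>space M. measure H A + \<epsilon> \<le> measure (P \<omega>) A}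
     \<le> ennreal (exp (a * gdp_rate r (measure H A) \<epsilon>))"
proof -
  interpret prob_space M by fact
  interpret H: prob_space H by fact
  define p where "p = measure H A"
  define c where "c = p + \<epsilon>"
  have p01: "0 < p" "p < 1" "p < c" "0 < c" "c < 1" using p \<epsilon> by (auto simp: p_def c_def)
  from P have a: "0 < a" and r: "1 \<le> r" by (auto simp: is_GDP_def)
  \<comment> \<open>The partition into two cells, \<open>m = 1\<close>; only the indices 0 and 1 are
    relevant.\<close>
  define B where "B i = (if i = 0 then A else - A)" for i :: nat
  define al where "al i = a * measure H (B i)" for i :: nat
  have compl: "measure H (- A) = 1 - p"
    using H.prob_compl[of A] H(2) sets_eq_imp_space_eq[OF H(2)] by (simp add: p_def Compl_eq_Diff_UNIV)
  have al: "al 0 = a * p" "al 1 = a * (1 - p)" by (auto simp: al_def B_def compl p_def[symmetric])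
  have al_pos: "0 < al 0" "0 < al 1" "al 0 + al 1 = a" unfolding al using a p01 by (auto simp: algebra_simps)
  let ?S = "Pi\<^sub>M {..<1::nat} (\<lambda>_. lborel) :: (nat \<Rightarrow> real) measure"
  define f where "f x = ennreal (gdp_density a r 1 al (x(1 := 1 - (\<Sum>i<1. x i))))" for x
  have D: "distributed M ?S (\<lambda>\<omega>. \<lambda>i\<in>{..<1}. measure (P \<omega>) (B i)) f"
    unfolding f_def al_def
  proof (rule P[unfolded is_GDP_def, THEN conjunct2, THEN conjunct2, THEN conjunct2, rule_format, of 1 B])
    show "(\<forall>i\<le>1. B i \<in> sets borel \<and> 0 < measure H (B i)) \<and> disjoint_family_on B {..1} \<and> \<Union> (B ` {..1}) = UNIV"
      using p01 by (auto simp: B_def compl p_def[symmetric] disjoint_family_on_def)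
  qed simp
  \<comment> \<open>The event \<open>x\<close> \<ge> \<open>c\<close> says that
    \<open>(1 - c) * X - c * Y\<close> \<ge> 0 for \<open>X = t * x\<close> and
    \<open>Y = t * (1 - x)\<close>. Multiplying by the exponential of \<epsilon> times this quantity
    therefore only increases the integrand, and it splits into one tilt for each kernel.\<close>
  define d0 where "d0 = \<epsilon> * (1 - c)"
  define d1 where "d1 = - (\<epsilon> * c)"
  have "\<epsilon> * (1 - c) \<le> 1 * (1 - c)" using \<epsilon> p01 by (intro mult_right_mono) (auto simp: c_def)
  also have "1 * (1 - c) < 1" using p01 by simp
  finally have d0: "d0 < 1" unfolding d0_def .
  have "0 < \<epsilon> * c" using \<epsilon> p01 by simp
  hence d1: "d1 < 1" unfolding d1_def by simp
  note d = d0 d1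
  define F0 where "F0 u = gdp_kernel r (al 0) u * ennreal (exp (d0 * u))" for u
  define F1 where "F1 u = gdp_kernel r (al 1) u * ennreal (exp (d1 * u))" for u
  have [measurable]: "F0 \<in> borel_measurable borel" "F1 \<in> borel_measurable borel"
    unfolding F0_def[abs_def] F1_def[abs_def] by measurable
  define C where "C = fact r powr a / (Gamma (real r * al 0) * Gamma (real r * al 1))"
  have Gpos: "0 < Gamma (real r * al 0)" "0 < Gamma (real r * al 1)" using al_pos r by auto
  have C: "0 \<le> C" using Gpos by (simp add: C_def)
  define J where "J x = (\<integral>\<^sup>+t. indicator {0<..} t * (ennreal t * (F0 (t * x) * F1 (t * (1 - x)))) \<partial>lborel)" for x
  have [measurable]: "J \<in> borel_measurable borel" unfolding J_def[abs_def] by measurable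
  define S where "S = {x \<in> space ?S. c \<le> x 0}"
  have S: "S \<in> sets ?S" unfolding S_def by measurable
  have "emeasure M {\<omega>\<in>space M. c \<le> measure (P \<omega>) A} = emeasure M ((\<lambda>\<omega>. \<lambda>i\<in>{..<1}. measure (P \<omega>) (B i)) -` S \<inter> space M)"
    by (intro arg_cong[where f = "emeasure M"]) (auto simp: S_def space_PiM B_def)
  also have "\<dots> = (\<integral>\<^sup>+x. f x * indicator S x \<partial>?S)"
    by (rule distributed_emeasure[OF D S])
  also have "\<dots> \<le> (\<integral>\<^sup>+x. ennreal C * J (x 0) \<partial>?S)"
  proof (rule nn_integral_mono)
    fix x :: "nat \<Rightarrow> real"
    show "f x * indicator S x \<le> ennreal C * J (x 0)"
    proof (cases "x \<in> S")
      case True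
      hence x0: "0 < x 0" "c \<le> x 0" using p01 by (auto simp: S_def)
      show ?thesis
      proof (cases "x 0 < 1")
        \<comment> \<open>Beyond 1 the last coordinate is negative and the density is 0 by
          definition; at 1 that coordinate is 0, and \<open>0 powr e\<close> is 0 for every
          exponent.\<close>
        case False
        have "gdp_density a r 1 al (x(1 := 1 - (\<Sum>i<1. x i))) = 0"
          using False by (auto simp: gdp_density_def atMost_Suc)
        thus ?thesis by (simp add: f_def)
      next
        case x1: True
        have "f x \<le> ennreal C * (\<integral>\<^sup>+t. indicator {0<..} t * (ennreal t * (gdp_kernel r (al 0) (t * x 0) * gdp_kernel r (al 1) (t * (1 - x 0)))) \<partial>lborel)"
          unfolding f_def C_def by (rule gdp_density_le[OF r al_pos]) (use x0 x1 in auto)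
        also have "\<dots> \<le> ennreal C * J (x 0)"
          unfolding J_def
        proof (rule mult_left_mono[OF nn_integral_mono])
          fix t :: real
          show "indicator {0<..} t * (ennreal t * (gdp_kernel r (al 0) (t * x 0) * gdp_kernel r (al 1) (t * (1 - x 0))))
             \<le> indicator {0<..} t * (ennreal t * (F0 (t * x 0) * F1 (t * (1 - x 0))))"
          proof (cases "0 < t")
            case True
            have "d0 * (t * x 0) + d1 * (t * (1 - x 0)) = \<epsilon> * t * (x 0 - c)"
              by (simp add: d0_def d1_def algebra_simps)
            hence "1 \<le> exp (d0 * (t * x 0) + d1 * (t * (1 - x 0)))"
              using True \<epsilon> x0 by simp
            hence "1 \<le> ennreal (exp (d0 * (t * x 0)) * exp (d1 * (t * (1 - x 0))))"
              by (simp add: exp_add)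
            hence "gdp_kernel r (al 0) (t * x 0) * gdp_kernel r (al 1) (t * (1 - x 0)) * 1
              \<le> gdp_kernel r (al 0) (t * x 0) * gdp_kernel r (al 1) (t * (1 - x 0)) * ennreal (exp (d0 * (t * x 0)) * exp (d1 * (t * (1 - x 0))))"
              by (rule mult_left_mono) simp
            also have "\<dots> = F0 (t * x 0) * F1 (t * (1 - x 0))"
              by (simp add: F0_def F1_def ennreal_mult mult_ac)
            finally show ?thesis by (intro mult_left_mono) auto
          qed simp
        qed simp
        finally show ?thesis using True by simp
      qed
    qed simp
  qed
  also have "\<dots> = (\<integral>\<^sup>+x. ennreal C * J x \<partial>lborel)"
  proof -
    interpret product_sigma_finite "\<lambda>_::nat. lborel :: real measure" by unfold_locales
    have "{..<1::nat} = {0}" by auto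
    thus ?thesis using product_nn_integral_singleton[of "\<lambda>x. ennreal C * J x" 0] by simp
  qed
  also have "\<dots> = ennreal C * (\<integral>\<^sup>+x. J x \<partial>lborel)" by (intro nn_integral_cmult) measurable
  also have "\<dots> \<le> ennreal C * ((\<integral>\<^sup>+u. F0 u \<partial>lborel) * (\<integral>\<^sup>+u. F1 u \<partial>lborel))"
    unfolding J_def by (intro mult_left_mono nn_integral_simplex_coordinates_le) auto
  also have "\<dots> \<le> ennreal C * (ennreal (Gamma (real r * al 0) * (\<Prod>k=1..r. 1 / (real k - d0)) powr al 0)
       * ennreal (Gamma (real r * al 1) * (\<Prod>k=1..r. 1 / (real k - d1)) powr al 1))"
    unfolding F0_def F1_def using r al_pos d by (intro mult_left_mono mult_mono gdp_kernel_Laplace_le) auto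
  also have "\<dots> = ennreal (C * ((Gamma (real r * al 0) * (\<Prod>k=1..r. 1 / (real k - d0)) powr al 0)
       * (Gamma (real r * al 1) * (\<Prod>k=1..r. 1 / (real k - d1)) powr al 1)))"
    using C Gpos by (simp add: ennreal_mult)
  also have "C * ((Gamma (real r * al 0) * (\<Prod>k=1..r. 1 / (real k - d0)) powr al 0)
       * (Gamma (real r * al 1) * (\<Prod>k=1..r. 1 / (real k - d1)) powr al 1))
    = fact r powr a * (\<Prod>k=1..r. 1 / (real k - d0)) powr al 0 * (\<Prod>k=1..r. 1 / (real k - d1)) powr al 1"
    using Gpos by (simp add: C_def)
  also have "\<dots> = exp (a * gdp_rate r p \<epsilon>)"
  proof -
    have pos: "0 < real k - d0" "0 < real k - d1" "0 < real k" if "k \<in> {1..r}" for k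
      using that d by (auto simp: algebra_simps)
    have pw: "(\<Prod>k=1..r. g k) powr b = exp (\<Sum>k=1..r. b * ln (g k))" if "\<And>k. k \<in> {1..r} \<Longrightarrow> 0 < g k" for g :: "nat \<Rightarrow> real" and b
    proof -
      have "(\<Prod>k=1..r. g k) powr b = (\<Prod>k=1..r. g k powr b)" by (rule prod_powr_distrib)
      also have "\<dots> = (\<Prod>k=1..r. exp (b * ln (g k)))"
        using that by (intro prod.cong refl) (metis less_irrefl powr_def)
      finally show ?thesis by (simp add: exp_sum)
    qed
    \<comment> \<open>The factorial is the product of the rates and \<open>a = al 0 + al 1\<close>,
      so each rate normalises both tilted factors and yields the quotients
      \<open>(k - d) / k\<close> inside the rate function.\<close>
    have "fact r powr a = (\<Prod>k=1..r. real k) powr a" by (simp add: fact_prod)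
    also have "\<dots> = exp (\<Sum>k=1..r. a * ln (real k))" using pos by (intro pw) auto
    finally have "fact r powr a * (\<Prod>k=1..r. 1 / (real k - d0)) powr al 0 * (\<Prod>k=1..r. 1 / (real k - d1)) powr al 1
       = exp (\<Sum>k=1..r. a * ln (real k) + al 0 * ln (1 / (real k - d0)) + al 1 * ln (1 / (real k - d1)))"
      using pw[of "\<lambda>k. 1 / (real k - d0)" "al 0"] pw[of "\<lambda>k. 1 / (real k - d1)" "al 1"] pos
      by (simp add: exp_add sum.distrib)
    also have "(\<Sum>k=1..r. a * ln (real k) + al 0 * ln (1 / (real k - d0)) + al 1 * ln (1 / (real k - d1))) = a * gdp_rate r p \<epsilon>"
      unfolding gdp_rate_def sum_distrib_left
    proof (intro sum.cong refl)
      fix k assume k: "k \<in> {1..r}"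
      have "1 - \<epsilon> * (1 - (p + \<epsilon>)) / real k = (real k - d0) / real k" "1 + \<epsilon> * (p + \<epsilon>) / real k = (real k - d1) / real k"
        using pos[OF k] by (auto simp: d0_def d1_def c_def field_simps)
      hence l1: "ln (1 - \<epsilon> * (1 - (p + \<epsilon>)) / real k) = ln (real k - d0) - ln (real k)"
        "ln (1 + \<epsilon> * (p + \<epsilon>) / real k) = ln (real k - d1) - ln (real k)"
        using pos[OF k] by (auto simp: ln_div)
      have l2: "ln (1 / (real k - d0)) = - ln (real k - d0)" "ln (1 / (real k - d1)) = - ln (real k - d1)"
        using pos[OF k] by (auto simp: ln_div)
      show "a * ln (real k) + al 0 * ln (1 / (real k - d0)) + al 1 * ln (1 / (real k - d1))
          = a * (- p * ln (1 - \<epsilon> * (1 - (p + \<epsilon>)) / real k) - (1 - p) * ln (1 + \<epsilon> * (p + \<epsilon>) / real k))"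
        unfolding l1 l2 al by (simp add: algebra_simps)
    qed
    finally show ?thesis .
  qed
  finally show ?thesis by (simp add: p_def c_def)
qed

section \<open>Almost sure uniform convergence\<close>

lemma nonatomic_surj_cdf:
  fixes H :: "real measure"
  assumes H: "prob_space H" "sets H = sets borel" and na: "nonatomic H" and y: "0 < y" "y < 1"
  shows "\<exists>x. measure H {..x} = y"
proof -
  interpret prob_space H by fact
  interpret real_distribution H by unfold_locales (use H in auto)
  \<comment> \<open>A charged singleton would have a subset of strictly smaller positive mass, but
    its only proper subset is empty. Without atoms the distribution function is continuous, and the
    intermediate value theorem supplies the quantile.\<close>
  have "measure H {x} = 0" for x
  proof (rule ccontr)
    assume "measure H {x} \<noteq> 0"
    hence "0 < emeasure H {x}" by (simp add: emeasure_eq_measure zero_less_measure_iff)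
    then obtain B where "B \<subseteq> {x}" "0 < emeasure H B" "emeasure H B < emeasure H {x}"
      using na unfolding nonatomic_def by (metis events_eq_borel borel_singleton sets.empty_sets)
    thus False by (auto simp: subset_singleton_iff)
  qed
  hence cont: "isCont (cdf H) x" for x by (simp add: isCont_cdf)
  have "eventually (\<lambda>x. cdf H x < y) at_bot" using cdf_lim_at_bot y(1) by (rule order_tendstoD(2))
  then obtain u where u: "cdf H u < y" by (auto simp: eventually_at_bot_linorder)
  have "eventually (\<lambda>x. y < cdf H x) at_top" using cdf_lim_at_top_prob y(2) by (rule order_tendstoD(1))
  then obtain w where w: "y < cdf H w" by (auto simp: eventually_at_top_linorder)
  have "u \<le> w" using u w cdf_nondecreasing[of w u] by linarith
  then obtain x where "cdf H x = y"
    using IVT[of "cdf H" u y w] u w cont by auto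
  thus ?thesis by (auto simp: cdf_def)
qed

text \<open>Polya's argument: between neighbouring grid quantiles monotonicity traps both functions.
  Only levels strictly between 0 and 1 are used, and the end cells rely on the bounds 0 and
  1.\<close>

lemma uniform_convergence_of_quantiles:
  fixes F :: "real \<Rightarrow> real" and G :: "nat \<Rightarrow> real \<Rightarrow> real" and X :: "real \<Rightarrow> real"
  assumes F: "mono F" "\<And>x. 0 \<le> F x \<and> F x \<le> 1"
    and G: "\<And>n. mono (G n)" "\<And>n x. 0 \<le> G n x \<and> G n x \<le> 1"
    and X: "\<And>i k. 0 < i \<Longrightarrow> i < k \<Longrightarrow> F (X (real i / real k)) = real i / real k"
    and lim: "\<And>i k. 0 < i \<Longrightarrow> i < k \<Longrightarrow> (\<lambda>n. G n (X (real i / real k))) \<longlonglongrightarrow> real i / real k"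
  shows "(\<lambda>n. SUP x. \<bar>G n x - F x\<bar>) \<longlonglongrightarrow> 0"
proof (rule LIMSEQ_I)
  fix e :: real assume e: "0 < e"
  obtain k :: nat where k: "3 / e < real k" using reals_Archimedean2 by blast
  have k0: "0 < real k" using k e by (meson divide_pos_pos less_trans zero_less_numeral)
  have ke: "3 / real k < e" using k k0 e by (simp add: field_simps)
  have "eventually (\<lambda>n. \<forall>i\<in>{1..<k}. \<bar>G n (X (real i / real k)) - real i / real k\<bar> < 1 / real k) sequentially"
  proof (subst eventually_ball_finite_distrib, simp, intro ballI)
    fix i assume "i \<in> {1..<k}"
    hence "(\<lambda>n. G n (X (real i / real k))) \<longlonglongrightarrow> real i / real k" by (intro lim) auto
    from tendstoD[OF this, of "1 / real k"] k0
    show "eventually (\<lambda>n. \<bar>G n (X (real i / real k)) - real i / real k\<bar> < 1 / real k) sequentially"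
      by (simp add: dist_real_def)
  qed
  then obtain N where N: "\<And>n i. N \<le> n \<Longrightarrow> i \<in> {1..<k} \<Longrightarrow> \<bar>G n (X (real i / real k)) - real i / real k\<bar> < 1 / real k"
    unfolding eventually_sequentially by blast
  have bound: "\<bar>G n x - F x\<bar> \<le> 3 / real k" if n: "N \<le> n" for n x
  proof -
    define i where "i = nat \<lfloor>real k * F x\<rfloor>"
    have "0 \<le> real k * F x" using F(2)[of x] by simp
    hence "real i \<le> real k * F x" "real k * F x < real i + 1" by (auto simp: i_def)
    hence i: "real i / real k \<le> F x" "F x < real i / real k + 1 / real k"
      using k0 by (auto simp: field_simps)
    have "G n x \<le> F x + 3 / real k"
    proof (cases "i + 1 < k")
      case True
      have FX: "F (X (real (i + 1) / real k)) = real (i + 1) / real k" using True by (intro X) auto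
      have "x \<le> X (real (i + 1) / real k)"
      proof (rule ccontr)
        assume "\<not> x \<le> X (real (i + 1) / real k)"
        hence "F (X (real (i + 1) / real k)) \<le> F x" by (intro monoD[OF F(1)]) simp
        thus False using i FX by (simp add: add_divide_distrib)
      qed
      hence "G n x \<le> G n (X (real (i + 1) / real k))" by (rule monoD[OF G(1)])
      moreover have "\<bar>G n (X (real (i + 1) / real k)) - real (i + 1) / real k\<bar> < 1 / real k"
        using True by (intro N n) auto
      moreover have "real (i + 1) / real k = real i / real k + 1 / real k" by (simp add: add_divide_distrib)
      moreover have "3 / real k = 1 / real k + 1 / real k + 1 / real k" by simp
      ultimately show ?thesis using i k0 by (smt (verit) divide_pos_pos)
    next
      case False
      hence "1 \<le> (real i + 1) / real k" using k0 by (simp add: pos_le_divide_eq)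
      moreover have "(real i + 1) / real k = real i / real k + 1 / real k" by (simp add: add_divide_distrib)
      moreover have "1 / real k \<le> 3 / real k" by (simp add: divide_right_mono)
      ultimately show ?thesis using i G(2)[of n x] by linarith
    qed
    \<comment> \<open>The lower comparison uses level \<open>i - 1\<close> instead of
      \<open>i\<close>: if \<open>F x\<close> equals \<open>i / k\<close>, a flat stretch of
      \<open>F\<close> may put the quantile at level \<open>i\<close> to the right of
      \<open>x\<close>, and \<open>i\<close> may equal \<open>k\<close>, where no quantile is given.
      This second grid step is why the error is 3 / k.\<close>
    moreover have "F x - 3 / real k \<le> G n x"
    proof (cases "2 \<le> i")
      case True
      have ik: "i \<le> k"
      proof -
        have "real i / real k \<le> 1" using i(1) F(2)[of x] by linarith
        thus ?thesis using k0 by simp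
      qed
      have FX: "F (X (real (i - 1) / real k)) = real (i - 1) / real k" using True ik by (intro X) auto
      have e: "real (i - 1) / real k = real i / real k - 1 / real k" using True by (simp add: of_nat_diff diff_divide_distrib)
      have "X (real (i - 1) / real k) \<le> x"
      proof (rule ccontr)
        assume "\<not> X (real (i - 1) / real k) \<le> x"
        hence "F x \<le> F (X (real (i - 1) / real k))" by (intro monoD[OF F(1)]) simp
        moreover have "0 < 1 / real k" using k0 by simp
        ultimately show False using i FX e by linarith
      qed
      hence "G n (X (real (i - 1) / real k)) \<le> G n x" by (rule monoD[OF G(1)])
      moreover have "\<bar>G n (X (real (i - 1) / real k)) - real (i - 1) / real k\<bar> < 1 / real k"
        using True ik by (intro N n) auto
      moreover have "3 / real k = 1 / real k + 1 / real k + 1 / real k" by simp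
      ultimately show ?thesis using i e by linarith
    next
      case False
      hence "real i / real k \<le> 1 / real k" using k0 by (simp add: divide_right_mono)
      moreover have "3 / real k = 1 / real k + 1 / real k + 1 / real k" by simp
      moreover have "0 < 1 / real k" using k0 by simp
      ultimately show ?thesis using i G(2)[of n x] by linarith
    qed
    ultimately show ?thesis by linarith
  qed
  show "\<exists>N. \<forall>n\<ge>N. norm ((SUP x. \<bar>G n x - F x\<bar>) - 0) < e"
  proof (intro exI allI impI)
    fix n assume n: "N \<le> n"
    have "(SUP x. \<bar>G n x - F x\<bar>) \<le> 3 / real k" by (intro cSUP_least bound[OF n]) auto
    moreover have "0 \<le> (SUP x. \<bar>G n x - F x\<bar>)"
      by (rule order_trans[OF _ cSUP_upper[of 0]]) (use bound[OF n] in \<open>auto intro!: bdd_aboveI2\<close>)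
    ultimately show "norm ((SUP x. \<bar>G n x - F x\<bar>) - 0) < e" using ke by simp
  qed
qed

lemma AE_tendsto_of_summable_deviations:
  fixes Y :: "nat \<Rightarrow> 'w \<Rightarrow> real"
  assumes "prob_space M" and [measurable]: "\<And>n. n \<ge> 1 \<Longrightarrow> Y n \<in> borel_measurable M"
    and dev: "\<And>\<epsilon>. 0 < \<epsilon> \<Longrightarrow> \<exists>b. summable b \<and> (\<forall>n. 0 \<le> b n) \<and>
        eventually (\<lambda>n. emeasure M {\<omega>\<in>space M. \<epsilon> \<le> \<bar>Y n \<omega> - y\<bar>} \<le> ennreal (b n)) sequentially"
  shows "AE \<omega> in M. (\<lambda>n. Y n \<omega>) \<longlonglongrightarrow> y"
proof -
  interpret prob_space M by fact
  have "AE \<omega> in M. eventually (\<lambda>n. \<bar>Y n \<omega> - y\<bar> < 1 / real (Suc j)) sequentially" for j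
  proof -
    obtain b where b: "summable b" "\<And>n. 0 \<le> b n" "eventually (\<lambda>n. emeasure M {\<omega>\<in>space M. 1 / real (Suc j) \<le> \<bar>Y n \<omega> - y\<bar>} \<le> ennreal (b n)) sequentially"
      using dev[of "1 / real (Suc j)"] by auto
    \<comment> \<open>\<open>Y 0\<close> is not assumed measurable, since the parameter
      \<open>n powr \<tau>\<close> is 0 at \<open>n = 0\<close> and nothing is known about
      \<open>P 0\<close>; replacing its event by the empty set does not affect the limit.\<close>
    define A where "A n = (if n = 0 then {} else {\<omega>\<in>space M. 1 / real (Suc j) \<le> \<bar>Y n \<omega> - y\<bar>})" for n
    have A[measurable]: "A n \<in> sets M" for n by (cases "n = 0") (auto simp: A_def)
    have "eventually (\<lambda>n. norm (measure M (A n)) \<le> b n) sequentially"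
      using b(3)
    proof eventually_elim
      case (elim n)
      have "emeasure M (A n) \<le> ennreal (b n)"
        using elim by (cases "n = 0") (auto simp: A_def)
      thus ?case using b(2)[of n] by (simp add: emeasure_eq_measure)
    qed
    hence "summable (\<lambda>n. measure M (A n))" using b(1) by (rule summable_comparison_test_ev)
    hence "AE \<omega> in M. eventually (\<lambda>n. \<omega> \<in> space M - A n) sequentially"
      by (intro borel_cantelli_AE1) (auto simp: emeasure_eq_measure)
    thus ?thesis
    proof eventually_elim
      case (elim \<omega>)
      from elim eventually_gt_at_top[of "0::nat"] show ?case
        by eventually_elim (auto simp: A_def not_le)
    qed
  qed
  hence "AE \<omega> in M. \<forall>j. eventually (\<lambda>n. \<bar>Y n \<omega> - y\<bar> < 1 / real (Suc j)) sequentially"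
    by (simp only: AE_all_countable) simp
  thus ?thesis
  proof eventually_elim
    case (elim \<omega>)
    show ?case
    proof (rule tendstoI)
      fix e :: real assume "0 < e"
      then obtain j where j: "1 / real (Suc j) < e" using nat_approx_posE by blast
      from elim[rule_format, of j] show "eventually (\<lambda>n. dist (Y n \<omega>) y < e) sequentially"
        by eventually_elim (use j in \<open>simp add: dist_real_def\<close>)
    qed
  qed
qed

section \<open>Summability of the deviation probabilities in n\<close>

lemma weight_moment_bound_mono:
  assumes "weight_moment_bound M H P q \<rho>" "\<rho> \<le> \<rho>'"
  shows "weight_moment_bound M H P q \<rho>'"
  using assms unfolding weight_moment_bound_def by (meson mult_right_mono order_trans zero_le)

lemma summable_stick_breaking_deviations:
  assumes M: "prob_space M" and A: "A \<in> sets borel" and \<epsilon>: "0 < \<epsilon>" and \<tau>: "0 < \<tau>" and \<gamma>: "0 < \<gamma>"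
    and wmb: "\<And>q. 2 \<le> q \<Longrightarrow> \<exists>K\<ge>0. eventually (\<lambda>n. weight_moment_bound M H (P n) q
        (ennreal (K * (real n powr \<tau>) powr (\<gamma> * (1 - real q))))) sequentially"
  shows "\<exists>b. summable b \<and> (\<forall>n. 0 \<le> b n) \<and>
        eventually (\<lambda>n. emeasure M {\<omega>\<in>space M. \<epsilon> \<le> \<bar>measure (P n \<omega>) A - measure H A\<bar>} \<le> ennreal (b n)) sequentially"
proof -
  \<comment> \<open>The moment order is chosen so that \<open>\<tau> * \<gamma> * (q - 1)\<close>
    \<ge> 2, making the bound a multiple of \<open>n powr - 2\<close>. The exponent \<gamma> will be
    1 for explicit densities and the leading exponent of the mean for general weights.\<close>
  obtain j :: nat where j: "2 / (\<tau> * \<gamma>) \<le> real j" using real_arch_simple by blast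
  define q where "q = j + 2"
  have q: "2 \<le> q" by (simp add: q_def)
  have "2 \<le> \<tau> * \<gamma> * real j" using j \<tau> \<gamma> by (simp add: field_simps)
  also have "\<dots> \<le> \<tau> * \<gamma> * (real q - 1)" using \<tau> \<gamma> by (simp add: q_def)
  finally have tq: "\<tau> * (\<gamma> * (1 - real q)) \<le> - 2" by (simp add: algebra_simps)
  obtain K where K: "0 \<le> K" "eventually (\<lambda>n. weight_moment_bound M H (P n) q
        (ennreal (K * (real n powr \<tau>) powr (\<gamma> * (1 - real q))))) sequentially"
    using wmb[OF q] by blast
  define c where "c = 2 * fact q / (\<epsilon>\<^sup>2 / 2) ^ q"
  have c: "0 \<le> c" by (simp add: c_def)
  define b where "b n = c * (K * real n powr - 2)" for n
  have "summable (\<lambda>n. real n powr - 2)" by (subst summable_real_powr_iff) simp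
  hence "summable b" unfolding b_def[abs_def] by (intro summable_mult)
  moreover have "0 \<le> b n" for n using c K by (simp add: b_def)
  moreover have "eventually (\<lambda>n. emeasure M {\<omega>\<in>space M. \<epsilon> \<le> \<bar>measure (P n \<omega>) A - measure H A\<bar>} \<le> ennreal (b n)) sequentially"
    using K(2) eventually_ge_at_top[of "1::nat"]
  proof eventually_elim
    case (elim n)
    have "(real n powr \<tau>) powr (\<gamma> * (1 - real q)) \<le> real n powr - 2"
      unfolding powr_powr using tq elim by (intro powr_mono) auto
    hence "ennreal (K * (real n powr \<tau>) powr (\<gamma> * (1 - real q))) \<le> ennreal (K * real n powr - 2)"
      using K by (intro ennreal_leI mult_left_mono)
    from weight_moment_bound_mono[OF elim(1) this]
    obtain v where v: "stick_breaking M H v (P n)"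
      "\<And>m. (\<integral>\<^sup>+\<omega>. ennreal (stick_weight v m \<omega> ^ q) \<partial>M) \<le> ennreal (K * real n powr - 2) * (\<integral>\<^sup>+\<omega>. ennreal (stick_weight v m \<omega>) \<partial>M)"
      unfolding weight_moment_bound_def by blast
    have "emeasure M {\<omega>\<in>space M. \<epsilon> \<le> \<bar>measure (P n \<omega>) A - measure H A\<bar>} \<le> ennreal c * ennreal (K * real n powr - 2)"
      unfolding c_def using q by (intro stick_breaking_deviation[OF M v(1) A \<epsilon> _ v(2)]) simp
    thus ?case using c K by (simp add: b_def ennreal_mult)
  qed
  ultimately show ?thesis by blast
qed

lemma filterlim_nat_powr_at_top:
  assumes "0 < \<tau>"
  shows "filterlim (\<lambda>n. real n powr \<tau>) at_top sequentially"
proof -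
  have "filterlim (\<lambda>n. \<tau> * ln (real n)) at_top sequentially"
    using assms by (intro filterlim_tendsto_pos_mult_at_top[OF tendsto_const]
      filterlim_compose[OF ln_at_top filterlim_real_sequentially])
  hence "filterlim (\<lambda>n. exp (\<tau> * ln (real n))) at_top sequentially"
    by (rule filterlim_compose[OF exp_at_top])
  moreover have "eventually (\<lambda>n. exp (\<tau> * ln (real n)) = real n powr \<tau>) sequentially"
    using eventually_gt_at_top[of "0::nat"] by eventually_elim (simp add: powr_def)
  ultimately show ?thesis by (simp add: filterlim_cong)
qed

lemma summable_powr_exp:
  assumes "0 < \<tau>" "\<theta> < 0"
  shows "\<exists>b. summable b \<and> (\<forall>n. 0 \<le> b n) \<and> eventually (\<lambda>n. 2 * exp (real n powr \<tau> * \<theta>) \<le> b n) sequentially"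
proof -
  obtain k :: nat where k: "2 / \<tau> \<le> real k" using real_arch_simple by blast
  define c where "c = 2 * (fact k / (- \<theta>) ^ k)"
  have c: "0 \<le> c" using assms by (simp add: c_def)
  have "2 * exp (real n powr \<tau> * \<theta>) \<le> c * real n powr - 2" if n: "1 \<le> n" for n
  proof -
    have x: "0 < real n powr \<tau> * (- \<theta>)" using n assms by (intro mult_pos_pos) auto
    have "exp (real n powr \<tau> * \<theta>) \<le> fact k / (real n powr \<tau> * (- \<theta>)) ^ k"
      using exp_minus_le_fact_power[OF x, of k] by simp
    also have "\<dots> = fact k / (- \<theta>) ^ k * (real n powr \<tau>) powr (- real k)"
      unfolding power_mult_distrib using n by (simp add: powr_minus powr_realpow divide_inverse)
    also have "\<dots> \<le> fact k / (- \<theta>) ^ k * real n powr - 2"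
      unfolding powr_powr using k n assms by (intro mult_left_mono powr_mono) (auto simp: field_simps)
    finally show ?thesis by (simp add: c_def)
  qed
  moreover have "summable (\<lambda>n. real n powr - 2)" by (subst summable_real_powr_iff) simp
  hence "summable (\<lambda>n. c * real n powr - 2)" by (rule summable_mult)
  ultimately show ?thesis using c
    by (intro exI[of _ "\<lambda>n. c * real n powr - 2"]) (auto simp: eventually_sequentially)
qed

lemma summable_gdp_deviations:
  assumes M: "prob_space M" and H: "prob_space H" "sets H = sets borel" and \<tau>: "0 < \<tau>"
    and P: "\<And>n. 1 \<le> n \<Longrightarrow> is_GDP M (real n powr \<tau>) r H (P n)"
    and A[measurable]: "A \<in> sets borel" and p: "0 < measure H A" "measure H A < 1" and \<epsilon>: "0 < \<epsilon>"
  shows "\<exists>b. summable b \<and> (\<forall>n. 0 \<le> b n) \<and>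
        eventually (\<lambda>n. emeasure M {\<omega>\<in>space M. \<epsilon> \<le> \<bar>measure (P n \<omega>) A - measure H A\<bar>} \<le> ennreal (b n)) sequentially"
proof -
  interpret prob_space M by fact
  interpret H: prob_space H by fact
  have r: "1 \<le> r" using P[of 1] by (auto simp: is_GDP_def)
  define m where "m = min (measure H A) (1 - measure H A)"
  have m: "0 < m" "m \<le> measure H A" "m \<le> 1 - measure H A" using p by (auto simp: m_def)
  \<comment> \<open>Chernoff's bound requires \<open>measure H B + e\<close> < 1 for both
    \<open>B = A\<close> and \<open>B = - A\<close>; half the smaller mass leaves room for this, and
    a smaller deviation only enlarges the event.\<close>
  define e where "e = min \<epsilon> (m / 2)"
  have "e \<le> m / 2" unfolding e_def by (rule min.cobounded2)
  also have "m / 2 < m" using m(1) by simp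
  finally have "e < m" .
  have e: "0 < e" "e \<le> \<epsilon>" "measure H A + e < 1" "1 - measure H A + e < 1"
    using m \<epsilon> \<open>e < m\<close> by (auto simp: e_def)
  have compl: "measure H (- A) = 1 - measure H A"
    using H.prob_compl[of A] H(2) sets_eq_imp_space_eq[OF H(2)] by (simp add: Compl_eq_Diff_UNIV)
  define \<theta> where "\<theta> = max (gdp_rate r (measure H A) e) (gdp_rate r (measure H (- A)) e)"
  have \<theta>: "\<theta> < 0" unfolding \<theta>_def using r p e compl by (auto intro!: gdp_rate_neg)
  obtain b where b: "summable b" "\<And>n. 0 \<le> b n" "eventually (\<lambda>n. 2 * exp (real n powr \<tau> * \<theta>) \<le> b n) sequentially"
    using summable_powr_exp[OF \<tau> \<theta>] by blast
  have "eventually (\<lambda>n. emeasure M {\<omega>\<in>space M. \<epsilon> \<le> \<bar>measure (P n \<omega>) A - measure H A\<bar>} \<le> ennreal (b n)) sequentially"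
    using b(3) eventually_ge_at_top[of "1::nat"]
  proof eventually_elim
    case (elim n)
    have [measurable]: "P n \<in> M \<rightarrow>\<^sub>M prob_algebra borel"
      using P[OF elim(2)] by (auto simp: is_GDP_def random_prob_measure_def)
    have [measurable]: "(\<lambda>\<omega>. measure (P n \<omega>) B) \<in> borel_measurable M" if "B \<in> sets borel" for B
      using that by (intro measurable_compose[OF _ measurable_measure_prob_algebra]) auto
    have up: "emeasure M {\<omega>\<in>space M. measure H B + e \<le> measure (P n \<omega>) B} \<le> ennreal (exp (real n powr \<tau> * \<theta>))"
      if B: "B = A \<or> B = - A" for B
    proof -
      have "emeasure M {\<omega>\<in>space M. measure H B + e \<le> measure (P n \<omega>) B} \<le> ennreal (exp (real n powr \<tau> * gdp_rate r (measure H B) e))"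
        using B p e compl by (intro gdp_upper_deviation[OF M H P[OF elim(2)]]) auto
      also have "\<dots> \<le> ennreal (exp (real n powr \<tau> * \<theta>))"
        using B by (auto simp: \<theta>_def intro!: ennreal_leI mult_left_mono)
      finally show ?thesis .
    qed
    have Pc: "measure (P n \<omega>) (- A) = 1 - measure (P n \<omega>) A" if \<omega>: "\<omega> \<in> space M" for \<omega>
    proof -
      have "P n \<omega> \<in> space (prob_algebra borel)" using \<omega> by (rule measurable_space[rotated]) measurable
      hence s: "sets (P n \<omega>) = sets borel" and ps: "prob_space (P n \<omega>)" by (auto simp: space_prob_algebra)
      show ?thesis using prob_space.prob_compl[OF ps, of A] s sets_eq_imp_space_eq[OF s] by (simp add: Compl_eq_Diff_UNIV)
    qed
    have "emeasure M {\<omega>\<in>space M. \<epsilon> \<le> \<bar>measure (P n \<omega>) A - measure H A\<bar>}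
      \<le> emeasure M ({\<omega>\<in>space M. measure H A + e \<le> measure (P n \<omega>) A} \<union> {\<omega>\<in>space M. measure H (- A) + e \<le> measure (P n \<omega>) (- A)})"
      using e by (intro emeasure_mono) (auto simp: Pc compl abs_if split: if_splits)
    also have "\<dots> \<le> emeasure M {\<omega>\<in>space M. measure H A + e \<le> measure (P n \<omega>) A} + emeasure M {\<omega>\<in>space M. measure H (- A) + e \<le> measure (P n \<omega>) (- A)}"
      by (intro emeasure_subadditive) measurable
    also have "\<dots> \<le> ennreal (exp (real n powr \<tau> * \<theta>)) + ennreal (exp (real n powr \<tau> * \<theta>))"
      by (intro add_mono up) auto
    also have "\<dots> = ennreal (2 * exp (real n powr \<tau> * \<theta>))" by (simp flip: ennreal_plus)
    also have "\<dots> \<le> ennreal (b n)" using elim by (intro ennreal_leI)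
    finally show ?case .
  qed
  with b show ?thesis by blast
qed

theorem theorem4p3:
  fixes M :: "'w measure" and H :: "real measure" and \<tau> :: real
    and P :: "nat \<Rightarrow> 'w \<Rightarrow> real measure"
  assumes "prob_space M" and "complete_measure M"
    and "prob_space H" and "sets H = sets borel" and "nonatomic H"
    and "\<tau> > 0"
    and "(\<forall>n\<ge>1. is_DP M (real n powr \<tau>) H (P n)) \<or>
         (\<exists>g. unit_interval_laws g \<and> moment_assumption g \<and>
              (\<forall>n\<ge>1. is_DPG M (g (real n powr \<tau>)) H (P n))) \<or>
         (\<exists>b. \<forall>n\<ge>1. is_PDP M (real n powr \<tau>) b H (P n)) \<or>
         (\<forall>n\<ge>1. is_NIGP M (real n powr \<tau>) H (P n)) \<or>
         (\<exists>\<sigma>. \<forall>n\<ge>1. is_NGGP M \<sigma> (real n powr \<tau>) H (P n)) \<or>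
         (\<exists>r. \<forall>n\<ge>1. is_GDP M (real n powr \<tau>) r H (P n))"
  shows "AE \<omega> in M.
           (\<lambda>n. SUP x. \<bar>measure (P n \<omega>) {..x} - measure H {..x}\<bar>) \<longlonglongrightarrow> 0"
proof -
  note M = assms(1) and H = assms(3,4) and \<tau> = assms(6)
  interpret prob_space M by fact
  interpret H: prob_space H by fact
  have large: "eventually (\<lambda>n. Q (real n powr \<tau>)) sequentially" if "eventually Q at_top" for Q
    using filterlim_nat_powr_at_top[OF \<tau>] that by (auto simp: filterlim_iff)
  \<comment> \<open>Masses strictly between 0 and 1 are what the quantile half-lines have, and they
    make both cells of the generalized Dirichlet partition non-null.\<close>
  have dev: "\<exists>b. summable b \<and> (\<forall>n. 0 \<le> b n) \<and>
        eventually (\<lambda>n. emeasure M {\<omega>\<in>space M. \<epsilon> \<le> \<bar>measure (P n \<omega>) A - measure H A\<bar>} \<le> ennreal (b n)) sequentially"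
    if A: "A \<in> sets borel" "0 < measure H A" "measure H A < 1" and \<epsilon>: "0 < \<epsilon>" for A \<epsilon>
  proof -
    note sb = summable_stick_breaking_deviations[OF M A(1) \<epsilon> \<tau>]
    \<comment> \<open>\<open>s\<close> is the exponent of the singularity at 0, \<kappa> the tilt
      per unit of the parameter, and \<open>a0\<close> the threshold above which the tilt is
      available.\<close>
    have tilted: ?thesis
      if s: "s < 1" and \<kappa>: "0 < \<kappa>"
        and wmb: "\<And>q n. 1 \<le> n \<Longrightarrow> a0 \<le> real n powr \<tau> \<Longrightarrow> 2 \<le> q \<Longrightarrow> weight_moment_bound M H (P n) q
          (ennreal (12 * Gamma (real q + 1 - s) * (\<kappa> * real n powr \<tau>) powr (1 - real q)))"
      for s \<kappa> a0
    proof (rule sb[OF zero_less_one])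
      fix q :: nat assume q: "2 \<le> q"
      have "eventually (\<lambda>n. weight_moment_bound M H (P n) q
          (ennreal ((12 * Gamma (real q + 1 - s) * \<kappa> powr (1 - real q)) * (real n powr \<tau>) powr (1 * (1 - real q))))) sequentially"
        using large[OF eventually_ge_at_top[of a0]] eventually_ge_at_top[of 1]
        by eventually_elim (use wmb q in \<open>simp add: powr_mult mult.assoc\<close>)
      moreover have "0 \<le> 12 * Gamma (real q + 1 - s) * \<kappa> powr (1 - real q)"
        using s by (intro mult_nonneg_nonneg Gamma_real_nonneg) auto
      ultimately show "\<exists>K\<ge>0. eventually (\<lambda>n. weight_moment_bound M H (P n) q
          (ennreal (K * (real n powr \<tau>) powr (1 * (1 - real q))))) sequentially"
        by blast
    qed
    consider (DP) "\<forall>n\<ge>1. is_DP M (real n powr \<tau>) H (P n)"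
      | (DPG) g where "unit_interval_laws g" "moment_assumption g" "\<forall>n\<ge>1. is_DPG M (g (real n powr \<tau>)) H (P n)"
      | (PDP) b where "\<forall>n\<ge>1. is_PDP M (real n powr \<tau>) b H (P n)"
      | (NIGP) "\<forall>n\<ge>1. is_NIGP M (real n powr \<tau>) H (P n)"
      | (NGGP) \<sigma> where "\<forall>n\<ge>1. is_NGGP M \<sigma> (real n powr \<tau>) H (P n)"
      | (GDP) r where "\<forall>n\<ge>1. is_GDP M (real n powr \<tau>) r H (P n)"
      using assms(7) by blast
    thus ?thesis
    proof cases
      case DP
      show ?thesis
        by (rule tilted[of 0 "1 / 2" 2]) (use DP_weight_moment_bound[OF M] DP in auto)
    next
      case DPG
      obtain k where k: "0 < k" "\<And>q. 1 \<le> q \<Longrightarrow> \<exists>C\<ge>0. eventually (\<lambda>a. (\<integral>x. x ^ q \<partial>g a) \<le> C * a powr (- k * (real q - 1)) * (\<integral>x. x \<partial>g a)) at_top"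
        using moment_assumption_ratio[OF DPG(1,2)] by blast
      show ?thesis
      proof (rule sb[OF k(1)])
        fix q :: nat assume q: "2 \<le> q"
        then obtain C where C: "0 \<le> C" "eventually (\<lambda>a. (\<integral>x. x ^ q \<partial>g a) \<le> C * a powr (- k * (real q - 1)) * (\<integral>x. x \<partial>g a)) at_top"
          using k(2)[of q] by auto
        have "eventually (\<lambda>n. weight_moment_bound M H (P n) q
            (ennreal (C * (real n powr \<tau>) powr (k * (1 - real q))))) sequentially"
          using large[OF C(2)] eventually_ge_at_top[of 1]
        proof eventually_elim
          case (elim n)
          have e: "- k * (real q - 1) = k * (1 - real q)" by (simp add: algebra_simps)
          show ?case using q C(1) elim unfolding e
            by (intro DPG_weight_moment_bound[OF M DPG(3)[rule_format, OF elim(2)] DPG(1)]) auto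
        qed
        thus "\<exists>K\<ge>0. eventually (\<lambda>n. weight_moment_bound M H (P n) q
            (ennreal (K * (real n powr \<tau>) powr (k * (1 - real q))))) sequentially"
          using C(1) by blast
      qed
    next
      case PDP
      hence "b < 1" by (auto simp: is_PDP_def)
      thus ?thesis
        by (rule tilted[of b "1 / 2" 2]) (use PDP_weight_moment_bound[OF M] PDP in auto)
    next
      case NIGP
      show ?thesis
        by (rule tilted[of "1 / 2" "1 / 4" 4]) (use NIGP_weight_moment_bound[OF M] NIGP in auto)
    next
      case NGGP
      hence "0 < \<sigma>" "\<sigma> < 1" by (auto simp: is_NGGP_def)
      thus ?thesis
        by (intro tilted[of \<sigma> "\<sigma> / 2" "2 / \<sigma>"]) (use NGGP_weight_moment_bound[OF M] NGGP in auto)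
    next
      case GDP
      show ?thesis using GDP by (intro summable_gdp_deviations[OF M H \<tau> _ A \<epsilon>]) auto
    qed
  qed

  have rpm: "P n \<in> M \<rightarrow>\<^sub>M prob_algebra borel" if "1 \<le> n" for n
    using assms(7) that
    by (auto simp: is_DP_def is_DPG_def is_PDP_def is_NIGP_def is_NGGP_def is_GDP_def
      stick_breaking_def random_prob_measure_def)
  obtain X where X: "\<And>y. 0 < y \<Longrightarrow> y < 1 \<Longrightarrow> measure H {..X y} = y"
    using nonatomic_surj_cdf[OF H assms(5)] by metis
  have "AE \<omega> in M. \<forall>k i. 0 < i \<longrightarrow> i < k \<longrightarrow>
      (\<lambda>n. measure (P n \<omega>) {..X (real i / real k)}) \<longlonglongrightarrow> real i / real k"
  proof (intro AE_all_countable[THEN iffD2] allI)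
    fix k i :: nat
    show "AE \<omega> in M. 0 < i \<longrightarrow> i < k \<longrightarrow>
      (\<lambda>n. measure (P n \<omega>) {..X (real i / real k)}) \<longlonglongrightarrow> real i / real k"
    proof (cases "0 < i \<and> i < k")
      case True
      hence y: "0 < real i / real k" "real i / real k < 1" by auto
      have "AE \<omega> in M. (\<lambda>n. measure (P n \<omega>) {..X (real i / real k)}) \<longlonglongrightarrow> real i / real k"
      proof (rule AE_tendsto_of_summable_deviations[OF M])
        show "(\<lambda>\<omega>. measure (P n \<omega>) {..X (real i / real k)}) \<in> borel_measurable M" if "1 \<le> n" for n
          by (rule measurable_compose[OF rpm[OF that] measurable_measure_prob_algebra]) simp
      qed (use dev[of "{..X (real i / real k)}"] X[OF y] y in auto)
      thus ?thesis by eventually_elim simp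
    qed auto
  qed
  thus ?thesis using AE_space
  proof eventually_elim
    case (elim \<omega>)
    \<comment> \<open>The index is shifted because \<open>P 0 \<omega>\<close> need not be a
      probability measure; a limit is insensitive to this.\<close>
    let ?G = "\<lambda>n x. measure (P (Suc n) \<omega>) {..x}"
    have ps: "prob_space (P (Suc n) \<omega>)" "sets (P (Suc n) \<omega>) = sets borel" for n
      using measurable_space[OF rpm[of "Suc n"] elim(2)] by (auto simp: space_prob_algebra)
    have "(\<lambda>n. SUP x. \<bar>?G n x - measure H {..x}\<bar>) \<longlonglongrightarrow> 0"
    proof (rule uniform_convergence_of_quantiles[where X = X])
      show "mono (?G n)" for n
        using ps[of n] by (intro monoI finite_measure.finite_measure_mono) (auto simp: prob_space_def)
      show "0 \<le> ?G n x \<and> ?G n x \<le> 1" for n x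
        using ps[of n] by (auto intro: prob_space.prob_le_1)
      show "mono (\<lambda>x. measure H {..x})"
        using H by (intro monoI H.finite_measure_mono) auto
      show "(\<lambda>n. ?G n (X (real i / real k))) \<longlonglongrightarrow> real i / real k" if "0 < i" "i < k" for i k
        using elim(1) that by (intro LIMSEQ_Suc) blast
    qed (auto intro!: X)
    thus ?case by (rule LIMSEQ_imp_Suc)
  qed
qed

end
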